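(* Let $\mathcal{A}_1$ and $\mathcal{A}_2$ be line arrangements in $\mathbb{P}^2_{\mathbb{C}}$ with $|\mathcal{A}_1|=|\mathcal{A}_2|\le 8$ and $I(\mathcal{A}_1)=I(\mathcal{A}_2)$. Then the pairs $(\mathbb{P}^2_{\mathbb{C}},\bigcup_{H\in\mathcal{A}_1}H)$ and $(\mathbb{P}^2_{\mathbb{C}},\bigcup_{H\in\mathcal{A}_2}H)$ are homeomorphic. Consequently $\pi_1(M(\mathcal{A}_1))\cong\pi_1(M(\mathcal{A}_2))$.
   Context: Arrangements are numbered, $\mathcal{A}=\{H_1,\dots,H_n\}$, and the incidence is $I(\mathcal{A})=\{\{i,j,k\}\subset\{1,\dots,n\}: i,j,k\text{ distinct},\ H_i\cap H_j\cap H_k\ne\emptyset\}$. $M(\mathcal{A})=\mathbb{P}^2\setminus\bigcup_{H\in\mathcal{A}}H$ is the complement. *)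

theory Defs
  imports "HOL-Analysis.Analysis" "HOL-Algebra.Group"
begin

definition proj_pt :: "complex^3 \<Rightarrow> (complex^3) set" where
  "proj_pt v = {c *s v | c. c \<noteq> 0}"

definition P2 :: "(complex^3) set set" where
  "P2 = proj_pt ` (UNIV - {0})"

definition P2_top :: "(complex^3) set topology" where
  "P2_top = topology (\<lambda>U. U \<subseteq> P2 \<and> open {v. v \<noteq> 0 \<and> proj_pt v \<in> U})"

definition proj_line :: "complex^3 \<Rightarrow> (complex^3) set set" where
  "proj_line a = {proj_pt v | v. v \<noteq> 0 \<and> (\<Sum>i\<in>UNIV. a $ i * v $ i) = 0}"

definition line_arrangement :: "nat \<Rightarrow> (nat \<Rightarrow> complex^3) \<Rightarrow> bool" where
  "line_arrangement n a \<longleftrightarrow>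
     (\<forall>i<n. a i \<noteq> 0) \<and>
     (\<forall>i<n. \<forall>j<n. i \<noteq> j \<longrightarrow> proj_line (a i) \<noteq> proj_line (a j))"

definition arr_union :: "nat \<Rightarrow> (nat \<Rightarrow> complex^3) \<Rightarrow> (complex^3) set set" where
  "arr_union n a = (\<Union>i<n. proj_line (a i))"

text \<open>Incidence I(A), indices 1..n (as in the paper).\<close>
definition incidence :: "nat \<Rightarrow> (nat \<Rightarrow> complex^3) \<Rightarrow> nat set set" where
  "incidence n a = {{i, j, k} | i j k. i \<in> {1..n} \<and> j \<in> {1..n} \<and> k \<in> {1..n} \<and>
      i \<noteq> j \<and> j \<noteq> k \<and> i \<noteq> k \<and>
      proj_line (a (i - 1)) \<inter> proj_line (a (j - 1)) \<inter> proj_line (a (k - 1)) \<noteq> {}}"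

definition complement_top :: "nat \<Rightarrow> (nat \<Rightarrow> complex^3) \<Rightarrow> (complex^3) set topology" where
  "complement_top n a = subtopology P2_top (P2 - arr_union n a)"

definition join_path :: "(real \<Rightarrow> 'a) \<Rightarrow> (real \<Rightarrow> 'a) \<Rightarrow> real \<Rightarrow> 'a" where
  "join_path g h t = (if t \<le> 1/2 then g (2 * t) else h (2 * t - 1))"

definition loops_at :: "'a topology \<Rightarrow> 'a \<Rightarrow> (real \<Rightarrow> 'a) set" where
  "loops_at X x = {g. pathin X g \<and> g 0 = x \<and> g 1 = x}"

definition path_homotopic_in :: "'a topology \<Rightarrow> (real \<Rightarrow> 'a) \<Rightarrow> (real \<Rightarrow> 'a) \<Rightarrow> bool" where
  "path_homotopic_in X g h \<longleftrightarrow>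
     pathin X g \<and> pathin X h \<and>
     homotopic_with (\<lambda>p. p 0 = g 0 \<and> p 1 = g 1) (top_of_set {0..1}) X g h"

definition loop_class :: "'a topology \<Rightarrow> 'a \<Rightarrow> (real \<Rightarrow> 'a) \<Rightarrow> (real \<Rightarrow> 'a) set" where
  "loop_class X x g = {h \<in> loops_at X x. path_homotopic_in X g h}"

definition fundamental_group :: "'a topology \<Rightarrow> 'a \<Rightarrow> (real \<Rightarrow> 'a) set monoid" where
  "fundamental_group X x =
     \<lparr> carrier = loop_class X x ` loops_at X x,
       mult = (\<lambda>A B. loop_class X x (join_path (SOME g. g \<in> A) (SOME h. h \<in> B))),
       one = loop_class X x (\<lambda>t. x) \<rparr>"

end

(*
  Local triviality: if the lines of an arrangement are moved slightly without destroying a concurrent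
  triple, an explicit C^*-homogeneous perturbation of the identity of C^3 with small Lipschitz constant
  is a homeomorphism carrying each line onto its new position.  So the topological type is constant
  along connected families of arrangements with constant incidence.

  Connectedness: if some line of the arrangement carries at most two points of multiplicity >= 3,
  then it is generic, or a member of a pencil, or determined by two intersection points of the others,
  so a polynomial curve joining two realizations of the other lines extends to this line.  Such a curve
  has the right incidence for all but finitely many complex parameters, and C minus a finite set is
  connected.  With at most eight lines, only two incidences have three multiple points on every line:
  the Fano plane, which has no complex realization, and the configuration 8_3, whose realizations
  (the MacLane arrangements) form two projective classes exchanged by complex conjugation.
*)

theory Submission
  imports Defs
begin

text \<open>A line is treated through its coefficient vector in the bilinear pairing
  \<open>dot\<close>: \<open>crs\<close> of two lines is their common point, \<open>crs\<close> of
  two points is their line, and \<open>det3 = 0\<close> is concurrency. The obstacle to extending a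
  deformation line by line is degeneration: between two good realizations, lines may coincide or
  acquire extra concurrences. \<open>deformable\<close> therefore asks at every parameter only for
  the closed conditions, that prescribed triples stay concurrent. The open ones hold at the two
  ends, hence off a finite set since everything is polynomial. Ends are met only up to nonzero
  factors because \<open>crs\<close> replaces division. The local homeomorphism is built on C^3, and
  homogeneity makes it descend. Its weights have degree zero and may jump at the origin, but
  multiplied by Lipschitz terms vanishing there they give Lipschitz maps of small constant, so the
  contraction principle inverts the perturbed identity. Three multiple points on a line need six
  further lines, so removing lines one by one can get stuck only at seven or eight lines.\<close>

section \<open>Linear algebra of coefficient vectors\<close>

definition dot :: "complex^3 \<Rightarrow> complex^3 \<Rightarrow> complex" where
  "dot a v = (\<Sum>i\<in>UNIV. a $ i * v $ i)"

text \<open>\<open>dot\<close> is bilinear, not Hermitian; conjugating one argument recovers the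
  squared norm (\<open>dot_cnjv_self\<close>) and with it orthogonal projections.\<close>

definition cnjv :: "complex^3 \<Rightarrow> complex^3" where
  "cnjv a = (\<chi> i. cnj (a $ i))"

definition crs :: "complex^3 \<Rightarrow> complex^3 \<Rightarrow> complex^3" where
  "crs a b = vector [a$2 * b$3 - a$3 * b$2, a$3 * b$1 - a$1 * b$3, a$1 * b$2 - a$2 * b$1]"

definition det3 :: "complex^3 \<Rightarrow> complex^3 \<Rightarrow> complex^3 \<Rightarrow> complex" where
  "det3 a b c = dot a (crs b c)"

lemma dot_3: "dot a v = a$1 * v$1 + a$2 * v$2 + a$3 * v$3"
  by (simp add: dot_def sum_3)

lemma crs_nth [simp]:
  "crs a b $ 1 = a$2 * b$3 - a$3 * b$2"
  "crs a b $ 2 = a$3 * b$1 - a$1 * b$3"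
  "crs a b $ 3 = a$1 * b$2 - a$2 * b$1"
  by (simp_all add: crs_def)

lemma vec3_eq_iff: "(a::complex^3) = b \<longleftrightarrow> a$1 = b$1 \<and> a$2 = b$2 \<and> a$3 = b$3"
  by (simp add: vec_eq_iff forall_3)

lemma det3_alt: "det3 a b c = a$1 * (b$2 * c$3 - b$3 * c$2) + a$2 * (b$3 * c$1 - b$1 * c$3) + a$3 * (b$1 * c$2 - b$2 * c$1)"
  by (simp add: det3_def dot_3)

lemma dot_linear:
  "dot (a + b) v = dot a v + dot b v" "dot (a - b) v = dot a v - dot b v"
  "dot a (v + w) = dot a v + dot a w" "dot a (v - w) = dot a v - dot a w"
  "dot (c *s a) v = c * dot a v" "dot a (c *s v) = c * dot a v"
  "dot 0 v = 0" "dot a 0 = 0" "dot a (- v) = - dot a v" "dot (-a) v = - dot a v"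
  by (simp_all add: dot_3 algebra_simps)

lemma dot_sum: "dot a (\<Sum>i\<in>I. f i) = (\<Sum>i\<in>I. dot a (f i))"
  by (induction I rule: infinite_finite_induct) (simp_all add: dot_linear)

lemma crs_eq_0_iff:
  assumes "a \<noteq> 0" "b \<noteq> 0"
  shows "crs a b = 0 \<longleftrightarrow> (\<exists>c. c \<noteq> 0 \<and> b = c *s a)"
proof
  assume *: "crs a b = 0"
  then have e: "a$2 * b$3 = a$3 * b$2" "a$3 * b$1 = a$1 * b$3" "a$1 * b$2 = a$2 * b$1"
    by (simp_all add: vec3_eq_iff)
  consider "a$1 \<noteq> 0" | "a$2 \<noteq> 0" | "a$3 \<noteq> 0" using assms(1) by (auto simp: vec3_eq_iff)
  then have "\<exists>c. b = c *s a"
  proof cases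
    case 1 then show ?thesis using e by (intro exI[of _ "b$1/a$1"]) (auto simp: vec3_eq_iff field_simps)
  next
    case 2 then show ?thesis using e by (intro exI[of _ "b$2/a$2"]) (auto simp: vec3_eq_iff field_simps)
  next
    case 3 then show ?thesis using e by (intro exI[of _ "b$3/a$3"]) (auto simp: vec3_eq_iff field_simps)
  qed
  then show "\<exists>c. c \<noteq> 0 \<and> b = c *s a" using assms by auto
next
  assume "\<exists>c. c \<noteq> 0 \<and> b = c *s a"
  then show "crs a b = 0" by (auto simp: vec3_eq_iff)
qed

lemma crs_crs: "crs (crs a b) v = dot a v *s b - dot b v *s a"
  by (simp add: vec3_eq_iff dot_3 algebra_simps)

text \<open>The double cross product formula \<open>crs_crs\<close> makes \<open>v\<close> parallel
  to \<open>crs a b\<close>: two distinct lines share only one point. The zero vector is covered by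
  \<open>c = 0\<close>.\<close>

lemma crs_neq_0_lin:
  assumes "crs a b \<noteq> 0" "dot a v = 0" "dot b v = 0"
  shows "\<exists>c. v = c *s crs a b"
proof -
  have "crs (crs a b) v = 0"
    using crs_crs[of a b v] assms(2,3) by simp
  then show ?thesis using crs_eq_0_iff[of "crs a b" v] assms(1)
    by (cases "v = 0") (auto intro: exI[of _ 0])
qed

lemma dot_crs_self [simp]: "dot a (crs a b) = 0" "dot b (crs a b) = 0"
  by (simp_all add: dot_3 algebra_simps)

lemma det3_perm: "det3 b a c = - det3 a b c" "det3 a c b = - det3 a b c"
  "det3 c b a = - det3 a b c"  "det3 b c a = det3 a b c" "det3 c a b = det3 a b c"
  by (simp_all add: det3_alt algebra_simps)

lemma det3_refl [simp]: "det3 a a c = 0" "det3 a c a = 0" "det3 c a a = 0"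
  by (simp_all add: det3_alt algebra_simps)

lemma det3_eq_0_iff:
  assumes "crs a b \<noteq> 0"
  shows "det3 a b c = 0 \<longleftrightarrow> (\<exists>x y. c = x *s a + y *s b)"
proof
  assume d: "det3 a b c = 0"
  let ?p = "crs a b"
  \<comment> \<open>Each coordinate of \<open>crs a b\<close> is a 2x2 minor and serves as the pivot
    of Cramer's rule; the error is \<open>det3 a b c\<close>, placed in that one coordinate.\<close>
  have cramer:
    "?p$1 *s c = (c$2 * b$3 - c$3*b$2) *s a + (a$2 * c$3 - a$3 * c$2) *s b + vector [det3 a b c, 0, 0]"
    "?p$2 *s c = (c$3 * b$1 - c$1*b$3) *s a + (a$3 * c$1 - a$1 * c$3) *s b + vector [0, det3 a b c, 0]"
    "?p$3 *s c = (c$1 * b$2 - c$2*b$1) *s a + (a$1 * c$2 - a$2 * c$1) *s b + vector [0, 0, det3 a b c]"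
    by (simp_all add: vec3_eq_iff det3_alt algebra_simps)
  have divide: "c = (x/q) *s a + (y/q) *s b" if "q *s c = x *s a + y *s b" "q \<noteq> 0" for q x y
  proof -
    have "c = inverse q *s (q *s c)" using that(2) by simp
    then show ?thesis unfolding that(1) by (simp add: vec3_eq_iff field_simps)
  qed
  have z: "vector [0, 0, 0] = (0::complex^3)" by (simp add: vec3_eq_iff)
  consider "?p$1 \<noteq> 0" | "?p$2 \<noteq> 0" | "?p$3 \<noteq> 0" using assms by (auto simp: vec3_eq_iff)
  then show "\<exists>x y. c = x *s a + y *s b"
  proof cases
    case 1
    have "?p$1 *s c = (c$2 * b$3 - c$3*b$2) *s a + (a$2 * c$3 - a$3 * c$2) *s b"
      using cramer d by (simp add: z)
    then have "c = ((c$2 * b$3 - c$3*b$2)/?p$1) *s a + ((a$2 * c$3 - a$3 * c$2)/?p$1) *s b"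
      using 1 by (intro divide)
    then show ?thesis by blast
  next
    case 2
    have "?p$2 *s c = (c$3 * b$1 - c$1*b$3) *s a + (a$3 * c$1 - a$1 * c$3) *s b"
      using cramer d by (simp add: z)
    then have "c = ((c$3 * b$1 - c$1*b$3)/?p$2) *s a + ((a$3 * c$1 - a$1 * c$3)/?p$2) *s b"
      using 2 by (intro divide)
    then show ?thesis by blast
  next
    case 3
    have "?p$3 *s c = (c$1 * b$2 - c$2*b$1) *s a + (a$1 * c$2 - a$2 * c$1) *s b"
      using cramer d by (simp add: z)
    then have "c = ((c$1 * b$2 - c$2*b$1)/?p$3) *s a + ((a$1 * c$2 - a$2 * c$1)/?p$3) *s b"
      using 3 by (intro divide)
    then show ?thesis by blast
  qed
next
  assume "\<exists>x y. c = x *s a + y *s b"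
  then show "det3 a b c = 0" by (auto simp: det3_alt algebra_simps)
qed

text \<open>Both \<open>j\<close> and \<open>l\<close> lie in the span of the independent vectors
  \<open>h\<close> and \<open>k\<close>, so \<open>h\<close>, \<open>j\<close>, \<open>l\<close>
  span at most a plane. Geometrically, meeting \<open>h\<close> in the same point is
  transitive.\<close>

lemma det3_trans:
  assumes "crs h k \<noteq> 0" "det3 h j k = 0" "det3 h k l = 0"
  shows "det3 h j l = 0"
proof -
  have "det3 h k j = 0" using assms(2) det3_perm(2)[where a=h and b=j and c=k] by simp
  then obtain x y where j: "j = x *s h + y *s k" using det3_eq_0_iff[OF assms(1)] by blast
  obtain x' y' where l: "l = x' *s h + y' *s k" using det3_eq_0_iff[OF assms(1)] assms(3) by blast
  show ?thesis unfolding j l by (simp add: det3_alt algebra_simps)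
qed

lemma ex_common_zero_iff:
  "(\<exists>v. v \<noteq> 0 \<and> dot a v = 0 \<and> dot b v = 0 \<and> dot c v = 0) \<longleftrightarrow> det3 a b c = 0"
  if nz: "crs a b \<noteq> 0"
proof
  assume "\<exists>v. v \<noteq> 0 \<and> dot a v = 0 \<and> dot b v = 0 \<and> dot c v = 0"
  then obtain v where v: "v \<noteq> 0" "dot a v = 0" "dot b v = 0" "dot c v = 0" by blast
  then obtain k where k: "v = k *s crs a b" using crs_neq_0_lin[OF nz] by blast
  then have "k * det3 c a b = 0" using v by (simp add: dot_linear det3_def)
  moreover have "k \<noteq> 0" using k v by auto
  ultimately show "det3 a b c = 0" using det3_perm(5)[where a=a and b=b and c=c] by simp
next
  assume "det3 a b c = 0"
  then have "dot c (crs a b) = 0" using det3_perm(5)[where a=a and b=b and c=c] by (simp add: det3_def)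
  then show "\<exists>v. v \<noteq> 0 \<and> dot a v = 0 \<and> dot b v = 0 \<and> dot c v = 0"
    using nz by (intro exI[of _ "crs a b"]) auto
qed

section \<open>Projective points and lines\<close>

lemma self_in_proj_pt: "v \<in> proj_pt v"
  by (auto simp: proj_pt_def intro: exI[of _ 1])

lemma proj_pt_eq_iff: "proj_pt v = proj_pt w \<longleftrightarrow> (\<exists>c. c \<noteq> 0 \<and> w = c *s v)"
proof
  assume "proj_pt v = proj_pt w"
  then have "w \<in> proj_pt v" using self_in_proj_pt by metis
  then show "\<exists>c. c \<noteq> 0 \<and> w = c *s v" by (auto simp: proj_pt_def)
next
  assume "\<exists>c. c \<noteq> 0 \<and> w = c *s v"
  then obtain c where c: "c \<noteq> 0" "w = c *s v" by blast
  have "d *s v \<in> proj_pt w" if "d \<noteq> 0" for d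
    using c that by (auto simp: proj_pt_def intro!: exI[of _ "d/c"])
  moreover have "d *s w \<in> proj_pt v" if "d \<noteq> 0" for d
    using c that by (auto simp: proj_pt_def)
  ultimately show "proj_pt v = proj_pt w" by (auto simp: proj_pt_def)
qed

lemma proj_line_dot: "proj_line a = {proj_pt v | v. v \<noteq> 0 \<and> dot a v = 0}"
  by (simp add: proj_line_def dot_def)

lemma proj_pt_in_line_iff: "v \<noteq> 0 \<Longrightarrow> proj_pt v \<in> proj_line a \<longleftrightarrow> dot a v = 0"
  unfolding proj_line_dot by (auto simp: proj_pt_eq_iff dot_linear)

lemma proj_line_subset: "proj_line a \<subseteq> P2"
  by (auto simp: proj_line_dot P2_def)

lemma proj_line_scale: "c \<noteq> 0 \<Longrightarrow> proj_line (c *s a) = proj_line a"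
  by (simp add: proj_line_dot dot_linear)

lemma proj_line_eq_iff:
  assumes "a \<noteq> 0" "b \<noteq> 0"
  shows "proj_line a = proj_line b \<longleftrightarrow> crs a b = 0"
proof
  assume eq: "proj_line a = proj_line b"
  have imp: "dot a v = 0 \<Longrightarrow> dot b v = 0" for v
    using eq proj_pt_in_line_iff[of v a] proj_pt_in_line_iff[of v b] by (cases "v = 0") (auto simp: dot_linear)
  \<comment> \<open>These three vectors are annihilated by \<open>a\<close>, and their values under
    \<open>b\<close> are, up to sign, the coordinates of \<open>crs a b\<close>.\<close>
  have "dot b (vector [0, a$3, - a$2]) = 0" "dot b (vector [- a$3, 0, a$1]) = 0" "dot b (vector [a$2, - a$1, 0]) = 0"
    by (intro imp; simp add: dot_3)+
  then show "crs a b = 0" by (simp add: dot_3 vec3_eq_iff algebra_simps)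
next
  assume "crs a b = 0"
  then show "proj_line a = proj_line b" using crs_eq_0_iff assms proj_line_scale by metis
qed

lemma line_arrangement_iff:
  "line_arrangement n a \<longleftrightarrow> (\<forall>i<n. a i \<noteq> 0) \<and> (\<forall>i<n. \<forall>j<n. i \<noteq> j \<longrightarrow> crs (a i) (a j) \<noteq> 0)"
  unfolding line_arrangement_def by (auto simp: proj_line_eq_iff)

lemma lines_meet_iff:
  assumes "crs a b \<noteq> 0"
  shows "proj_line a \<inter> proj_line b \<inter> proj_line c \<noteq> {} \<longleftrightarrow> det3 a b c = 0"
proof -
  have "proj_line a \<inter> proj_line b \<inter> proj_line c \<noteq> {} \<longleftrightarrow> (\<exists>v. v \<noteq> 0 \<and> dot a v = 0 \<and> dot b v = 0 \<and> dot c v = 0)"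
  proof
    assume "proj_line a \<inter> proj_line b \<inter> proj_line c \<noteq> {}"
    then obtain v where "v \<noteq> 0" "proj_pt v \<in> proj_line a" "proj_pt v \<in> proj_line b" "proj_pt v \<in> proj_line c"
      by (auto simp: proj_line_dot)
    then show "\<exists>v. v \<noteq> 0 \<and> dot a v = 0 \<and> dot b v = 0 \<and> dot c v = 0"
      using proj_pt_in_line_iff by blast
  next
    assume "\<exists>v. v \<noteq> 0 \<and> dot a v = 0 \<and> dot b v = 0 \<and> dot c v = 0"
    then obtain v where "v \<noteq> 0" "dot a v = 0" "dot b v = 0" "dot c v = 0" by blast
    then have "proj_pt v \<in> proj_line a \<inter> proj_line b \<inter> proj_line c"
      using proj_pt_in_line_iff by blast
    then show "proj_line a \<inter> proj_line b \<inter> proj_line c \<noteq> {}" by blast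
  qed
  then show ?thesis using ex_common_zero_iff[OF assms] by simp
qed

lemma incidence_iff_det3:
  assumes "line_arrangement n a" "i < n" "j < n" "k < n" "i \<noteq> j" "j \<noteq> k" "i \<noteq> k"
  shows "{Suc i, Suc j, Suc k} \<in> incidence n a \<longleftrightarrow> det3 (a i) (a j) (a k) = 0"
proof -
  have nz: "crs (a i) (a j) \<noteq> 0" using assms(1-3,5) by (simp add: line_arrangement_iff)
  show ?thesis
  proof
    assume "det3 (a i) (a j) (a k) = 0"
    then have "proj_line (a i) \<inter> proj_line (a j) \<inter> proj_line (a k) \<noteq> {}"
      using lines_meet_iff[OF nz] by simp
    then show "{Suc i, Suc j, Suc k} \<in> incidence n a"
      unfolding incidence_def using assms(2-)
      by (intro CollectI exI[of _ "Suc i"] exI[of _ "Suc j"] exI[of _ "Suc k"]) simp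
  next
    assume "{Suc i, Suc j, Suc k} \<in> incidence n a"
    then obtain i' j' k' where e: "{Suc i, Suc j, Suc k} = {i', j', k'}" "i' \<noteq> j'" "j' \<noteq> k'" "i' \<noteq> k'"
      and ne: "proj_line (a (i' - 1)) \<inter> proj_line (a (j' - 1)) \<inter> proj_line (a (k' - 1)) \<noteq> {}"
      unfolding incidence_def by blast
    \<comment> \<open>Members of \<open>incidence\<close> are unordered and count from 1. Shifting
      back by one and intersecting over the whole index set avoids treating the possible orders of
      \<open>i'\<close>, \<open>j'\<close>, \<open>k'\<close> separately.\<close>
    have "(\<lambda>m. m - 1) ` {Suc i, Suc j, Suc k} = (\<lambda>m. m - 1) ` {i', j', k'}" by (simp only: e(1))
    then have "{i, j, k} = {i' - 1, j' - 1, k' - 1}" by (simp only: image_insert image_empty diff_Suc_1)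
    then have "(\<Inter>m\<in>{i,j,k}. proj_line (a m)) = (\<Inter>m\<in>{i' - 1, j' - 1, k' - 1}. proj_line (a m))" by (rule arg_cong)
    then have "proj_line (a i) \<inter> proj_line (a j) \<inter> proj_line (a k) \<noteq> {}" using ne
      by (simp only: INT_insert Int_assoc INT_empty Int_UNIV_right not_False_eq_True)
    then show "det3 (a i) (a j) (a k) = 0"
      using lines_meet_iff[OF nz] by simp
  qed
qed

section \<open>Homeomorphisms of the projective plane\<close>

lemma istopology_P2: "istopology (\<lambda>U. U \<subseteq> P2 \<and> open {v. v \<noteq> 0 \<and> proj_pt v \<in> U})"
  unfolding istopology_def
proof (rule conjI; intro allI impI)
  fix S T assume S: "S \<subseteq> P2 \<and> open {v. v \<noteq> 0 \<and> proj_pt v \<in> S}"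
    and T: "T \<subseteq> P2 \<and> open {v. v \<noteq> 0 \<and> proj_pt v \<in> T}"
  have "{v. v \<noteq> 0 \<and> proj_pt v \<in> S \<inter> T} = {v. v \<noteq> 0 \<and> proj_pt v \<in> S} \<inter> {v. v \<noteq> 0 \<and> proj_pt v \<in> T}" by auto
  then show "S \<inter> T \<subseteq> P2 \<and> open {v. v \<noteq> 0 \<and> proj_pt v \<in> S \<inter> T}" using S T by auto
next
  fix K assume K: "\<forall>S\<in>K. S \<subseteq> P2 \<and> open {v. v \<noteq> 0 \<and> proj_pt v \<in> S}"
  have "{v. v \<noteq> 0 \<and> proj_pt v \<in> \<Union>K} = (\<Union>S\<in>K. {v. v \<noteq> 0 \<and> proj_pt v \<in> S})" by auto
  then show "\<Union>K \<subseteq> P2 \<and> open {v. v \<noteq> 0 \<and> proj_pt v \<in> \<Union>K}" using K by auto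
qed

lemma openin_P2_top: "openin P2_top U \<longleftrightarrow> U \<subseteq> P2 \<and> open {v. v \<noteq> 0 \<and> proj_pt v \<in> U}"
  unfolding P2_top_def using istopology_P2 by (simp add: topology_inverse')

lemma topspace_P2_top [simp]: "topspace P2_top = P2"
proof -
  have "{v. v \<noteq> 0 \<and> proj_pt v \<in> P2} = - {0}" by (auto simp: P2_def)
  then have "openin P2_top P2" by (simp add: openin_P2_top open_Compl)
  then show ?thesis using openin_P2_top by (metis openin_subset openin_topspace subset_antisym)
qed

lemma proj_pt_in_P2 [simp]: "v \<noteq> 0 \<Longrightarrow> proj_pt v \<in> P2"
  by (simp add: P2_def)

text \<open>Points of \<open>P2\<close> are punctured complex lines in C^3, so a bijection of C^3
  acts on them by taking images. Asking in \<open>pt\<close> only that such sets go onto such sets,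
  rather than linearity, admits the homogeneous perturbations as well as complex
  conjugation.\<close>

lemma homeomorphic_map_P2:
  fixes f g :: "complex^3 \<Rightarrow> complex^3"
  assumes cont: "continuous_on UNIV f" "continuous_on UNIV g"
    and inv: "\<And>v. g (f v) = v" "\<And>v. f (g v) = v" and zero: "f 0 = 0"
    and pt: "\<And>v. f ` proj_pt v = proj_pt (f v)"
  shows "homeomorphic_map P2_top P2_top (\<lambda>X. f ` X)"
proof -
  have g0: "g 0 = 0" using inv zero by metis
  have f0: "f v \<noteq> 0" if "v \<noteq> 0" for v using that inv g0 by metis
  have g0': "g v \<noteq> 0" if "v \<noteq> 0" for v using that inv zero by metis
  have ptg: "g ` proj_pt v = proj_pt (g v)" for v
  proof -
    have "g ` proj_pt (f (g v)) = g ` f ` proj_pt (g v)" by (simp add: pt)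
    then show ?thesis by (simp add: inv image_image)
  qed
  have cm: "continuous_map P2_top P2_top (\<lambda>X. h ` X)"
    if h: "continuous_on UNIV h" "\<And>v. h ` proj_pt v = proj_pt (h v)" "\<And>v. v \<noteq> 0 \<Longrightarrow> h v \<noteq> 0" "h 0 = 0"
    for h :: "complex^3 \<Rightarrow> complex^3"
    unfolding continuous_map_def
  proof (intro conjI allI impI)
    show "(`) h \<in> topspace P2_top \<rightarrow> topspace P2_top"
      using h(2,3) by (auto simp: P2_def intro!: imageI)
  next
    fix U assume "openin P2_top U"
    then have U: "U \<subseteq> P2" "open {v. v \<noteq> 0 \<and> proj_pt v \<in> U}" by (auto simp: openin_P2_top)
    have "{v. v \<noteq> 0 \<and> proj_pt v \<in> {x \<in> topspace P2_top. h ` x \<in> U}} = h -` {v. v \<noteq> 0 \<and> proj_pt v \<in> U}"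
      using h(2-4) U(1) by (auto intro!: proj_pt_in_P2)
    then show "openin P2_top {x \<in> topspace P2_top. h ` x \<in> U}"
      using open_vimage[OF U(2) h(1)] by (simp add: openin_P2_top)
  qed
  have "homeomorphic_maps P2_top P2_top (\<lambda>X. f ` X) (\<lambda>X. g ` X)"
    unfolding homeomorphic_maps_def
  proof (intro conjI ballI)
    show "continuous_map P2_top P2_top (\<lambda>X. f ` X)" by (rule cm[OF cont(1) pt f0 zero])
    show "continuous_map P2_top P2_top (\<lambda>X. g ` X)" by (rule cm[OF cont(2) ptg g0' g0])
  qed (simp_all only: image_image inv image_ident)
  then show ?thesis using homeomorphic_map_maps by blast
qed

definition lines_homeo :: "nat \<Rightarrow> (nat \<Rightarrow> complex^3) \<Rightarrow> (nat \<Rightarrow> complex^3) \<Rightarrow> bool" where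
  "lines_homeo n a b \<longleftrightarrow> (\<exists>F. homeomorphic_map P2_top P2_top F \<and> (\<forall>i<n. F ` proj_line (a i) = proj_line (b i)))"

lemma lines_homeo_cong:
  "lines_homeo n a b" if "\<And>i. i < n \<Longrightarrow> proj_line (a i) = proj_line (b i)"
  unfolding lines_homeo_def using that by (intro exI[of _ id]) simp

lemma lines_homeo_trans:
  assumes "lines_homeo n a b" "lines_homeo n b c"
  shows "lines_homeo n a c"
proof -
  obtain F where F: "homeomorphic_map P2_top P2_top F" "\<forall>i<n. F ` proj_line (a i) = proj_line (b i)"
    using assms(1) unfolding lines_homeo_def by blast
  obtain G where G: "homeomorphic_map P2_top P2_top G" "\<forall>i<n. G ` proj_line (b i) = proj_line (c i)"
    using assms(2) unfolding lines_homeo_def by blast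
  have "(G \<circ> F) ` proj_line (a i) = proj_line (c i)" if "i < n" for i
    unfolding image_comp[symmetric] using F(2) G(2) that by metis
  then show ?thesis unfolding lines_homeo_def
    by (intro exI[of _ "G \<circ> F"] conjI allI impI homeomorphic_map_compose[OF F(1) G(1)])
qed

lemma lines_homeo_sym:
  assumes "lines_homeo n a b"
  shows "lines_homeo n b a"
proof -
  obtain F where F: "homeomorphic_map P2_top P2_top F" "\<forall>i<n. F ` proj_line (a i) = proj_line (b i)"
    using assms unfolding lines_homeo_def by blast
  obtain G where G: "homeomorphic_maps P2_top P2_top F G"
    using F(1) homeomorphic_map_maps by blast
  have "homeomorphic_map P2_top P2_top G" using G homeomorphic_map_maps homeomorphic_maps_sym by blast
  moreover have "G ` proj_line (b i) = proj_line (a i)" if "i < n" for i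
  proof -
    have "G ` F ` proj_line (a i) = proj_line (a i)"
      using G proj_line_subset[of "a i"] unfolding homeomorphic_maps_def
      by (force simp: image_image subset_iff)
    then show ?thesis using F that by simp
  qed
  ultimately show ?thesis unfolding lines_homeo_def by blast
qed

lemma lines_homeoI:
  fixes f g :: "complex^3 \<Rightarrow> complex^3"
  assumes "continuous_on UNIV f" "continuous_on UNIV g"
    and inv: "\<And>v. g (f v) = v" "\<And>v. f (g v) = v" and zero: "f 0 = 0"
    and pt: "\<And>v. f ` proj_pt v = proj_pt (f v)"
    and ln: "\<And>i v. i < n \<Longrightarrow> dot (b i) (f v) = 0 \<longleftrightarrow> dot (a i) v = 0"
  shows "lines_homeo n a b"
  unfolding lines_homeo_def
proof (intro exI conjI allI impI)
  show "homeomorphic_map P2_top P2_top (\<lambda>X. f ` X)" using assms by (intro homeomorphic_map_P2[of f g]) auto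
  fix i assume i: "i < n"
  have f0: "f v \<noteq> 0 \<longleftrightarrow> v \<noteq> 0" for v using inv zero by metis
  show "(`) f ` proj_line (a i) = proj_line (b i)"
  proof (intro equalityI subsetI)
    fix X assume "X \<in> (`) f ` proj_line (a i)"
    then obtain v where v: "X = proj_pt (f v)" "v \<noteq> 0" "dot (a i) v = 0"
      by (auto simp: proj_line_dot pt)
    then show "X \<in> proj_line (b i)" using ln[OF i] f0 proj_pt_in_line_iff by simp
  next
    fix X assume "X \<in> proj_line (b i)"
    then obtain w where w: "X = proj_pt w" "w \<noteq> 0" "dot (b i) w = 0" by (auto simp: proj_line_dot)
    then have "X = f ` proj_pt (g w)" "g w \<noteq> 0" "dot (a i) (g w) = 0"
      using ln[OF i, of "g w"] f0[of "g w"] by (auto simp: pt inv)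
    then show "X \<in> (`) f ` proj_line (a i)" by (auto simp: proj_line_dot)
  qed
qed

section \<open>Fundamental groups of homeomorphic spaces\<close>

text \<open>On loops at \<open>x\<close> this agrees with \<open>path_homotopic_in\<close>, but the
  endpoint condition names \<open>x\<close> instead of the first path, which makes symmetry and
  transitivity immediate.\<close>

definition loop_htpy :: "'a topology \<Rightarrow> 'a \<Rightarrow> (real \<Rightarrow> 'a) \<Rightarrow> (real \<Rightarrow> 'a) \<Rightarrow> bool" where
  "loop_htpy X x = homotopic_with (\<lambda>p. p 0 = x \<and> p 1 = x) (top_of_set {0..1}) X"

lemma loop_htpy_refl: "g \<in> loops_at X x \<Longrightarrow> loop_htpy X x g g"
  by (simp add: loop_htpy_def loops_at_def pathin_def)

lemma loop_htpy_sym: "loop_htpy X x g h \<Longrightarrow> loop_htpy X x h g"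
  unfolding loop_htpy_def by (rule homotopic_with_symD)

lemma loop_htpy_trans: "loop_htpy X x g h \<Longrightarrow> loop_htpy X x h k \<Longrightarrow> loop_htpy X x g k"
  unfolding loop_htpy_def by (rule homotopic_with_trans)

lemma loop_class_eq: "g \<in> loops_at X x \<Longrightarrow> loop_class X x g = {h \<in> loops_at X x. loop_htpy X x g h}"
  unfolding loop_class_def path_homotopic_in_def loop_htpy_def loops_at_def by auto

lemma loop_class_cong:
  assumes "g \<in> loops_at X x" "h \<in> loops_at X x" "loop_htpy X x g h"
  shows "loop_class X x g = loop_class X x h"
  unfolding loop_class_eq[OF assms(1)] loop_class_eq[OF assms(2)]
  using loop_htpy_trans[OF assms(3)] loop_htpy_trans[OF loop_htpy_sym[OF assms(3)]] by (intro Collect_cong) blast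

lemma loop_class_eqD:
  assumes "g \<in> loops_at X x" "h \<in> loops_at X x" "loop_class X x g = loop_class X x h"
  shows "loop_htpy X x g h"
proof -
  have "h \<in> loop_class X x h" using assms(2) loop_htpy_refl by (simp add: loop_class_eq)
  then have "h \<in> loop_class X x g" by (simp only: assms(3))
  then show ?thesis using assms(1) by (simp add: loop_class_eq)
qed

text \<open>Names the choice hidden in the multiplication of
  \<open>fundamental_group\<close>.\<close>

definition rep :: "(real \<Rightarrow> 'a) set \<Rightarrow> real \<Rightarrow> 'a" where
  "rep A = (SOME g. g \<in> A)"

lemma rep_loop_class:
  assumes "g \<in> loops_at X x"
  shows "rep (loop_class X x g) \<in> loops_at X x" "loop_htpy X x g (rep (loop_class X x g))"
proof -
  have "g \<in> loop_class X x g" using assms loop_htpy_refl by (simp add: loop_class_eq)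
  then have "rep (loop_class X x g) \<in> loop_class X x g" unfolding rep_def
    by (rule someI[of "\<lambda>h. h \<in> loop_class X x g"])
  then show "rep (loop_class X x g) \<in> loops_at X x" "loop_htpy X x g (rep (loop_class X x g))"
    using assms by (auto simp: loop_class_eq)
qed

text \<open>Pasting along \<open>s = 1/2\<close>. The first coordinate is the homotopy parameter,
  the second runs along the path.\<close>

lemma continuous_map_join:
  fixes H K :: "real \<times> real \<Rightarrow> 'a"
  assumes H: "continuous_map (prod_topology (top_of_set {0..1}) (top_of_set {0..1})) X H"
    and K: "continuous_map (prod_topology (top_of_set {0..1}) (top_of_set {0..1})) X K"
    and eq: "\<And>t. t \<in> {0..1} \<Longrightarrow> H (t, 1) = K (t, 0)"
  shows "continuous_map (prod_topology (top_of_set {0..1}) (top_of_set {0..1})) X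
     (\<lambda>(t,s). if s \<le> 1/2 then H (t, 2 * s) else K (t, 2 * s - 1))"
proof -
  let ?I = "top_of_set {0..1::real}"
  have I: "prod_topology ?I ?I = top_of_set ({0..1} \<times> {0..1})"
    by (simp add: prod_topology_subtopology_eu)
  have "continuous_map (prod_topology ?I ?I) X
     (\<lambda>x. if snd x \<le> 1/2 then (H \<circ> (\<lambda>x. (fst x, 2 * snd x))) x else (K \<circ> (\<lambda>x. (fst x, 2 * snd x - 1))) x)"
  proof (rule continuous_map_cases_le)
    show "continuous_map (prod_topology ?I ?I) euclideanreal snd"
      "continuous_map (prod_topology ?I ?I) euclideanreal (\<lambda>x. 1/2)"
      by (auto simp: I intro: continuous_intros)
    show "continuous_map (subtopology (prod_topology ?I ?I) {x \<in> topspace (prod_topology ?I ?I). snd x \<le> 1/2}) X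
        (H \<circ> (\<lambda>x. (fst x, 2 * snd x)))"
      by (rule continuous_map_compose[OF _ H])
        (auto simp: I subtopology_subtopology intro!: continuous_intros)
    show "continuous_map (subtopology (prod_topology ?I ?I) {x \<in> topspace (prod_topology ?I ?I). 1/2 \<le> snd x}) X
        (K \<circ> (\<lambda>x. (fst x, 2 * snd x - 1)))"
      by (rule continuous_map_compose[OF _ K])
        (auto simp: I subtopology_subtopology intro!: continuous_intros)
    fix x assume x: "x \<in> topspace (prod_topology ?I ?I)" "snd x = 1/2"
    then have "2 * snd x = 1" "fst x \<in> {0..1}" by (auto simp: I)
    then show "(H \<circ> (\<lambda>x. (fst x, 2 * snd x))) x = (K \<circ> (\<lambda>x. (fst x, 2 * snd x - 1))) x"
      unfolding o_def by (simp only: eq diff_self)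
  qed
  then show ?thesis unfolding o_def case_prod_unfold .
qed

lemma loop_htpy_join:
  assumes "loop_htpy X x g g'" "loop_htpy X x h h'"
  shows "loop_htpy X x (join_path g h) (join_path g' h')"
proof -
  obtain H where H: "continuous_map (prod_topology (top_of_set {0..1::real}) (top_of_set {0..1})) X H"
    "\<forall>s. H (0, s) = g s" "\<forall>s. H (1, s) = g' s" "\<forall>t\<in>{0..1}. H (t, 0) = x \<and> H (t, 1) = x"
    using assms(1) unfolding loop_htpy_def homotopic_with_def by blast
  obtain K where K: "continuous_map (prod_topology (top_of_set {0..1::real}) (top_of_set {0..1})) X K"
    "\<forall>s. K (0, s) = h s" "\<forall>s. K (1, s) = h' s" "\<forall>t\<in>{0..1}. K (t, 0) = x \<and> K (t, 1) = x"
    using assms(2) unfolding loop_htpy_def homotopic_with_def by blast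
  show ?thesis
    unfolding loop_htpy_def homotopic_with_def
  proof (intro exI conjI allI ballI)
    show "continuous_map (prod_topology (top_of_set {0..1}) (top_of_set {0..1})) X
     (\<lambda>(t,s). if s \<le> 1/2 then H (t, 2 * s) else K (t, 2 * s - 1))"
      using H K by (intro continuous_map_join) auto
  qed (use H K in \<open>auto simp: join_path_def\<close>)
qed

text \<open>Being a loop is being homotopic to itself, so closure properties of loops become special
  cases of those of homotopies.\<close>

lemma loops_at_iff: "g \<in> loops_at X x \<longleftrightarrow> loop_htpy X x g g"
  by (auto simp: loop_htpy_def loops_at_def pathin_def)

lemma join_path_loops: "g \<in> loops_at X x \<Longrightarrow> h \<in> loops_at X x \<Longrightarrow> join_path g h \<in> loops_at X x"
  unfolding loops_at_iff by (rule loop_htpy_join)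

lemma loop_htpy_image:
  assumes "continuous_map X Y f" "loop_htpy X x g h"
  shows "loop_htpy Y (f x) (f \<circ> g) (f \<circ> h)"
  using assms(2) unfolding loop_htpy_def
  by (rule homotopic_with_compose_continuous_map_left[OF _ assms(1)]) auto

lemma loops_at_image:
  assumes "continuous_map X Y f" "g \<in> loops_at X x"
  shows "f \<circ> g \<in> loops_at Y (f x)"
  using assms(2) unfolding loops_at_iff by (rule loop_htpy_image[OF assms(1)])

text \<open>\<open>F\<close> pushes a representative forward. It does not depend on the
  representative because \<open>f\<close> carries homotopies to homotopies, and composing with
  \<open>g\<close> undoes it on classes.\<close>

lemma fundamental_group_homeo:
  assumes fg: "homeomorphic_maps X Y f g" and x: "x \<in> topspace X"
  shows "fundamental_group X x \<cong> fundamental_group Y (f x)"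
proof (rule is_isoI, rule isoI)
  have f: "continuous_map X Y f" and g: "continuous_map Y X g"
    and gf: "\<And>z. z \<in> topspace X \<Longrightarrow> g (f z) = z" and fg': "\<And>z. z \<in> topspace Y \<Longrightarrow> f (g z) = z"
    using fg unfolding homeomorphic_maps_def by auto
  define F where "F A = loop_class Y (f x) (f \<circ> rep A)" for A
  have F: "F (loop_class X x p) = loop_class Y (f x) (f \<circ> p)" if p: "p \<in> loops_at X x" for p
    unfolding F_def
    by (rule loop_class_cong[OF loops_at_image[OF f rep_loop_class(1)[OF p]] loops_at_image[OF f p]
          loop_htpy_image[OF f loop_htpy_sym[OF rep_loop_class(2)[OF p]]]])
  \<comment> \<open>Paths are functions on all reals, unconstrained outside [0,1], where
    \<open>p\<close> may leave the space and \<open>g\<close> need not invert \<open>f\<close>. The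
    two loops are therefore homotopic, agreeing on [0,1], but not necessarily equal.\<close>
  have retr: "loop_htpy X x p (g \<circ> (f \<circ> p))" if p: "p \<in> loops_at X x" for p
    unfolding loop_htpy_def
  proof (rule homotopic_with_equal)
    have pc: "continuous_map (top_of_set {0..1}) X p" "p 0 = x" "p 1 = x"
      using p by (auto simp: loops_at_def pathin_def)
    then show "continuous_map (top_of_set {0..1}) X p" "p 0 = x \<and> p 1 = x" by auto
    show "(g \<circ> (f \<circ> p)) 0 = x \<and> (g \<circ> (f \<circ> p)) 1 = x" using pc gf x by simp
    show "p z = (g \<circ> (f \<circ> p)) z" if "z \<in> topspace (top_of_set {0..1})" for z
      using that gf continuous_map_image_subset_topspace[OF pc(1)] by (simp add: image_subset_iff)
  qed
  have hom_join: "f \<circ> join_path p q = join_path (f \<circ> p) (f \<circ> q)" for p q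
    by (auto simp: join_path_def)
  show "F \<in> hom (fundamental_group X x) (fundamental_group Y (f x))"
  proof (rule homI)
    fix A assume "A \<in> carrier (fundamental_group X x)"
    then show "F A \<in> carrier (fundamental_group Y (f x))"
      using F loops_at_image[OF f] by (auto simp: fundamental_group_def)
  next
    fix A B assume "A \<in> carrier (fundamental_group X x)" "B \<in> carrier (fundamental_group X x)"
    then obtain p q where pq: "p \<in> loops_at X x" "A = loop_class X x p" "q \<in> loops_at X x" "B = loop_class X x q"
      by (auto simp: fundamental_group_def)
    have r: "rep A \<in> loops_at X x" "rep B \<in> loops_at X x" using rep_loop_class pq by auto
    have FA: "F A = loop_class Y (f x) (f \<circ> rep A)" "F B = loop_class Y (f x) (f \<circ> rep B)" by (simp_all add: F_def)
    have fr: "f \<circ> rep A \<in> loops_at Y (f x)" "f \<circ> rep B \<in> loops_at Y (f x)" using r loops_at_image[OF f] by auto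
    have "F (A \<otimes>\<^bsub>fundamental_group X x\<^esub> B) = loop_class Y (f x) (join_path (f \<circ> rep A) (f \<circ> rep B))"
      by (simp add: fundamental_group_def F join_path_loops r hom_join flip: rep_def)
    also have "\<dots> = loop_class Y (f x) (join_path (rep (F A)) (rep (F B)))"
      unfolding FA using rep_loop_class fr
      by (intro loop_class_cong join_path_loops loop_htpy_join) auto
    also have "\<dots> = F A \<otimes>\<^bsub>fundamental_group Y (f x)\<^esub> F B"
      by (simp add: fundamental_group_def flip: rep_def)
    finally show "F (A \<otimes>\<^bsub>fundamental_group X x\<^esub> B) = F A \<otimes>\<^bsub>fundamental_group Y (f x)\<^esub> F B" .
  qed
  show "bij_betw F (carrier (fundamental_group X x)) (carrier (fundamental_group Y (f x)))"
    unfolding bij_betw_def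
  proof
    show "inj_on F (carrier (fundamental_group X x))"
    proof (rule inj_onI)
      fix A B assume "A \<in> carrier (fundamental_group X x)" "B \<in> carrier (fundamental_group X x)" and e: "F A = F B"
      then obtain p q where pq: "p \<in> loops_at X x" "A = loop_class X x p" "q \<in> loops_at X x" "B = loop_class X x q"
        by (auto simp: fundamental_group_def)
      then have "loop_class Y (f x) (f \<circ> p) = loop_class Y (f x) (f \<circ> q)" using e F by simp
      then have "loop_htpy Y (f x) (f \<circ> p) (f \<circ> q)"
        by (rule loop_class_eqD[OF loops_at_image[OF f pq(1)] loops_at_image[OF f pq(3)]])
      from loop_htpy_image[OF g this] have "loop_htpy X x (g \<circ> (f \<circ> p)) (g \<circ> (f \<circ> q))"
        unfolding gf[OF x] .
      from loop_htpy_trans[OF retr[OF pq(1)] loop_htpy_trans[OF this loop_htpy_sym[OF retr[OF pq(3)]]]]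
      show "A = B" unfolding pq(2,4) by (rule loop_class_cong[OF pq(1,3)])
    qed
    show "F ` carrier (fundamental_group X x) = carrier (fundamental_group Y (f x))"
    proof (intro equalityI subsetI)
      fix B assume "B \<in> F ` carrier (fundamental_group X x)"
      then show "B \<in> carrier (fundamental_group Y (f x))"
        using F loops_at_image[OF f] by (auto simp: fundamental_group_def)
    next
      fix B assume "B \<in> carrier (fundamental_group Y (f x))"
      then obtain q where q: "q \<in> loops_at Y (f x)" "B = loop_class Y (f x) q" by (auto simp: fundamental_group_def)
      have gq: "g \<circ> q \<in> loops_at X x" using loops_at_image[OF g q(1)] gf[OF x] by simp
      have qc: "continuous_map (top_of_set {0..1}) Y q" "q 0 = f x" "q 1 = f x"
        using q(1) by (auto simp: loops_at_def pathin_def)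
      have "loop_htpy Y (f x) q (f \<circ> (g \<circ> q))"
        unfolding loop_htpy_def
      proof (rule homotopic_with_equal)
        show "q z = (f \<circ> (g \<circ> q)) z" if "z \<in> topspace (top_of_set {0..1})" for z
          using that fg' continuous_map_image_subset_topspace[OF qc(1)] by (simp add: image_subset_iff)
      qed (use qc gf x in auto)
      then have "B = F (loop_class X x (g \<circ> q))"
        unfolding F[OF gq] q(2) using q(1) loops_at_image[OF f gq] by (intro loop_class_cong)
      then show "B \<in> F ` carrier (fundamental_group X x)" using gq by (auto simp: fundamental_group_def)
    qed
  qed
qed

section \<open>Local triviality\<close>

lemma norm_vsmult [simp]: "norm (c *s v) = norm c * norm (v::complex^3)"
  by (simp add: norm_vec_def L2_set_right_distrib[symmetric] norm_mult)

lemma norm_dot_le: "norm (dot a v) \<le> norm a * norm v"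
proof -
  have "norm (dot a v) \<le> (\<Sum>i\<in>UNIV. \<bar>norm (a $ i)\<bar> * \<bar>norm (v $ i)\<bar>)"
    unfolding dot_def by (rule order_trans[OF norm_sum]) (simp add: norm_mult)
  also have "\<dots> \<le> norm a * norm v"
    unfolding norm_vec_def by (rule L2_set_mult_ineq)
  finally show ?thesis .
qed

lemma norm_cnjv [simp]: "norm (cnjv a) = norm a"
  by (simp add: norm_vec_def cnjv_def)

lemma dot_cnjv_self: "dot a (cnjv a) = of_real ((norm a)\<^sup>2)" "dot (cnjv a) a = of_real ((norm a)\<^sup>2)"
proof -
  have "(norm a)\<^sup>2 = (\<Sum>i\<in>UNIV. (norm (a $ i))\<^sup>2)"
    by (simp add: norm_vec_def L2_set_def sum_nonneg)
  moreover have "z * cnj z = of_real ((norm z)\<^sup>2)" "cnj z * z = of_real ((norm z)\<^sup>2)" for z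
    by (simp_all only: complex_norm_square mult.commute)
  ultimately show "dot a (cnjv a) = of_real ((norm a)\<^sup>2)" "dot (cnjv a) a = of_real ((norm a)\<^sup>2)"
    by (simp_all add: dot_def cnjv_def)
qed

lemma scaleR_eq_vsmult: "r *\<^sub>R v = complex_of_real r *s (v::complex^3)"
  by (simp add: vec_eq_iff scaleR_conv_of_real[of r "v $ i" for i])

lemma norm_le_of_lipschitz:
  assumes "L-lipschitz_on W f" "x \<in> W" "0 \<in> W" "f 0 = 0"
  shows "norm (f x) \<le> L * norm x"
  using lipschitz_onD[OF assms(1,2,3)] assms(4) by (simp add: dist_norm)

lemma lipschitz_on_linear:
  fixes f :: "'a::real_normed_vector \<Rightarrow> 'b::real_normed_vector"
  assumes "\<And>x y. f (x - y) = f x - f y" "\<And>x. norm (f x) \<le> L * norm x" "0 \<le> L"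
  shows "L-lipschitz_on W f"
  using assms by (intro lipschitz_onI) (simp_all add: dist_norm flip: assms(1))

lemma lipschitz_on_sum:
  assumes "finite I" "\<And>i. i \<in> I \<Longrightarrow> L-lipschitz_on W (f i)" "0 \<le> L"
  shows "(real (card I) * L)-lipschitz_on W (\<lambda>x. \<Sum>i\<in>I. (f i x :: 'b::real_normed_vector))"
  using assms
proof (induction I rule: finite_induct)
  case empty
  then show ?case by (simp add: lipschitz_on_constant)
next
  case (insert i I)
  have "(L + real (card I) * L)-lipschitz_on W (\<lambda>x. f i x + (\<Sum>i\<in>I. f i x))"
    using insert by (intro lipschitz_on_add) auto
  then show ?case using insert by (simp add: algebra_simps)
qed

text \<open>Lipschitz functions are not closed under products; bounded ones are. One constant
  \<open>C\<close> serves both purposes.\<close>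

definition bdd_lip :: "'a::metric_space set \<Rightarrow> ('a \<Rightarrow> real) \<Rightarrow> bool" where
  "bdd_lip S f \<longleftrightarrow> (\<exists>C. (\<forall>x\<in>S. \<bar>f x\<bar> \<le> C) \<and> C-lipschitz_on S f)"

lemma bdd_lipI: "(\<And>x. x \<in> S \<Longrightarrow> \<bar>f x\<bar> \<le> B) \<Longrightarrow> C-lipschitz_on S f \<Longrightarrow> bdd_lip S f"
  unfolding bdd_lip_def
  by (intro exI[of _ "max B C"] conjI ballI lipschitz_on_mono[OF _ subset_refl max.cobounded2])
    (auto simp: le_max_iff_disj)

lemma bdd_lip_const: "bdd_lip S (\<lambda>x. c)"
  by (rule bdd_lipI[of _ _ "\<bar>c\<bar>" 0]) (auto intro: lipschitz_on_constant)

lemma bdd_lip_mult: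
  assumes "bdd_lip S f" "bdd_lip S g"
  shows "bdd_lip S (\<lambda>x. f x * g x)"
proof -
  obtain C where C: "\<And>x. x \<in> S \<Longrightarrow> \<bar>f x\<bar> \<le> C" "C-lipschitz_on S f" using assms(1) by (auto simp: bdd_lip_def)
  obtain D where D: "\<And>x. x \<in> S \<Longrightarrow> \<bar>g x\<bar> \<le> D" "D-lipschitz_on S g" using assms(2) by (auto simp: bdd_lip_def)
  have nn: "0 \<le> C" "0 \<le> D" using C D lipschitz_on_nonneg by auto
  show ?thesis
  proof (rule bdd_lipI)
    show "\<bar>f x * g x\<bar> \<le> C * D" if "x \<in> S" for x
      unfolding abs_mult using C D that nn by (intro mult_mono) auto
    show "(C * D + C * D)-lipschitz_on S (\<lambda>x. f x * g x)"
    proof (rule lipschitz_onI)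
      fix x y assume xy: "x \<in> S" "y \<in> S"
      have "f x * g x - f y * g y = f x * (g x - g y) + (f x - f y) * g y" by (simp add: algebra_simps)
      then have "\<bar>f x * g x - f y * g y\<bar> \<le> \<bar>f x\<bar> * \<bar>g x - g y\<bar> + \<bar>f x - f y\<bar> * \<bar>g y\<bar>"
        by (metis abs_mult abs_triangle_ineq)
      also have "\<dots> \<le> C * (D * dist x y) + (C * dist x y) * D"
        using xy C D nn lipschitz_onD[OF C(2) xy] lipschitz_onD[OF D(2) xy]
        by (intro add_mono mult_mono) (auto simp: dist_real_def)
      finally show "dist (f x * g x) (f y * g y) \<le> (C * D + C * D) * dist x y"
        by (simp add: dist_real_def algebra_simps)
    qed (use nn in auto)
  qed
qed

lemma bdd_lip_add:
  assumes "bdd_lip S f" "bdd_lip S g"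
  shows "bdd_lip S (\<lambda>x. f x + g x)"
proof -
  obtain C where C: "\<And>x. x \<in> S \<Longrightarrow> \<bar>f x\<bar> \<le> C" "C-lipschitz_on S f" using assms(1) by (auto simp: bdd_lip_def)
  obtain D where D: "\<And>x. x \<in> S \<Longrightarrow> \<bar>g x\<bar> \<le> D" "D-lipschitz_on S g" using assms(2) by (auto simp: bdd_lip_def)
  show ?thesis
  proof (rule bdd_lipI)
    show "\<bar>f x + g x\<bar> \<le> C + D" if "x \<in> S" for x
      using C(1)[OF that] D(1)[OF that] by linarith
    show "(C + D)-lipschitz_on S (\<lambda>x. f x + g x)" using C D by (intro lipschitz_on_add)
  qed
qed

lemma bdd_lip_prod: "finite I \<Longrightarrow> (\<And>i. i \<in> I \<Longrightarrow> bdd_lip S (f i)) \<Longrightarrow> bdd_lip S (\<lambda>x. \<Prod>i\<in>I. f i x)"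
  by (induction I rule: finite_induct) (auto intro: bdd_lip_const bdd_lip_mult)

lemma bdd_lip_sum: "finite I \<Longrightarrow> (\<And>i. i \<in> I \<Longrightarrow> bdd_lip S (f i)) \<Longrightarrow> bdd_lip S (\<lambda>x. \<Sum>i\<in>I. f i x)"
  by (induction I rule: finite_induct) (auto intro: bdd_lip_const bdd_lip_add)

text \<open>On a compact set a positive continuous function has a lower bound \<open>c > 0\<close>,
  and inversion then enlarges Lipschitz constants by at most \<open>1 / (c * c)\<close>.\<close>

lemma bdd_lip_inverse:
  assumes f: "bdd_lip S f" and "compact S" "\<And>x. x \<in> S \<Longrightarrow> f x > 0"
  shows "bdd_lip S (\<lambda>x. inverse (f x))"
proof (cases "S = {}")
  case True then show ?thesis by (auto simp: bdd_lip_def)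
next
  case False
  obtain C where C: "C-lipschitz_on S f" using f by (auto simp: bdd_lip_def)
  then have "continuous_on S f" by (rule lipschitz_on_continuous_on)
  then obtain x0 where x0: "x0 \<in> S" "\<And>y. y \<in> S \<Longrightarrow> f x0 \<le> f y"
    using continuous_attains_inf[OF assms(2) False] by blast
  define c where "c = f x0"
  have c: "c > 0" "\<And>y. y \<in> S \<Longrightarrow> c \<le> f y" using x0 assms(3) by (auto simp: c_def)
  show ?thesis
  proof (rule bdd_lipI)
    show "\<bar>inverse (f x)\<bar> \<le> inverse c" if "x \<in> S" for x
      using c(1) c(2)[OF that] by (simp add: le_imp_inverse_le)
    show "(C / (c * c))-lipschitz_on S (\<lambda>x. inverse (f x))"
    proof (rule lipschitz_onI)
      fix x y assume xy: "x \<in> S" "y \<in> S"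
      have pos: "f x > 0" "f y > 0" using xy c by force+
      have "\<bar>inverse (f x) - inverse (f y)\<bar> = \<bar>f x - f y\<bar> / (f x * f y)"
        using pos by (simp add: inverse_diff_inverse abs_mult divide_inverse abs_minus_commute)
      also have "\<dots> \<le> (C * dist x y) / (c * c)"
        using c xy lipschitz_onD[OF C xy] lipschitz_on_nonneg[OF C] pos
        by (intro frac_le mult_mono) (auto simp: dist_real_def)
      finally show "dist (inverse (f x)) (inverse (f y)) \<le> C / (c * c) * dist x y"
        by (simp add: dist_real_def)
    qed (use lipschitz_on_nonneg[OF C] c in auto)
  qed
qed

lemma bdd_lip_ratio:
  assumes "finite I" "\<And>i. i \<in> I \<Longrightarrow> bdd_lip S (f i)" "compact S"
    "\<And>x. x \<in> S \<Longrightarrow> (\<Sum>i\<in>I. f i x) > 0" "i \<in> I"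
  shows "bdd_lip S (\<lambda>x. f i x / (\<Sum>i\<in>I. f i x))"
  unfolding divide_inverse using assms by (intro bdd_lip_mult bdd_lip_inverse bdd_lip_sum) auto

lemma bdd_lip_norm_dot: "S \<subseteq> sphere 0 1 \<Longrightarrow> bdd_lip S (\<lambda>v. norm (dot a v))"
proof (rule bdd_lipI)
  assume S: "S \<subseteq> sphere 0 1"
  show "\<bar>norm (dot a v)\<bar> \<le> norm a" if "v \<in> S" for v
    using norm_dot_le[of a v] S that by auto
  show "(norm a)-lipschitz_on S (\<lambda>v. norm (dot a v))"
  proof (rule lipschitz_onI)
    fix x y
    have "\<bar>norm (dot a x) - norm (dot a y)\<bar> \<le> norm (dot a (x - y))"
      by (simp add: dot_linear norm_triangle_ineq3)
    also have "\<dots> \<le> norm a * norm (x - y)" by (rule norm_dot_le)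
    finally show "dist (norm (dot a x)) (norm (dot a y)) \<le> norm a * dist x y"
      by (simp add: dist_norm)
  qed simp
qed

lemma bdd_lip_norm: "S \<subseteq> sphere 0 1 \<Longrightarrow> bdd_lip S (\<lambda>v::complex^3. norm v)"
proof (rule bdd_lipI)
  assume S: "S \<subseteq> sphere (0::complex^3) 1"
  show "\<bar>norm v\<bar> \<le> 1" if "v \<in> S" for v :: "complex^3" using S that by auto
  show "1-lipschitz_on S (\<lambda>v. norm v)"
    by (rule lipschitz_onI) (auto simp: dist_norm norm_triangle_ineq3)
qed

text \<open>\<open>h\<close> depends only on the direction and may be discontinuous at 0. Its
  variation between \<open>v\<close> and \<open>w\<close> is of order
  \<open>norm (v - w) / norm w\<close>, and the factor \<open>norm (k w) \<le> e * norm w\<close>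
  cancels the denominator.\<close>

lemma lipschitz_on_homogeneous_times:
  fixes h :: "'a::real_normed_vector \<Rightarrow> real" and k :: "'a \<Rightarrow> 'b::real_normed_vector"
  assumes W: "\<And>r x. x \<in> W \<Longrightarrow> r *\<^sub>R x \<in> W"
    and hom: "\<And>r x. r > 0 \<Longrightarrow> h (r *\<^sub>R x) = h x"
    and bnd: "\<And>x. \<bar>h x\<bar> \<le> 1"
    and lip: "C-lipschitz_on (W \<inter> sphere 0 1) h"
    and k: "e-lipschitz_on W k" "k 0 = 0"
  shows "((1 + 2 * C) * e)-lipschitz_on W (\<lambda>x. h x *\<^sub>R k x)"
proof (rule lipschitz_onI)
  have C: "0 \<le> C" and e: "0 \<le> e" using lip k(1) lipschitz_on_nonneg by auto
  then show "0 \<le> (1 + 2 * C) * e" by simp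
  fix v w assume vw: "v \<in> W" "w \<in> W"
  have "0 \<in> W" using W[OF vw(1), of 0] by simp
  then have kn: "norm (k x) \<le> e * norm x" if "x \<in> W" for x
    using norm_le_of_lipschitz[OF k(1) that _ k(2)] by simp
  have one: "norm (h x *\<^sub>R k x) \<le> ((1 + 2 * C) * e) * norm x" if "x \<in> W" for x
  proof -
    have "norm (h x *\<^sub>R k x) \<le> 1 * (e * norm x)"
      unfolding norm_scaleR using bnd kn[OF that] e by (intro mult_mono) auto
    also have "\<dots> \<le> (1 + 2 * C) * (e * norm x)" using C e by (intro mult_right_mono) auto
    finally show ?thesis by (simp add: mult.assoc)
  qed
  show "dist (h v *\<^sub>R k v) (h w *\<^sub>R k w) \<le> ((1 + 2 * C) * e) * dist v w"
  proof (cases "v = 0 \<or> w = 0")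
    case True
    then show ?thesis using one[OF vw(1)] one[OF vw(2)] k(2) by (auto simp: dist_norm)
  next
    case False
    define v1 where "v1 = inverse (norm v) *\<^sub>R v"
    define w1 where "w1 = inverse (norm w) *\<^sub>R w"
    have in_S: "v1 \<in> W \<inter> sphere 0 1" "w1 \<in> W \<inter> sphere 0 1"
      using False vw W by (auto simp: v1_def w1_def)
    have h1: "h v = h v1" "h w = h w1" using False hom by (auto simp: v1_def w1_def)
    \<comment> \<open>Both terms on the right have norm at most \<open>norm (v - w)\<close>, the
      second because it only changes the length of \<open>v\<close> to that of \<open>w\<close>.
      This is the origin of the factor 2.\<close>
    have "norm w *\<^sub>R (v1 - w1) = (v - w) + (norm w / norm v - 1) *\<^sub>R v"
      using False by (simp add: v1_def w1_def algebra_simps divide_inverse)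
    then have "norm w * norm (v1 - w1) \<le> norm (v - w) + norm ((norm w / norm v - 1) *\<^sub>R v)"
      by (metis abs_norm_cancel norm_scaleR norm_triangle_ineq)
    also have "norm ((norm w / norm v - 1) *\<^sub>R v) = \<bar>(norm w / norm v - 1) * norm v\<bar>"
      by (simp add: abs_mult)
    also have "(norm w / norm v - 1) * norm v = norm w - norm v" using False by (simp add: field_simps)
    also have "\<bar>norm w - norm v\<bar> \<le> norm (v - w)" by (metis norm_minus_commute norm_triangle_ineq3)
    finally have d1: "norm w * norm (v1 - w1) \<le> 2 * norm (v - w)" by simp
    have "\<bar>h v - h w\<bar> \<le> C * norm (v1 - w1)"
      using lipschitz_onD[OF lip in_S] by (simp add: h1 dist_norm)
    then have "\<bar>h v - h w\<bar> * norm (k w) \<le> (C * norm (v1 - w1)) * (e * norm w)"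
      using kn[OF vw(2)] C e by (intro mult_mono) auto
    also have "\<dots> = C * e * (norm w * norm (v1 - w1))" by simp
    also have "\<dots> \<le> C * e * (2 * norm (v - w))" using d1 C e by (intro mult_left_mono) auto
    finally have t2: "norm ((h v - h w) *\<^sub>R k w) \<le> 2 * C * e * norm (v - w)" by (simp add: mult_ac)
    have "norm (h v *\<^sub>R (k v - k w)) \<le> 1 * (e * norm (v - w))"
      unfolding norm_scaleR using bnd lipschitz_onD[OF k(1) vw]
      by (intro mult_mono) (auto simp: dist_norm)
    moreover have "h v *\<^sub>R k v - h w *\<^sub>R k w = h v *\<^sub>R (k v - k w) + (h v - h w) *\<^sub>R k w"
      by (simp add: algebra_simps)
    then have "norm (h v *\<^sub>R k v - h w *\<^sub>R k w) \<le> norm (h v *\<^sub>R (k v - k w)) + norm ((h v - h w) *\<^sub>R k w)"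
      by (metis norm_triangle_ineq)
    ultimately show ?thesis using t2 by (simp add: dist_norm algebra_simps)
  qed
qed

text \<open>Solving \<open>u + g u = w\<close> means finding a fixed point of the contraction that
  sends \<open>u\<close> to \<open>w - g u\<close>. The perturbed identity shrinks distances at most
  by \<open>1 - c\<close>, so its inverse is Lipschitz.\<close>

lemma lipschitz_perturbation_of_identity:
  fixes g :: "'a::banach \<Rightarrow> 'a"
  assumes "c-lipschitz_on UNIV g" "c < 1"
  obtains h where "continuous_on UNIV h" "\<And>v. h (v + g v) = v" "\<And>v. h v + g (h v) = v"
proof -
  have c0: "0 \<le> c" using assms(1) lipschitz_on_nonneg by blast
  have lip: "norm (g x - g y) \<le> c * norm (x - y)" for x y
    using lipschitz_onD[OF assms(1), of x y] by (simp add: dist_norm)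
  have "\<exists>u. u + g u = w" for w
  proof -
    have "\<exists>!u. w - g u = u"
      using c0 assms(2) lip by (intro banach_fix_type[of c]) (auto simp: dist_norm norm_minus_commute)
    then obtain u where "w - g u = u" by blast
    then have "u + g u = w" by (metis diff_add_cancel)
    then show ?thesis by blast
  qed
  then obtain h where h: "\<And>w. h w + g (h w) = w" by metis
  have exp: "(1 - c) * norm (x - y) \<le> norm ((x + g x) - (y + g y))" for x y
  proof -
    have "(x + g x) - (y + g y) = (x - y) - (g y - g x)" by simp
    then have "norm ((x + g x) - (y + g y)) \<ge> norm (x - y) - norm (g y - g x)" by (metis norm_triangle_ineq2)
    then show ?thesis using lip[of y x] by (simp add: algebra_simps norm_minus_commute)
  qed
  have "h (v + g v) = v" for v
  proof -
    have "(1 - c) * norm (h (v + g v) - v) \<le> 0" using exp[of "h (v + g v)" v] h[of "v + g v"] by simp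
    then have "norm (h (v + g v) - v) \<le> 0" using assms(2) by (simp add: mult_le_0_iff)
    then show ?thesis by simp
  qed
  moreover have "(1 / (1 - c))-lipschitz_on UNIV h"
  proof (rule lipschitz_onI)
    fix x y
    show "dist (h x) (h y) \<le> 1 / (1 - c) * dist x y"
      using exp[of "h x" "h y"] h assms(2) by (simp add: dist_norm field_simps)
  qed (use assms(2) in simp)
  ultimately show ?thesis using that[of h] h lipschitz_on_continuous_on by blast
qed

lemma finite_uniform_const:
  fixes P :: "'a \<Rightarrow> real \<Rightarrow> bool"
  assumes "finite A" "\<And>x. x \<in> A \<Longrightarrow> \<exists>C. P x C" "\<And>x C D. P x C \<Longrightarrow> C \<le> D \<Longrightarrow> P x D"
  shows "\<exists>C\<ge>0. \<forall>x\<in>A. P x C"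
  using assms(1,2)
proof (induction A rule: finite_induct)
  case empty
  then show ?case by auto
next
  case (insert y A)
  then obtain C where "C \<ge> 0" "\<forall>x\<in>A. P x C" by blast
  moreover obtain D where "P y D" using insert.prems by blast
  ultimately have "\<forall>x\<in>insert y A. P x (max C D)" "max C D \<ge> 0"
    by (auto intro: assms(3)[of _ C "max C D"] assms(3)[of _ D "max C D"])
  then show ?case by blast
qed

lemma continuous_dot: "continuous_on S (dot c)"
proof -
  have "(norm c)-lipschitz_on S (dot c)"
    by (rule lipschitz_on_linear) (auto simp: dot_linear norm_dot_le)
  then show ?thesis by (rule lipschitz_on_continuous_on)
qed

section \<open>Weights attached to the intersection points\<close>

locale arrangement =
  fixes n :: nat and a :: "nat \<Rightarrow> complex^3"
  assumes arr: "line_arrangement n a" and two: "2 \<le> n"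
begin

text \<open>Ordered pairs of lines stand for intersection points. A point may be listed several
  times; the normalization of the weights absorbs the repetition.\<close>

definition "pairs = {(i,j). i < n \<and> j < n \<and> i \<noteq> j}"

definition "through q = {k. k < n \<and> det3 (a (fst q)) (a (snd q)) (a k) = 0}"

definition "pt q = crs (a (fst q)) (a (snd q))"

text \<open>The factors \<open>norm v\<close> for lines through \<open>q\<close> give all
  \<open>mu q\<close> the same degree \<open>n\<close>, so that the quotient \<open>muh\<close> has
  degree zero.\<close>

definition "mu q v = (\<Prod>k<n. if k \<in> through q then norm v else norm (dot (a k) v))"

definition "muh q v = mu q v / (\<Sum>q\<in>pairs. mu q v)"

text \<open>Coefficient of the orthogonal projection of \<open>v\<close> to the span of
  \<open>pt q\<close>; \<open>Q q\<close> is the complementary projection, onto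
  \<open>W q\<close>.\<close>

definition "phi q v = dot (cnjv (pt q)) v / of_real ((norm (pt q))\<^sup>2)"

definition "Q q v = v - phi q v *s pt q"

definition "nu q k x = (\<Prod>l\<in>through q - {k}. norm (dot (a l) x))"

definition "nuh q k x = nu q k x / (\<Sum>k\<in>through q. nu q k x)"

definition "W q = {v. dot (cnjv (pt q)) v = 0}"

lemma finite_pairs: "finite pairs"
  by (rule finite_subset[of _ "{..<n} \<times> {..<n}"]) (auto simp: pairs_def)

lemma finite_through: "finite (through q)"
  unfolding through_def by auto

lemma card_through: "card (through q) \<le> n"
  using card_mono[of "{..<n}" "through q"] by (auto simp: through_def)

lemma crs_nz: "i < n \<Longrightarrow> j < n \<Longrightarrow> i \<noteq> j \<Longrightarrow> crs (a i) (a j) \<noteq> 0"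
  using arr unfolding line_arrangement_iff by auto

lemma pt_nz: "q \<in> pairs \<Longrightarrow> pt q \<noteq> 0"
  using crs_nz by (auto simp: pairs_def pt_def)

lemma through_iff: "k < n \<Longrightarrow> k \<in> through q \<longleftrightarrow> dot (a k) (pt q) = 0"
  unfolding through_def pt_def using det3_perm(5)[where a="a (fst q)" and b="a (snd q)" and c="a k"]
  by (simp add: det3_def)

lemma through_lt: "k \<in> through q \<Longrightarrow> k < n"
  by (simp add: through_def)

lemma fst_in_through: "q \<in> pairs \<Longrightarrow> fst q \<in> through q"
  by (auto simp: pairs_def through_def)

lemma mu_nonneg: "0 \<le> mu q v"
  unfolding mu_def by (intro prod_nonneg) auto

lemma nu_nonneg: "0 \<le> nu q k v"
  unfolding nu_def by (intro prod_nonneg) auto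

text \<open>Some \<open>q\<close> has to lie on every line that contains \<open>v\<close>. If
  \<open>v\<close> is on two lines, take their intersection, which is then \<open>v\<close> itself;
  if on one, any point of that line; if on none, any point.\<close>

lemma mu_sum_pos:
  assumes "v \<noteq> 0"
  shows "(\<Sum>q\<in>pairs. mu q v) > 0"
proof -
  obtain q where q: "q \<in> pairs" "\<And>k. k < n \<Longrightarrow> k \<notin> through q \<Longrightarrow> dot (a k) v \<noteq> 0"
  proof (cases "\<exists>i<n. dot (a i) v = 0")
    case False
    then show ?thesis using that[of "(0,1)"] two by (auto simp: pairs_def)
  next
    case True
    then obtain i where i: "i < n" "dot (a i) v = 0" by blast
    show ?thesis
    proof (cases "\<exists>j<n. j \<noteq> i \<and> dot (a j) v = 0")
      case True
      then obtain j where j: "j < n" "j \<noteq> i" "dot (a j) v = 0" by blast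
      obtain c where c: "v = c *s crs (a i) (a j)" using crs_neq_0_lin[OF crs_nz] i j by metis
      show ?thesis
      proof (rule that)
        show "(i,j) \<in> pairs" using i j by (auto simp: pairs_def)
        fix k assume k: "k < n" "k \<notin> through (i,j)"
        then show "dot (a k) v \<noteq> 0"
          using through_iff[OF k(1)] c assms by (auto simp: pt_def dot_linear)
      qed
    next
      case False
      obtain j where j: "j < n" "j \<noteq> i" using two that[of 0] that[of 1] by (cases "i = 0") auto
      show ?thesis
      proof (rule that)
        show "(i,j) \<in> pairs" using i j by (auto simp: pairs_def)
        then show "dot (a k) v \<noteq> 0" if "k < n" "k \<notin> through (i,j)" for k
          using that False fst_in_through[of "(i,j)"] by auto
      qed
    qed
  qed
  have "mu q v > 0" unfolding mu_def using q(2) assms by (intro prod_pos) auto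
  then show ?thesis using q(1) finite_pairs mu_nonneg by (intro sum_pos2) auto
qed

lemma muh_sum: "v \<noteq> 0 \<Longrightarrow> (\<Sum>q\<in>pairs. muh q v) = 1"
  using mu_sum_pos[of v] by (simp add: muh_def flip: sum_divide_distrib)

lemma Q_simps:
  assumes "q \<in> pairs"
  shows "phi q (pt q) = 1" "dot (cnjv (pt q)) (Q q v) = 0" "Q q v \<in> W q"
proof -
  have *: "complex_of_real ((norm (pt q))\<^sup>2) \<noteq> 0" using pt_nz[OF assms] by simp
  show "phi q (pt q) = 1" unfolding phi_def dot_cnjv_self using * by simp
  show "dot (cnjv (pt q)) (Q q v) = 0" using * by (simp add: Q_def dot_linear phi_def dot_cnjv_self)
  then show "Q q v \<in> W q" by (simp add: W_def)
qed

lemma dot_Q: "k \<in> through q \<Longrightarrow> dot (a k) (Q q v) = dot (a k) v"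
  using through_iff[of k q] through_lt by (simp add: Q_def dot_linear)

text \<open>Two distinct lines through \<open>q\<close> meet only in multiples of
  \<open>pt q\<close>, and a nonzero multiple is not orthogonal to \<open>pt q\<close>.\<close>

lemma through_zero_unique:
  assumes q: "q \<in> pairs" and x: "x \<in> W q" "x \<noteq> 0"
    and k: "k \<in> through q" "dot (a k) x = 0" and l: "l \<in> through q" "l \<noteq> k"
  shows "dot (a l) x \<noteq> 0"
proof
  assume 0: "dot (a l) x = 0"
  have kl: "crs (a k) (a l) \<noteq> 0" using crs_nz k l through_lt by auto
  have "dot (a k) (pt q) = 0" "dot (a l) (pt q) = 0" using k l through_iff through_lt by blast+
  then obtain c where c: "pt q = c *s crs (a k) (a l)" using crs_neq_0_lin[OF kl] by blast
  obtain d where d: "x = d *s crs (a k) (a l)" using crs_neq_0_lin[OF kl k(2) 0] by blast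
  have "c \<noteq> 0" using c pt_nz[OF q] by auto
  then have "x = (d / c) *s pt q" by (simp add: c d)
  moreover from this have "d / c * of_real ((norm (pt q))\<^sup>2) = 0"
    using x(1) by (simp add: W_def dot_linear dot_cnjv_self)
  ultimately show False using x(2) pt_nz[OF q] by auto
qed

lemma nu_sum_pos:
  assumes q: "q \<in> pairs" and x: "x \<in> W q" "x \<noteq> 0"
  shows "(\<Sum>k\<in>through q. nu q k x) > 0"
proof -
  obtain k where k: "k \<in> through q" "\<And>l. l \<in> through q \<Longrightarrow> l \<noteq> k \<Longrightarrow> dot (a l) x \<noteq> 0"
  proof (cases "\<exists>k\<in>through q. dot (a k) x = 0")
    case True
    then show ?thesis using that through_zero_unique[OF q x] by blast
  next
    case False
    then show ?thesis using that fst_in_through[OF q] by blast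
  qed
  have "nu q k x > 0" unfolding nu_def using k by (intro prod_pos) auto
  then show ?thesis using k(1) finite_through nu_nonneg by (intro sum_pos2) auto
qed

text \<open>For \<open>k\<close> different from \<open>i\<close> the product \<open>nu q k\<close>
  contains the vanishing factor of line \<open>i\<close>, so after normalization the whole weight
  sits on \<open>i\<close>.\<close>

lemma nuh_on_line:
  assumes q: "q \<in> pairs" and x: "x \<in> W q" "x \<noteq> 0" and i: "i \<in> through q" "dot (a i) x = 0"
    and k: "k \<in> through q"
  shows "nuh q k x = (if k = i then 1 else 0)"
proof -
  have z: "nu q k x = 0" if "k \<in> through q" "k \<noteq> i" for k
    unfolding nu_def using that i finite_through by (intro prod_zero) auto
  have "(\<Sum>k\<in>through q. nu q k x) = (\<Sum>k\<in>{i}. nu q k x)"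
    using i z finite_through by (intro sum.mono_neutral_right) auto
  then show ?thesis using nu_sum_pos[OF q x] z[OF k] by (auto simp: nuh_def)
qed

lemma mu_scale: "mu q (c *s v) = norm c ^ n * mu q v"
proof -
  have "mu q (c *s v) = (\<Prod>k<n. norm c * (if k \<in> through q then norm v else norm (dot (a k) v)))"
    unfolding mu_def by (intro prod.cong) (auto simp: dot_linear norm_mult)
  then show ?thesis by (simp add: mu_def prod.distrib)
qed

lemma muh_scale: "c \<noteq> 0 \<Longrightarrow> muh q (c *s v) = muh q v"
  by (simp add: muh_def mu_scale flip: sum_distrib_left)

lemma nu_scale: "k \<in> through q \<Longrightarrow> nu q k (c *s v) = norm c ^ (card (through q) - 1) * nu q k v"
  using finite_through by (simp add: nu_def dot_linear norm_mult prod.distrib card_Diff_singleton)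

lemma nuh_scale: "c \<noteq> 0 \<Longrightarrow> k \<in> through q \<Longrightarrow> nuh q k (c *s v) = nuh q k v"
proof -
  assume c: "c \<noteq> 0" and k: "k \<in> through q"
  have "(\<Sum>k\<in>through q. nu q k (c *s v)) = norm c ^ (card (through q) - 1) * (\<Sum>k\<in>through q. nu q k v)"
    unfolding sum_distrib_left by (intro sum.cong refl nu_scale)
  then show ?thesis using c by (simp add: nuh_def nu_scale[OF k])
qed

lemma abs_ratio_le_1:
  fixes f :: "'b \<Rightarrow> real"
  assumes "finite I" "i \<in> I" "\<And>j. 0 \<le> f j"
  shows "\<bar>f i / (\<Sum>j\<in>I. f j)\<bar> \<le> 1"
proof -
  have "f i \<le> (\<Sum>j\<in>I. f j)" using assms by (intro member_le_sum) auto
  then show ?thesis using assms(3)[of i] by (auto simp: divide_le_eq_1)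
qed

lemma muh_le_1: "q \<in> pairs \<Longrightarrow> \<bar>muh q v\<bar> \<le> 1"
  unfolding muh_def using finite_pairs mu_nonneg by (intro abs_ratio_le_1)

lemma nuh_le_1: "k \<in> through q \<Longrightarrow> \<bar>nuh q k v\<bar> \<le> 1"
  unfolding nuh_def by (rule abs_ratio_le_1[of "through q" k "\<lambda>k. nu q k v"]) (auto simp: finite_through nu_nonneg)

lemma muh_lip: "q \<in> pairs \<Longrightarrow> bdd_lip (UNIV \<inter> sphere 0 1) (muh q)"
  unfolding muh_def
proof (rule bdd_lip_ratio)
  show "bdd_lip (UNIV \<inter> sphere 0 1) (mu q)" for q
    unfolding mu_def
  proof (rule bdd_lip_prod)
    show "bdd_lip (UNIV \<inter> sphere 0 1) (\<lambda>x. if k \<in> through q then norm x else norm (dot (a k) x))" for k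
      by (cases "k \<in> through q") (auto intro: bdd_lip_norm bdd_lip_norm_dot)
  qed simp
  show "(\<Sum>q\<in>pairs. mu q x) > 0" if "x \<in> UNIV \<inter> sphere 0 1" for x
    using that by (intro mu_sum_pos) auto
qed (use finite_pairs in auto)

lemma nuh_lip:
  assumes "q \<in> pairs" "k \<in> through q"
  shows "bdd_lip (W q \<inter> sphere 0 1) (nuh q k)"
  unfolding nuh_def
proof (rule bdd_lip_ratio)
  show "bdd_lip (W q \<inter> sphere 0 1) (nu q k)" for k
    unfolding nu_def using finite_through by (intro bdd_lip_prod) (auto intro: bdd_lip_norm_dot)
  have "closed (W q)" unfolding W_def
    by (intro closed_Collect_eq continuous_dot continuous_on_const)
  then show "compact (W q \<inter> sphere 0 1)" by (simp add: closed_Int_compact)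
  show "(\<Sum>k\<in>through q. nu q k x) > 0" if "x \<in> W q \<inter> sphere 0 1" for x
    using that assms by (intro nu_sum_pos) auto
qed (use finite_through assms in auto)

text \<open>The constant depends on the arrangement \<open>a\<close> alone. This allows the
  threshold in \<open>locally_trivial\<close> to be fixed before the perturbed arrangement is
  known.\<close>

lemma lip_const:
  obtains C where "0 \<le> C" "\<And>q. q \<in> pairs \<Longrightarrow> C-lipschitz_on (UNIV \<inter> sphere 0 1) (muh q)"
    "\<And>q k. q \<in> pairs \<Longrightarrow> k \<in> through q \<Longrightarrow> C-lipschitz_on (W q \<inter> sphere 0 1) (nuh q k)"
proof -
  let ?P = "\<lambda>x C. C-lipschitz_on (UNIV \<inter> sphere 0 1) (muh (fst x)) \<and> C-lipschitz_on (W (fst x) \<inter> sphere 0 1) (nuh (fst x) (snd x))"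
  have "\<exists>C\<ge>0. \<forall>x\<in>Sigma pairs through. ?P x C"
  proof (rule finite_uniform_const)
    show "finite (Sigma pairs through)" using finite_pairs finite_through by auto
    fix x assume x: "x \<in> Sigma pairs through"
    then obtain C D where "C-lipschitz_on (UNIV \<inter> sphere 0 1) (muh (fst x))"
       "D-lipschitz_on (W (fst x) \<inter> sphere 0 1) (nuh (fst x) (snd x))"
      using muh_lip[of "fst x"] nuh_lip[of "fst x" "snd x"] unfolding bdd_lip_def by auto
    then have "?P x (max C D)"
      by (auto intro: lipschitz_on_mono[OF _ subset_refl max.cobounded1] lipschitz_on_mono[OF _ subset_refl max.cobounded2])
    then show "\<exists>C. ?P x C" by blast
  next
    fix x C D assume "?P x C" "C \<le> (D::real)"
    then show "?P x D" by (auto intro: lipschitz_on_mono[OF _ subset_refl])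
  qed
  then obtain C where C: "C \<ge> 0" "\<forall>x\<in>Sigma pairs through. ?P x C" by blast
  show ?thesis
  proof (rule that[OF C(1)])
    fix q assume q: "q \<in> pairs"
    then have "(q, fst q) \<in> Sigma pairs through" using fst_in_through by auto
    then show "C-lipschitz_on (UNIV \<inter> sphere 0 1) (muh q)" using C(2) by force
  next
    fix q k assume "q \<in> pairs" "k \<in> through q"
    then have "(q, k) \<in> Sigma pairs through" by auto
    then show "C-lipschitz_on (W q \<inter> sphere 0 1) (nuh q k)" using C(2) by force
  qed
qed

lemma norm_phi: "q \<in> pairs \<Longrightarrow> norm (phi q v) \<le> norm v / norm (pt q)"
proof -
  assume q: "q \<in> pairs"
  have "norm (phi q v) = norm (dot (cnjv (pt q)) v) / (norm (pt q))\<^sup>2"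
    by (simp add: phi_def norm_divide norm_power)
  also have "\<dots> \<le> (norm (pt q) * norm v) / (norm (pt q))\<^sup>2"
    using norm_dot_le[of "cnjv (pt q)" v] by (intro divide_right_mono) auto
  finally show ?thesis using pt_nz[OF q] by (simp add: power2_eq_square)
qed

lemma phi_linear: "phi q (x - y) = phi q x - phi q y" "phi q (c *s x) = c * phi q x"
  by (simp_all add: phi_def dot_linear diff_divide_distrib)

lemma Q_linear: "Q q (x - y) = Q q x - Q q y" "Q q (c *s x) = c *s Q q x"
  by (simp_all add: Q_def phi_linear vec_eq_iff algebra_simps)

lemma norm_Q: "q \<in> pairs \<Longrightarrow> norm (Q q v) \<le> 2 * norm v"
proof -
  assume q: "q \<in> pairs"
  have "norm (Q q v) \<le> norm v + norm (phi q v) * norm (pt q)"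
    unfolding Q_def by (metis norm_triangle_ineq4 norm_vsmult)
  then show ?thesis using norm_phi[OF q, of v] pt_nz[OF q] by (simp add: field_simps)
qed

text \<open>
  The homeomorphism is \<open>v \<mapsto> v + gmap b v\<close>.  Write \<open>p\<close>, \<open>p'\<close> for the old and new position of the
  intersection point \<open>q\<close>.  For \<open>k\<close> through \<open>q\<close> the linear map
  \<open>v \<mapsto> v + phi q v *s (p' - p) - dot (b k - a k) (Q q v) *s e\<^sub>k\<close> with \<open>dot (b k) e\<^sub>k = 1\<close> sends \<open>p\<close> to \<open>p'\<close>
  and the plane \<open>a k\<close> to \<open>b k\<close>.  These maps are averaged twice: \<open>nu q k\<close> vanishes on the lines through
  \<open>q\<close> other than \<open>k\<close>, and \<open>mu q\<close> on the lines that miss \<open>q\<close>.  The weights \<open>nuh\<close> are discontinuous at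
  \<open>p\<close>, but multiply terms that vanish there.
\<close>

definition "bracket b q v = phi q v *s (crs (b (fst q)) (b (snd q)) - pt q) -
  (\<Sum>k\<in>through q. nuh q k (Q q v) *\<^sub>R (dot (b k - a k) (Q q v) *s (inverse (of_real ((norm (b k))\<^sup>2)) *s cnjv (b k))))"

definition "gmap b v = (\<Sum>q\<in>pairs. muh q v *\<^sub>R bracket b q v)"

text \<open>The constant is linear in \<eta>. The term with \<open>phi\<close> contributes \<eta>;
  each of at most \<open>n\<close> summands contributes \<eta> times \<open>1 + 2 * C\<close> for
  its weight and 2 for the projection \<open>Q q\<close>.\<close>

lemma bracket_lipschitz:
  assumes "0 \<le> \<eta>" "0 \<le> C" and q: "q \<in> pairs"
    and C: "\<And>k. k \<in> through q \<Longrightarrow> C-lipschitz_on (W q \<inter> sphere 0 1) (nuh q k)"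
    and b: "\<And>k. k < n \<Longrightarrow> b k \<noteq> 0 \<and> norm (b k - a k) \<le> \<eta> * norm (b k)"
    and p: "norm (crs (b (fst q)) (b (snd q)) - pt q) \<le> \<eta> * norm (pt q)"
  shows "((1 + real n * ((1 + 2 * C) * 2)) * \<eta>)-lipschitz_on UNIV (bracket b q)"
proof -
  let ?e = "\<lambda>k. inverse (of_real ((norm (b k))\<^sup>2)) *s cnjv (b k)"
  let ?d = "crs (b (fst q)) (b (snd q)) - pt q"
  have 1: "\<eta>-lipschitz_on UNIV (\<lambda>v. phi q v *s ?d)"
  proof (rule lipschitz_on_linear)
    show "phi q (x - y) *s ?d = phi q x *s ?d - phi q y *s ?d" for x y
      by (simp add: phi_linear vec_eq_iff algebra_simps)
    show "norm (phi q x *s ?d) \<le> \<eta> * norm x" for x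
    proof -
      have "norm (phi q x *s ?d) \<le> (norm x / norm (pt q)) * (\<eta> * norm (pt q))"
        unfolding norm_vsmult using norm_phi[OF q] p by (intro mult_mono) auto
      then show ?thesis using pt_nz[OF q] by (simp add: mult.commute)
    qed
  qed fact
  have 2: "(((1 + 2 * C) * \<eta>) * 2)-lipschitz_on UNIV (\<lambda>v. nuh q k (Q q v) *\<^sub>R (dot (b k - a k) (Q q v) *s ?e k))"
    if k: "k \<in> through q" for k
  proof -
    have kn: "k < n" using through_lt k by blast
    have "\<eta>-lipschitz_on (W q) (\<lambda>x. dot (b k - a k) x *s ?e k)"
    proof (rule lipschitz_on_linear)
      show "dot (b k - a k) (x - y) *s ?e k = dot (b k - a k) x *s ?e k - dot (b k - a k) y *s ?e k" for x y
        by (simp add: dot_linear(4) vec_eq_iff algebra_simps)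
      show "norm (dot (b k - a k) x *s ?e k) \<le> \<eta> * norm x" for x
      proof -
        have "norm (?e k) = inverse (norm (b k))"
          using b[OF kn] by (simp add: norm_inverse norm_mult power2_eq_square)
        then have "norm (dot (b k - a k) x *s ?e k) = norm (dot (b k - a k) x) * inverse (norm (b k))"
          by (simp only: norm_vsmult)
        also have "\<dots> \<le> ((\<eta> * norm (b k)) * norm x) * inverse (norm (b k))"
          using b[OF kn] by (intro mult_right_mono order_trans[OF norm_dot_le]) auto
        also have "\<dots> = \<eta> * norm x" using b[OF kn] by simp
        finally show ?thesis .
      qed
    qed fact
    then have *: "((1 + 2 * C) * \<eta>)-lipschitz_on (W q) (\<lambda>x. nuh q k x *\<^sub>R (dot (b k - a k) x *s ?e k))"
      using C[OF k] nuh_le_1[OF k] nuh_scale[OF _ k]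
      by (intro lipschitz_on_homogeneous_times) (auto simp: W_def scaleR_eq_vsmult dot_linear)
    have Q2: "2-lipschitz_on UNIV (Q q)"
      using norm_Q[OF q] Q_linear by (intro lipschitz_on_linear) auto
    have "((1 + 2 * C) * \<eta>)-lipschitz_on (range (Q q)) (\<lambda>x. nuh q k x *\<^sub>R (dot (b k - a k) x *s ?e k))"
      using * by (rule lipschitz_on_subset) (use Q_simps(3)[OF q] in auto)
    then show ?thesis by (rule lipschitz_on_compose2[OF Q2])
  qed
  have "(real (card (through q)) * (((1 + 2 * C) * \<eta>) * 2))-lipschitz_on UNIV
      (\<lambda>v. \<Sum>k\<in>through q. nuh q k (Q q v) *\<^sub>R (dot (b k - a k) (Q q v) *s ?e k))"
    using 2 assms(1,2) finite_through by (intro lipschitz_on_sum) auto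
  then have 3: "(real n * (((1 + 2 * C) * \<eta>) * 2))-lipschitz_on UNIV
      (\<lambda>v. \<Sum>k\<in>through q. nuh q k (Q q v) *\<^sub>R (dot (b k - a k) (Q q v) *s ?e k))"
    using assms(1,2) card_through[of q] by (rule_tac lipschitz_on_mono[OF _ subset_refl]) (auto intro!: mult_right_mono simp del: split_paired_All)
  have "(\<eta> + real n * (((1 + 2 * C) * \<eta>) * 2))-lipschitz_on UNIV (bracket b q)"
    unfolding bracket_def by (intro lipschitz_on_diff 1 3)
  then show ?thesis by (simp add: algebra_simps)
qed

lemma phi_0 [simp]: "phi q 0 = 0" and Q_0 [simp]: "Q q 0 = 0"
  by (simp_all add: phi_def Q_def dot_linear)

lemma bracket_0 [simp]: "bracket b q 0 = 0"
  by (simp add: bracket_def dot_linear)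

lemma bracket_scale: "c \<noteq> 0 \<Longrightarrow> bracket b q (c *s v) = c *s bracket b q v"
proof -
  assume c: "c \<noteq> 0"
  have *: "(\<Sum>k\<in>through q. nuh q k (Q q (c *s v)) *\<^sub>R (dot (b k - a k) (Q q (c *s v)) *s e k)) =
    c *s (\<Sum>k\<in>through q. nuh q k (Q q v) *\<^sub>R (dot (b k - a k) (Q q v) *s e k))" for e :: "nat \<Rightarrow> complex^3"
    using c by (simp add: Q_linear nuh_scale dot_linear(6) vec_eq_iff sum_distrib_left mult.assoc cong: sum.cong)
  have "(c * x) *s d - c *s S = c *s (x *s d - S)" for x and d S :: "complex^3"
    by (simp add: vec_eq_iff algebra_simps)
  then show ?thesis unfolding bracket_def * phi_linear by simp
qed

lemma gmap_scale: "gmap b (c *s v) = c *s gmap b v"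
proof (cases "c = 0")
  case True
  then show ?thesis by (simp add: gmap_def)
next
  case False
  then show ?thesis
    by (simp add: gmap_def muh_scale bracket_scale vec_eq_iff sum_distrib_left cong: sum.cong)
qed

lemma gmap_lipschitz:
  assumes "0 \<le> \<eta>" "0 \<le> C"
    and C: "\<And>q. q \<in> pairs \<Longrightarrow> C-lipschitz_on (UNIV \<inter> sphere 0 1) (muh q)"
      "\<And>q k. q \<in> pairs \<Longrightarrow> k \<in> through q \<Longrightarrow> C-lipschitz_on (W q \<inter> sphere 0 1) (nuh q k)"
    and b: "\<And>k. k < n \<Longrightarrow> b k \<noteq> 0 \<and> norm (b k - a k) \<le> \<eta> * norm (b k)"
    and p: "\<And>q. q \<in> pairs \<Longrightarrow> norm (crs (b (fst q)) (b (snd q)) - pt q) \<le> \<eta> * norm (pt q)"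
  shows "(real (card pairs) * ((1 + 2 * C) * ((1 + real n * ((1 + 2 * C) * 2)) * \<eta>)))-lipschitz_on UNIV (gmap b)"
  unfolding gmap_def
proof (rule lipschitz_on_sum[OF finite_pairs])
  show "0 \<le> (1 + 2 * C) * ((1 + real n * ((1 + 2 * C) * 2)) * \<eta>)" using assms(1,2) by simp
  fix q assume q: "q \<in> pairs"
  show "((1 + 2 * C) * ((1 + real n * ((1 + 2 * C) * 2)) * \<eta>))-lipschitz_on UNIV (\<lambda>v. muh q v *\<^sub>R bracket b q v)"
  proof (rule lipschitz_on_homogeneous_times)
    show "((1 + real n * ((1 + 2 * C) * 2)) * \<eta>)-lipschitz_on UNIV (bracket b q)"
      using assms q by (intro bracket_lipschitz) auto
  qed (use C q muh_le_1 muh_scale in \<open>auto simp: scaleR_eq_vsmult\<close>)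
qed

text \<open>If \<open>Q q v = 0\<close>, then \<open>v\<close> is a multiple of the old point and
  moves to the same multiple of the new one, which lies on \<open>b i\<close>. Otherwise only the
  summand of \<open>i\<close> survives, and it cancels exactly the value of \<open>b i\<close> at
  \<open>Q q v\<close>.\<close>

lemma bracket_on_line:
  assumes q: "q \<in> pairs" and i: "i \<in> through q" "dot (a i) v = 0"
    and b: "b i \<noteq> 0" "det3 (b (fst q)) (b (snd q)) (b i) = 0"
  shows "dot (b i) (v + bracket b q v) = 0"
proof -
  let ?e = "\<lambda>k. inverse (of_real ((norm (b k))\<^sup>2)) *s cnjv (b k)"
  let ?p' = "crs (b (fst q)) (b (snd q))"
  have bp: "dot (b i) ?p' = 0"
    using b(2) det3_perm(5)[where a="b (fst q)" and b="b (snd q)" and c="b i"] by (simp add: det3_def)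
  have ap: "dot (a i) (pt q) = 0" using i through_iff through_lt by blast
  have v: "v = Q q v + phi q v *s pt q" by (simp add: Q_def)
  show ?thesis
  proof (cases "Q q v = 0")
    case True
    then have "bracket b q v = phi q v *s (?p' - pt q)" by (simp add: bracket_def dot_linear)
    moreover have "v = phi q v *s pt q" using v True by simp
    ultimately have "v + bracket b q v = phi q v *s ?p'" by (simp add: vec_eq_iff algebra_simps)
    then show ?thesis using bp by (simp add: dot_linear)
  next
    case False
    have 0: "dot (a i) (Q q v) = 0" using dot_Q i by simp
    have "(\<Sum>k\<in>through q. nuh q k (Q q v) *\<^sub>R (dot (b k - a k) (Q q v) *s ?e k))
      = (\<Sum>k\<in>through q. if k = i then dot (b k - a k) (Q q v) *s ?e k else 0)"
      using nuh_on_line[OF q Q_simps(3)[OF q] False i(1) 0] by (intro sum.cong) auto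
    also have "\<dots> = dot (b i - a i) (Q q v) *s ?e i" using finite_through i by simp
    also have "\<dots> = dot (b i) (Q q v) *s ?e i" using 0 by (simp add: dot_linear)
    finally have B: "bracket b q v = phi q v *s (?p' - pt q) - dot (b i) (Q q v) *s ?e i"
      by (simp add: bracket_def)
    have "dot (b i) (?e i) = 1" using b(1) by (simp add: dot_linear(6) dot_cnjv_self)
    then have "dot (b i) (bracket b q v) = - phi q v * dot (b i) (pt q) - dot (b i) (Q q v)"
      unfolding B dot_linear(3,4) dot_linear(6)[of _ "phi q v"] dot_linear(6)[of _ "dot (b i) (Q q v)"] by (simp add: bp)
    moreover have "dot (b i) v = dot (b i) (Q q v) + phi q v * dot (b i) (pt q)"
      by (subst v) (simp only: dot_linear)
    ultimately show ?thesis by (simp add: dot_linear)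
  qed
qed

text \<open>The condition \<open>dot (b i) (v + x) = 0\<close> is affine in \<open>x\<close>, hence
  survives averaging. Points \<open>q\<close> off line \<open>i\<close> have weight zero at
  \<open>v\<close>, and all others satisfy it by \<open>bracket_on_line\<close>.\<close>

lemma gmap_on_line:
  assumes i: "i < n" "dot (a i) v = 0" and b: "b i \<noteq> 0"
    and T: "\<And>q. q \<in> pairs \<Longrightarrow> i \<in> through q \<Longrightarrow> det3 (b (fst q)) (b (snd q)) (b i) = 0"
  shows "dot (b i) (v + gmap b v) = 0"
proof (cases "v = 0")
  case True
  then show ?thesis by (simp add: gmap_def dot_linear)
next
  case False
  have "muh q v * dot (b i) (bracket b q v) = - (muh q v * dot (b i) v)" if q: "q \<in> pairs" for q
  proof (cases "i \<in> through q")
    case True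
    have "dot (b i) v + dot (b i) (bracket b q v) = 0"
      using bracket_on_line[OF q True i(2) b T[OF q True]] by (simp add: dot_linear)
    then have "dot (b i) (bracket b q v) = - dot (b i) v" by (simp add: add_eq_0_iff)
    then show ?thesis by simp
  next
    case False
    then have "mu q v = 0" unfolding mu_def using i by (intro prod_zero) auto
    then show ?thesis by (simp add: muh_def)
  qed
  then have "dot (b i) (gmap b v) = (\<Sum>q\<in>pairs. - (muh q v * dot (b i) v))"
    unfolding gmap_def dot_sum by (intro sum.cong) (auto simp: scaleR_eq_vsmult dot_linear)
  also have "\<dots> = - (of_real (\<Sum>q\<in>pairs. muh q v) * dot (b i) v)"
    by (simp add: sum_negf sum_distrib_right)
  finally show ?thesis using muh_sum[OF False] by (simp add: dot_linear)
qed

text \<open>Closeness is measured relatively: for lines against \<open>norm (b k)\<close>, because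
  the correcting vector in \<open>bracket\<close> has norm \<open>1 / norm (b k)\<close>, and for
  points against the old point, because \<open>phi\<close> divides by its norm.\<close>

lemma locally_trivial:
  "\<exists>\<eta>>0. \<forall>b. (\<forall>k<n. b k \<noteq> 0 \<and> norm (b k - a k) \<le> \<eta> * norm (b k)) \<and>
     (\<forall>i<n. \<forall>j<n. i \<noteq> j \<longrightarrow> norm (crs (b i) (b j) - crs (a i) (a j)) \<le> \<eta> * norm (crs (a i) (a j))) \<and>
     (\<forall>i<n. \<forall>j<n. \<forall>k<n. det3 (a i) (a j) (a k) = 0 \<longrightarrow> det3 (b i) (b j) (b k) = 0) \<longrightarrow>
     lines_homeo n a b"
proof -
  obtain C where C: "0 \<le> C" "\<And>q. q \<in> pairs \<Longrightarrow> C-lipschitz_on (UNIV \<inter> sphere 0 1) (muh q)"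
    "\<And>q k. q \<in> pairs \<Longrightarrow> k \<in> through q \<Longrightarrow> C-lipschitz_on (W q \<inter> sphere 0 1) (nuh q k)"
    by (rule lip_const, rule that)
  define L where "L = real (card pairs) * ((1 + 2 * C) * (1 + real n * ((1 + 2 * C) * 2)))"
  have L: "0 \<le> L" using C(1) by (simp add: L_def)
  \<comment> \<open>\<open>L * \<eta>\<close> is the Lipschitz constant of \<open>gmap b\<close>; at
    most 1/4, it makes the map invertible. Since \<open>\<eta> * (1 + L)\<close> is 1/4 and
    \<open>norm (b i)\<close> is at most twice \<open>norm (a i)\<close>, the error \<open>r\<close>
    below is at most half of \<open>dot (a i) v\<close>.\<close>
  define \<eta> where "\<eta> = 1 / (4 * (L + 1))"
  have \<eta>: "\<eta> > 0" "\<eta> \<le> 1/4" "L * \<eta> \<le> 1/4" "\<eta> * (1 + L) = 1/4"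
    using L by (auto simp: \<eta>_def field_simps)
  show ?thesis
  proof (intro exI[of _ \<eta>] conjI allI impI \<eta>(1); elim conjE)
    fix b :: "nat \<Rightarrow> complex^3"
    assume b': "\<forall>k<n. b k \<noteq> 0 \<and> norm (b k - a k) \<le> \<eta> * norm (b k)"
      and p: "\<forall>i<n. \<forall>j<n. i \<noteq> j \<longrightarrow> norm (crs (b i) (b j) - crs (a i) (a j)) \<le> \<eta> * norm (crs (a i) (a j))"
      and T: "\<forall>i<n. \<forall>j<n. \<forall>k<n. det3 (a i) (a j) (a k) = 0 \<longrightarrow> det3 (b i) (b j) (b k) = 0"
    note b = b'[rule_format]
    have "(real (card pairs) * ((1 + 2 * C) * ((1 + real n * ((1 + 2 * C) * 2)) * \<eta>)))-lipschitz_on UNIV (gmap b)"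
      using \<eta>(1) by (intro gmap_lipschitz C b) (auto simp: pairs_def pt_def p)
    then have lip: "(L * \<eta>)-lipschitz_on UNIV (gmap b)" by (simp add: L_def mult.assoc)
    obtain h where h: "continuous_on UNIV h" "\<And>v. h (v + gmap b v) = v" "\<And>v. h v + gmap b (h v) = v"
      by (rule lipschitz_perturbation_of_identity[OF lip]) (use \<eta> in auto)
    have on_line: "dot (b i) (v + gmap b v) = 0" if "i < n" "dot (a i) v = 0" for i v
      using that b by (intro gmap_on_line) (auto simp: pairs_def through_def T)
    have off_line: "dot (b i) (v + gmap b v) \<noteq> 0" if i: "i < n" "dot (a i) v \<noteq> 0" for i v
    proof -
      \<comment> \<open>\<open>r\<close> vanishes on the line and has a small Lipschitz constant, so it cannot cancel \<open>dot (a i) v\<close>.\<close>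
      define r where "r w = dot (b i) (w + gmap b w) - dot (a i) w" for w
      have a0: "a i \<noteq> 0" using i by (auto simp: dot_linear)
      \<comment> \<open>\<open>w\<close> is the orthogonal projection of \<open>v\<close> to the
        plane of line \<open>i\<close>; its distance from \<open>v\<close> is proportional to
        \<open>dot (a i) v\<close>, which turns the Lipschitz bound into a bound by that
        value.\<close>
      define w where "w = v - (dot (a i) v / of_real ((norm (a i))\<^sup>2)) *s cnjv (a i)"
      have w: "dot (a i) w = 0" using a0 by (simp add: w_def dot_linear dot_cnjv_self)
      have nvw: "norm (v - w) = norm (dot (a i) v) / norm (a i)"
        using a0 by (simp add: w_def norm_divide norm_mult power2_eq_square)
      have ba: "norm (b i) \<le> 2 * norm (a i)"
      proof -
        have "norm (b i) \<le> norm (a i) + norm (b i - a i)" by (metis norm_triangle_sub)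
        also have "\<dots> \<le> norm (a i) + 1/4 * norm (b i)"
          using b[OF i(1)] \<eta>(2) by (meson add_left_mono mult_right_mono norm_ge_zero order_trans)
        finally show ?thesis using norm_ge_zero[of "a i"] by linarith
      qed
      have "r v - r w = dot (b i - a i) (v - w) + dot (b i) (gmap b v - gmap b w)"
        by (simp add: r_def dot_linear)
      then have "norm (r v - r w) \<le> norm (dot (b i - a i) (v - w)) + norm (dot (b i) (gmap b v - gmap b w))"
        by (metis norm_triangle_ineq)
      also have "\<dots> \<le> norm (b i - a i) * norm (v - w) + norm (b i) * norm (gmap b v - gmap b w)"
        by (intro add_mono norm_dot_le)
      also have "\<dots> \<le> (\<eta> * norm (b i)) * norm (v - w) + norm (b i) * (L * \<eta> * norm (v - w))"
        using b[OF i(1)] lipschitz_onD[OF lip, of v w]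
        by (intro add_mono mult_left_mono mult_right_mono) (auto simp: dist_norm)
      also have "\<dots> = \<eta> * (1 + L) * norm (b i) * norm (v - w)" by (simp add: algebra_simps)
      also have "\<dots> \<le> 1/4 * (2 * norm (a i)) * norm (v - w)"
        unfolding \<eta>(4) using ba by (intro mult_right_mono mult_left_mono) auto
      also have "\<dots> = norm (dot (a i) v) / 2" using a0 by (simp add: nvw)
      also have "\<dots> < norm (dot (a i) v)" using i by simp
      finally have "norm (r v - r w) < norm (dot (a i) v)" .
      moreover have "r w = 0" using on_line[OF i(1) w] w by (simp add: r_def)
      ultimately have "norm (r v) < norm (dot (a i) v)" by simp
      moreover have "r v = - dot (a i) v" if "dot (b i) (v + gmap b v) = 0" using that by (simp add: r_def)
      ultimately show ?thesis by auto
    qed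
    have hom: "c *s v + gmap b (c *s v) = c *s (v + gmap b v)" for c v
      by (simp add: gmap_scale vec_eq_iff algebra_simps)
    show "lines_homeo n a b"
    proof (rule lines_homeoI[of "\<lambda>v. v + gmap b v" h])
      show "continuous_on UNIV (\<lambda>v. v + gmap b v)"
        using lipschitz_on_continuous_on[OF lip] by (intro continuous_intros)
      show "0 + gmap b 0 = 0" by (simp add: gmap_def)
      show "(\<lambda>v. v + gmap b v) ` proj_pt v = proj_pt (v + gmap b v)" for v
        by (simp only: proj_pt_def setcompr_eq_image image_image hom)
      show "dot (b i) (v + gmap b v) = 0 \<longleftrightarrow> dot (a i) v = 0" if "i < n" for i v
        using on_line off_line that by blast
    qed (use h in auto)
  qed
qed

end

section \<open>Polynomial deformations\<close>

definition polyfun :: "(complex \<Rightarrow> complex) \<Rightarrow> bool" where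
  "polyfun f \<longleftrightarrow> (\<exists>p. f = poly p)"

definition polycurve :: "(complex \<Rightarrow> complex^3) \<Rightarrow> bool" where
  "polycurve g \<longleftrightarrow> (\<forall>k. polyfun (\<lambda>t. g t $ k))"

lemma polyfun_const: "polyfun (\<lambda>t. c)"
  unfolding polyfun_def by (rule exI[of _ "[:c:]"]) auto

lemma polyfun_id: "polyfun (\<lambda>t. t)"
  unfolding polyfun_def by (rule exI[of _ "[:0,1:]"]) auto

lemma polyfun_add: "polyfun f \<Longrightarrow> polyfun g \<Longrightarrow> polyfun (\<lambda>t. f t + g t)"
  unfolding polyfun_def by (elim exE, rule_tac x="p + pa" in exI) (simp add: fun_eq_iff)

lemma polyfun_diff: "polyfun f \<Longrightarrow> polyfun g \<Longrightarrow> polyfun (\<lambda>t. f t - g t)"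
  unfolding polyfun_def by (elim exE, rule_tac x="p - pa" in exI) (simp add: fun_eq_iff)

lemma polyfun_mult: "polyfun f \<Longrightarrow> polyfun g \<Longrightarrow> polyfun (\<lambda>t. f t * g t)"
  unfolding polyfun_def by (elim exE, rule_tac x="p * pa" in exI) (simp add: fun_eq_iff)

lemmas polyfun_intros = polyfun_const polyfun_id polyfun_add polyfun_diff polyfun_mult

lemma finite_polyfun_zeros:
  assumes "polyfun f" "f t0 \<noteq> 0"
  shows "finite {t. f t = 0}"
proof -
  obtain p where p: "f = poly p" using assms(1) polyfun_def by blast
  then have "p \<noteq> 0" using assms(2) by auto
  then show ?thesis unfolding p by (rule poly_roots_finite)
qed

lemma polycurve_nth: "polycurve g \<Longrightarrow> polyfun (\<lambda>t. g t $ k)"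
  by (simp add: polycurve_def)

lemma polycurve_3: "polycurve g \<longleftrightarrow> polyfun (\<lambda>t. g t $ 1) \<and> polyfun (\<lambda>t. g t $ 2) \<and> polyfun (\<lambda>t. g t $ 3)"
  by (simp add: polycurve_def forall_3)

lemma polycurve_crs: "polycurve f \<Longrightarrow> polycurve g \<Longrightarrow> polycurve (\<lambda>t. crs (f t) (g t))"
  unfolding polycurve_3 by (auto intro!: polyfun_intros)

lemma polycurve_add: "polycurve f \<Longrightarrow> polycurve g \<Longrightarrow> polycurve (\<lambda>t. f t + g t)"
  unfolding polycurve_3 by (auto intro!: polyfun_intros)

lemma polycurve_scale: "polyfun c \<Longrightarrow> polycurve g \<Longrightarrow> polycurve (\<lambda>t. c t *s g t)"
  unfolding polycurve_3 by (auto intro!: polyfun_intros)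

lemma polycurve_const: "polycurve (\<lambda>t. v)"
  by (simp add: polycurve_def polyfun_const)

lemma polyfun_det3: "polycurve f \<Longrightarrow> polycurve g \<Longrightarrow> polycurve h \<Longrightarrow> polyfun (\<lambda>t. det3 (f t) (g t) (h t))"
  unfolding polycurve_3 det3_alt by (auto intro!: polyfun_intros)

lemma polycurve_continuous:
  assumes "polycurve g"
  shows "continuous_on S g"
proof -
  have "continuous_on S (\<lambda>t. g t $ k)" for k
  proof -
    obtain p where p: "(\<lambda>t. g t $ k) = poly p" using assms unfolding polycurve_def polyfun_def by blast
    show ?thesis unfolding p by (intro continuous_on_poly continuous_on_id)
  qed
  then have "continuous_on S (\<lambda>t. \<chi> k. g t $ k)" by (rule continuous_on_vec_lambda)
  then show ?thesis by simp
qed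

lemma finite_polycurve_zeros:
  assumes "polycurve g" "g t0 \<noteq> 0"
  shows "finite {t. g t = 0}"
proof -
  obtain k where "g t0 $ k \<noteq> 0" using assms(2) by (auto simp: vec_eq_iff)
  then have "finite {t. g t $ k = 0}" using finite_polyfun_zeros polycurve_nth[OF assms(1)] by blast
  then show ?thesis by (rule rev_finite_subset) auto
qed

lemma crs_scale: "crs (c *s a) (d *s b) = (c * d) *s crs a b"
  by (simp add: vec3_eq_iff algebra_simps)

lemma det3_scale: "det3 (c *s a) (d *s b) (e *s f) = (c * d * e) * det3 a b f"
  by (simp add: det3_alt algebra_simps)

text \<open>The concurrences in \<open>T\<close> are needed at every parameter, whereas distinctness
  and non-concurrence come from the two ends and hold off finitely many parameters.\<close>

lemma lines_homeo_along_curve: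
  assumes n: "2 \<le> n" and a: "line_arrangement n a" and b: "line_arrangement n b"
    and same: "\<And>i j k. i < n \<Longrightarrow> j < n \<Longrightarrow> k < n \<Longrightarrow> det3 (a i) (a j) (a k) = 0 \<longleftrightarrow> det3 (b i) (b j) (b k) = 0"
    and poly: "\<And>i. i < n \<Longrightarrow> polycurve (\<gamma> i)"
    and at0: "\<And>i. i < n \<Longrightarrow> \<exists>c. c \<noteq> 0 \<and> \<gamma> i 0 = c *s a i"
    and at1: "\<And>i. i < n \<Longrightarrow> \<exists>c. c \<noteq> 0 \<and> \<gamma> i 1 = c *s b i"
    and T: "\<And>i j k t. i < n \<Longrightarrow> j < n \<Longrightarrow> k < n \<Longrightarrow> det3 (a i) (a j) (a k) = 0 \<Longrightarrow> det3 (\<gamma> i t) (\<gamma> j t) (\<gamma> k t) = 0"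
  shows "lines_homeo n a b"
proof -
  \<comment> \<open>\<open>B1\<close> collects the parameters where two lines coincide or a
    coefficient vector vanishes, \<open>B2\<close> those with an unwanted concurrence. Finiteness
    comes from the polynomials being nonzero at 0; that 1 is also avoided uses
    \<open>same\<close>.\<close>
  define B1 where "B1 = (\<Union>(i,j)\<in>{(i,j). i < n \<and> j < n \<and> i \<noteq> j}. {t. crs (\<gamma> i t) (\<gamma> j t) = 0})"
  define B2 where "B2 = (\<Union>(i,j,k)\<in>{(i,j,k). i < n \<and> j < n \<and> k < n \<and> det3 (a i) (a j) (a k) \<noteq> 0}. {t. det3 (\<gamma> i t) (\<gamma> j t) (\<gamma> k t) = 0})"
  have crs0: "crs (\<gamma> i 0) (\<gamma> j 0) \<noteq> 0" if ij: "i < n" "j < n" "i \<noteq> j" for i j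
  proof -
    have nz: "crs (a i) (a j) \<noteq> 0" using a ij unfolding line_arrangement_iff by auto
    obtain c d where "c \<noteq> 0" "\<gamma> i 0 = c *s a i" "d \<noteq> 0" "\<gamma> j 0 = d *s a j" using at0[OF ij(1)] at0[OF ij(2)] by blast
    then show ?thesis using nz by (simp add: crs_scale)
  qed
  have crs1: "crs (\<gamma> i 1) (\<gamma> j 1) \<noteq> 0" if ij: "i < n" "j < n" "i \<noteq> j" for i j
  proof -
    have nz: "crs (b i) (b j) \<noteq> 0" using b ij unfolding line_arrangement_iff by auto
    obtain c d where "c \<noteq> 0" "\<gamma> i 1 = c *s b i" "d \<noteq> 0" "\<gamma> j 1 = d *s b j" using at1[OF ij(1)] at1[OF ij(2)] by blast
    then show ?thesis using nz by (simp add: crs_scale)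
  qed
  have det0: "det3 (\<gamma> i 0) (\<gamma> j 0) (\<gamma> k 0) \<noteq> 0" if ijk: "i < n" "j < n" "k < n" "det3 (a i) (a j) (a k) \<noteq> 0" for i j k
  proof -
    obtain c d e where "c \<noteq> 0" "\<gamma> i 0 = c *s a i" "d \<noteq> 0" "\<gamma> j 0 = d *s a j" "e \<noteq> 0" "\<gamma> k 0 = e *s a k"
      using at0[OF ijk(1)] at0[OF ijk(2)] at0[OF ijk(3)] by blast
    then show ?thesis using ijk(4) by (simp add: det3_scale)
  qed
  have det1: "det3 (\<gamma> i 1) (\<gamma> j 1) (\<gamma> k 1) \<noteq> 0" if ijk: "i < n" "j < n" "k < n" "det3 (a i) (a j) (a k) \<noteq> 0" for i j k
  proof -
    obtain c d e where "c \<noteq> 0" "\<gamma> i 1 = c *s b i" "d \<noteq> 0" "\<gamma> j 1 = d *s b j" "e \<noteq> 0" "\<gamma> k 1 = e *s b k"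
      using at1[OF ijk(1)] at1[OF ijk(2)] at1[OF ijk(3)] by blast
    then show ?thesis using ijk(4) same[OF ijk(1-3)] by (simp add: det3_scale)
  qed
  have "finite B1" unfolding B1_def
  proof (rule finite_UN_I)
    show "finite {(i,j). i < n \<and> j < n \<and> i \<noteq> j}"
      by (rule finite_subset[of _ "{..<n} \<times> {..<n}"]) auto
    fix q assume "q \<in> {(i,j). i < n \<and> j < n \<and> i \<noteq> j}"
    then show "finite (case q of (i,j) \<Rightarrow> {t. crs (\<gamma> i t) (\<gamma> j t) = 0})"
      using crs0 by (auto intro!: finite_polycurve_zeros polycurve_crs poly)
  qed
  moreover have "finite B2" unfolding B2_def
  proof (rule finite_UN_I)
    show "finite {(i,j,k). i < n \<and> j < n \<and> k < n \<and> det3 (a i) (a j) (a k) \<noteq> 0}"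
      by (rule finite_subset[of _ "{..<n} \<times> {..<n} \<times> {..<n}"]) auto
    fix q assume "q \<in> {(i,j,k). i < n \<and> j < n \<and> k < n \<and> det3 (a i) (a j) (a k) \<noteq> 0}"
    then show "finite (case q of (i,j,k) \<Rightarrow> {t. det3 (\<gamma> i t) (\<gamma> j t) (\<gamma> k t) = 0})"
      using det0 by (auto intro!: finite_polyfun_zeros polyfun_det3 poly)
  qed
  ultimately have fin: "finite (B1 \<union> B2)" by simp
  define U where "U = UNIV - (B1 \<union> B2)"
  have "connected U" unfolding U_def
    by (rule connected_open_diff_countable[OF _ _ _ countable_finite[OF fin]]) (auto simp: connected_UNIV)
  have U: "crs (\<gamma> i t) (\<gamma> j t) \<noteq> 0" if "t \<in> U" "i < n" "j < n" "i \<noteq> j" for t i j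
    using that unfolding U_def B1_def by auto
  have Ud: "det3 (a i) (a j) (a k) = 0" if "t \<in> U" "i < n" "j < n" "k < n" "det3 (\<gamma> i t) (\<gamma> j t) (\<gamma> k t) = 0" for t i j k
    using that unfolding U_def B2_def by auto
  have U01: "0 \<in> U" "1 \<in> U" using crs0 crs1 det0 det1 unfolding U_def B1_def B2_def by auto
  have nz: "\<gamma> i t \<noteq> 0" if ti: "t \<in> U" "i < n" for i t
  proof -
    obtain j where "j < n" "j \<noteq> i" using n ti(2) that[of 0] that[of 1] by (cases "i = 0") auto
    then have "crs (\<gamma> i t) (\<gamma> j t) \<noteq> 0" using U ti by simp
    then show ?thesis by (auto simp: vec3_eq_iff)
  qed
  have arr: "line_arrangement n (\<lambda>i. \<gamma> i t)" if "t \<in> U" for t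
    using nz[OF that] U[OF that] unfolding line_arrangement_iff by auto
  have "lines_homeo n (\<lambda>i. \<gamma> i 0) (\<lambda>i. \<gamma> i 1)"
  proof (rule connected_equivalence_relation[OF \<open>connected U\<close> U01, where R = "\<lambda>s t. lines_homeo n (\<lambda>i. \<gamma> i s) (\<lambda>i. \<gamma> i t)"])
    fix t assume t: "t \<in> U"
    interpret arrangement n "\<lambda>i. \<gamma> i t" by unfold_locales (use arr t n in auto)
    obtain \<eta> where \<eta>: "\<eta> > 0" and triv: "\<And>b. (\<forall>k<n. b k \<noteq> 0 \<and> norm (b k - \<gamma> k t) \<le> \<eta> * norm (b k)) \<and>
     (\<forall>i<n. \<forall>j<n. i \<noteq> j \<longrightarrow> norm (crs (b i) (b j) - crs (\<gamma> i t) (\<gamma> j t)) \<le> \<eta> * norm (crs (\<gamma> i t) (\<gamma> j t))) \<and>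
     (\<forall>i<n. \<forall>j<n. \<forall>k<n. det3 (\<gamma> i t) (\<gamma> j t) (\<gamma> k t) = 0 \<longrightarrow> det3 (b i) (b j) (b k) = 0) \<longrightarrow>
     lines_homeo n (\<lambda>i. \<gamma> i t) b"
      using locally_trivial by blast
    \<comment> \<open>Strict forms of the two smallness conditions of
      \<open>locally_trivial\<close>: they hold at \<open>s = t\<close> and cut out open sets of
      parameters.\<close>
    define V1 where "V1 = (\<Inter>k\<in>{..<n}. {s. norm (\<gamma> k s - \<gamma> k t) < \<eta> * norm (\<gamma> k s)})"
    define V2 where "V2 = (\<Inter>q\<in>{(i,j). i < n \<and> j < n \<and> i \<noteq> j}.
      {s. norm (crs (\<gamma> (fst q) s) (\<gamma> (snd q) s) - crs (\<gamma> (fst q) t) (\<gamma> (snd q) t)) < \<eta> * norm (crs (\<gamma> (fst q) t) (\<gamma> (snd q) t))})"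
    have "open V1" unfolding V1_def
      by (intro open_INT finite_lessThan ballI open_Collect_less continuous_intros polycurve_continuous poly) auto
    moreover have "open V2" unfolding V2_def
    proof (intro open_INT ballI open_Collect_less continuous_on_const continuous_on_norm continuous_on_diff)
      show "finite {(i,j). i < n \<and> j < n \<and> i \<noteq> j}"
        by (rule finite_subset[of _ "{..<n} \<times> {..<n}"]) auto
      fix q assume "q \<in> {(i,j). i < n \<and> j < n \<and> i \<noteq> j}"
      then show "continuous_on UNIV (\<lambda>s. crs (\<gamma> (fst q) s) (\<gamma> (snd q) s))"
        by (intro polycurve_continuous polycurve_crs poly) auto
    qed
    ultimately have "openin (top_of_set U) (U \<inter> (V1 \<inter> V2))" by (intro openin_open_Int open_Int)
    moreover have "t \<in> U \<inter> (V1 \<inter> V2)"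
      using t \<eta> nz[OF t] U[OF t] unfolding V1_def V2_def by auto
    moreover have "\<forall>s\<in>U \<inter> (V1 \<inter> V2). lines_homeo n (\<lambda>i. \<gamma> i t) (\<lambda>i. \<gamma> i s)"
    proof
      fix s assume s: "s \<in> U \<inter> (V1 \<inter> V2)"
      show "lines_homeo n (\<lambda>i. \<gamma> i t) (\<lambda>i. \<gamma> i s)"
      proof (rule triv[rule_format], intro conjI allI impI)
        show "\<gamma> k s \<noteq> 0" "norm (\<gamma> k s - \<gamma> k t) \<le> \<eta> * norm (\<gamma> k s)" if "k < n" for k
          using s nz[of s k] that unfolding V1_def by (auto intro: less_imp_le)
        show "norm (crs (\<gamma> i s) (\<gamma> j s) - crs (\<gamma> i t) (\<gamma> j t)) \<le> \<eta> * norm (crs (\<gamma> i t) (\<gamma> j t))"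
          if "i < n" "j < n" "i \<noteq> j" for i j
          using s that unfolding V2_def by (auto intro: less_imp_le)
        show "det3 (\<gamma> i s) (\<gamma> j s) (\<gamma> k s) = 0"
          if "i < n" "j < n" "k < n" "det3 (\<gamma> i t) (\<gamma> j t) (\<gamma> k t) = 0" for i j k
          using T Ud t that by blast
      qed
    qed
    ultimately show "\<exists>T. openin (top_of_set U) T \<and> t \<in> T \<and> (\<forall>s\<in>T. lines_homeo n (\<lambda>i. \<gamma> i t) (\<lambda>i. \<gamma> i s))"
      by blast
  qed (use lines_homeo_sym lines_homeo_trans in blast)+
  moreover have "lines_homeo n a (\<lambda>i. \<gamma> i 0)"
    by (rule lines_homeo_cong) (use at0 proj_line_scale in metis)
  moreover have "lines_homeo n (\<lambda>i. \<gamma> i 1) b"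
    by (rule lines_homeo_cong) (use at1 proj_line_scale in metis)
  ultimately show ?thesis using lines_homeo_trans by blast
qed

section \<open>Extending a deformation by one line\<close>

text \<open>The identity in the proof is Cramer's rule multiplied out, so it remains usable when
  some of the three lines coincide, as they may at degenerate parameters.\<close>

lemma det3_zero_of_common:
  assumes "v \<noteq> 0" "dot a v = 0" "dot b v = 0" "dot c v = 0"
  shows "det3 a b c = 0"
proof -
  have "det3 a b c *s v = dot a v *s crs b c + dot b v *s crs c a + dot c v *s crs a b"
    by (simp add: vec3_eq_iff det3_alt dot_3 algebra_simps)
  then show ?thesis using assms by simp
qed

lemma det3_pencil:
  assumes "crs h i \<noteq> 0" "det3 h i x = 0" "det3 h i y = 0" "det3 h i z = 0"
  shows "det3 x y z = 0"
proof -
  have "dot w (crs h i) = 0" if "det3 h i w = 0" for w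
    using that det3_perm(5)[where a=h and b=i and c=w] by (simp add: det3_def)
  then show ?thesis using assms by (intro det3_zero_of_common[of "crs h i"])
qed

text \<open>Formulated for arbitrary index sets, so that single lines can be removed and restored
  without renumbering.\<close>

definition same_pattern :: "nat set \<Rightarrow> (nat \<Rightarrow> complex^3) \<Rightarrow> (nat \<Rightarrow> complex^3) \<Rightarrow> bool" where
  "same_pattern S a b \<longleftrightarrow>
     (\<forall>i\<in>S. a i \<noteq> 0 \<and> b i \<noteq> 0) \<and>
     (\<forall>i\<in>S. \<forall>j\<in>S. i \<noteq> j \<longrightarrow> crs (a i) (a j) \<noteq> 0 \<and> crs (b i) (b j) \<noteq> 0) \<and>
     (\<forall>i\<in>S. \<forall>j\<in>S. \<forall>k\<in>S. det3 (a i) (a j) (a k) = 0 \<longleftrightarrow> det3 (b i) (b j) (b k) = 0)"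

definition deformable :: "nat set \<Rightarrow> (nat \<Rightarrow> complex^3) \<Rightarrow> (nat \<Rightarrow> complex^3) \<Rightarrow> bool" where
  "deformable S a b \<longleftrightarrow> (\<exists>\<gamma>.
     (\<forall>i\<in>S. polycurve (\<gamma> i) \<and> (\<exists>c. c \<noteq> 0 \<and> \<gamma> i 0 = c *s a i) \<and> (\<exists>c. c \<noteq> 0 \<and> \<gamma> i 1 = c *s b i)) \<and>
     (\<forall>i\<in>S. \<forall>j\<in>S. \<forall>k\<in>S. det3 (a i) (a j) (a k) = 0 \<longrightarrow> (\<forall>t. det3 (\<gamma> i t) (\<gamma> j t) (\<gamma> k t) = 0)))"

lemma deformable_empty: "deformable {} a b"
  by (simp add: deformable_def)

lemma deformable_insertI:
  assumes "h \<notin> S"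
    and \<gamma>: "\<forall>i\<in>S. polycurve (\<gamma> i) \<and> (\<exists>c. c \<noteq> 0 \<and> \<gamma> i 0 = c *s a i) \<and> (\<exists>c. c \<noteq> 0 \<and> \<gamma> i 1 = c *s b i)"
      "\<forall>i\<in>S. \<forall>j\<in>S. \<forall>k\<in>S. det3 (a i) (a j) (a k) = 0 \<longrightarrow> (\<forall>t. det3 (\<gamma> i t) (\<gamma> j t) (\<gamma> k t) = 0)"
    and g: "polycurve g" "\<exists>c. c \<noteq> 0 \<and> g 0 = c *s a h" "\<exists>c. c \<noteq> 0 \<and> g 1 = c *s b h"
    and gT: "\<And>j k t. j \<in> S \<Longrightarrow> k \<in> S \<Longrightarrow> j \<noteq> k \<Longrightarrow> det3 (a h) (a j) (a k) = 0 \<Longrightarrow> det3 (g t) (\<gamma> j t) (\<gamma> k t) = 0"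
  shows "deformable (insert h S) a b"
  unfolding deformable_def
proof (intro exI[of _ "\<gamma>(h := g)"] conjI ballI impI allI)
  fix i assume i: "i \<in> insert h S"
  show "polycurve ((\<gamma>(h := g)) i)" "\<exists>c. c \<noteq> 0 \<and> (\<gamma>(h := g)) i 0 = c *s a i" "\<exists>c. c \<noteq> 0 \<and> (\<gamma>(h := g)) i 1 = c *s b i"
    using i \<gamma>(1) g assms(1) by auto
next
  have gT': "det3 (g t) (\<gamma> j t) (\<gamma> k t) = 0" if "j \<in> S" "k \<in> S" "det3 (a h) (a j) (a k) = 0" for j k t
    using gT[OF that(1,2) _ that(3)] by (cases "j = k") auto
  fix i j k t assume ijk: "i \<in> insert h S" "j \<in> insert h S" "k \<in> insert h S" and T: "det3 (a i) (a j) (a k) = 0"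
  have T1: "det3 (a j) (a i) (a k) = 0" "det3 (a k) (a i) (a j) = 0"
    using T det3_perm(1)[where a="a i" and b="a j" and c="a k"] det3_perm(5)[where a="a i" and b="a j" and c="a k"] by auto
  consider "i \<noteq> h" "j \<noteq> h" "k \<noteq> h" | "i = h" "j \<noteq> h" "k \<noteq> h" | "i \<noteq> h" "j = h" "k \<noteq> h"
    | "i \<noteq> h" "j \<noteq> h" "k = h" | "i = j" | "i = k" | "j = k" by blast
  then show "det3 ((\<gamma>(h := g)) i t) ((\<gamma>(h := g)) j t) ((\<gamma>(h := g)) k t) = 0"
  proof cases
    case 1 then show ?thesis using \<gamma>(2) ijk T by auto
  next
    case 2 then show ?thesis using gT' ijk T by auto
  next
    case 3
    then have "det3 (g t) (\<gamma> i t) (\<gamma> k t) = 0" using gT' ijk T1(1) by auto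
    then show ?thesis using 3 det3_perm(1)[where a="\<gamma> i t" and b="g t" and c="\<gamma> k t"] by simp
  next
    case 4
    then have "det3 (g t) (\<gamma> i t) (\<gamma> j t) = 0" using gT' ijk T1(2) by auto
    then show ?thesis using 4 det3_perm(5)[where a="\<gamma> i t" and b="\<gamma> j t" and c="g t"] by simp
  qed auto
qed

text \<open>No concurrence constrains \<open>h\<close>, so the straight segment between its two
  coefficient vectors will do; accidental coincidences along it are tolerated.\<close>

lemma deformable_insert_generic:
  assumes "h \<notin> S" "deformable S a b" "\<And>x y. x \<in> S \<Longrightarrow> y \<in> S \<Longrightarrow> x \<noteq> y \<Longrightarrow> det3 (a h) (a x) (a y) \<noteq> 0"
  shows "deformable (insert h S) a b"
proof -
  obtain \<gamma> where \<gamma>: "\<forall>i\<in>S. polycurve (\<gamma> i) \<and> (\<exists>c. c \<noteq> 0 \<and> \<gamma> i 0 = c *s a i) \<and> (\<exists>c. c \<noteq> 0 \<and> \<gamma> i 1 = c *s b i)"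
      "\<forall>i\<in>S. \<forall>j\<in>S. \<forall>k\<in>S. det3 (a i) (a j) (a k) = 0 \<longrightarrow> (\<forall>t. det3 (\<gamma> i t) (\<gamma> j t) (\<gamma> k t) = 0)"
    using assms(2) unfolding deformable_def by blast
  show ?thesis
  proof (rule deformable_insertI[OF assms(1) \<gamma>])
    show "polycurve (\<lambda>t. (1 - t) *s a h + t *s b h)"
      by (intro polycurve_add polycurve_scale polycurve_const polyfun_intros)
  qed (use assms(3) in \<open>auto intro: exI[of _ 1]\<close>)
qed

text \<open>By \<open>only\<close>, the point of \<open>i\<close> and \<open>j\<close> is the only
  multiple point on \<open>h\<close>. At both ends \<open>h\<close> is a combination of
  \<open>i\<close> and \<open>j\<close>; interpolating the two coefficients keeps it in the moving
  pencil.\<close>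

lemma deformable_insert_pencil:
  assumes h: "h \<notin> S" and def: "deformable S a b" and pat: "same_pattern (insert h S) a b"
    and ij: "i \<in> S" "j \<in> S" "i \<noteq> j" "det3 (a h) (a i) (a j) = 0"
    and only: "\<And>x y. x \<in> S \<Longrightarrow> y \<in> S \<Longrightarrow> x \<noteq> y \<Longrightarrow> det3 (a h) (a x) (a y) = 0 \<Longrightarrow> det3 (a h) (a i) (a x) = 0"
  shows "deformable (insert h S) a b"
proof -
  obtain \<gamma> where \<gamma>: "\<forall>i\<in>S. polycurve (\<gamma> i) \<and> (\<exists>c. c \<noteq> 0 \<and> \<gamma> i 0 = c *s a i) \<and> (\<exists>c. c \<noteq> 0 \<and> \<gamma> i 1 = c *s b i)"
      "\<forall>i\<in>S. \<forall>j\<in>S. \<forall>k\<in>S. det3 (a i) (a j) (a k) = 0 \<longrightarrow> (\<forall>t. det3 (\<gamma> i t) (\<gamma> j t) (\<gamma> k t) = 0)"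
    using def unfolding deformable_def by blast
  have coeffs: "\<exists>x y. u h = x *s \<gamma> i t + y *s \<gamma> j t"
    if u: "crs (u i) (u j) \<noteq> 0" "det3 (u h) (u i) (u j) = 0" "\<exists>c. c \<noteq> 0 \<and> \<gamma> i t = c *s u i" "\<exists>c. c \<noteq> 0 \<and> \<gamma> j t = c *s u j"
    for u t
  proof -
    have "det3 (u i) (u j) (u h) = 0" using u(2) det3_perm(4)[where a="u h" and b="u i" and c="u j"] by simp
    then obtain x y where xy: "u h = x *s u i + y *s u j" using det3_eq_0_iff[OF u(1)] by blast
    obtain c d where "c \<noteq> 0" "\<gamma> i t = c *s u i" "d \<noteq> 0" "\<gamma> j t = d *s u j" using u(3,4) by blast
    then have "u h = (x / c) *s \<gamma> i t + (y / d) *s \<gamma> j t" by (simp add: xy)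
    then show ?thesis by blast
  qed
  have cij: "crs (a i) (a j) \<noteq> 0" "crs (b i) (b j) \<noteq> 0" "det3 (b h) (b i) (b j) = 0" "crs (a h) (a i) \<noteq> 0"
    using pat ij h unfolding same_pattern_def by auto
  obtain x0 y0 where 0: "a h = x0 *s \<gamma> i 0 + y0 *s \<gamma> j 0" using coeffs[of a 0] cij ij \<gamma>(1) by blast
  obtain x1 y1 where 1: "b h = x1 *s \<gamma> i 1 + y1 *s \<gamma> j 1" using coeffs[of b 1] cij ij \<gamma>(1) by blast
  define g where "g t = ((1 - t) * x0 + t * x1) *s \<gamma> i t + ((1 - t) * y0 + t * y1) *s \<gamma> j t" for t
  show ?thesis
  proof (rule deformable_insertI[OF h \<gamma>])
    show "polycurve g" unfolding g_def using \<gamma>(1) ij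
      by (intro polycurve_add polycurve_scale polycurve_const polyfun_intros) auto
    have "g 0 = a h" "g 1 = b h" by (simp_all add: g_def 0 1)
    then show "\<exists>c. c \<noteq> 0 \<and> g 0 = c *s a h" "\<exists>c. c \<noteq> 0 \<and> g 1 = c *s b h" by (auto intro: exI[of _ 1])
    fix x y t assume xy: "x \<in> S" "y \<in> S" "x \<noteq> y" "det3 (a h) (a x) (a y) = 0"
    have hx: "det3 (a h) (a i) (a x) = 0" using only xy by blast
    have "crs (a h) (a x) \<noteq> 0" using pat xy h unfolding same_pattern_def by auto
    then have hy: "det3 (a h) (a i) (a y) = 0" using det3_trans hx xy(4) by blast
    \<comment> \<open>\<open>x\<close> and \<open>y\<close> belong to the pencil of \<open>i\<close>
      and \<open>j\<close>, so the given curves already preserve these two concurrences; the one for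
      \<open>g\<close> follows by linearity.\<close>
    have "det3 (a i) (a x) (a y) = 0" "det3 (a j) (a x) (a y) = 0"
      using det3_pencil[OF cij(4) _ hx hy] ij(4) by auto
    then have "det3 (\<gamma> i t) (\<gamma> x t) (\<gamma> y t) = 0" "det3 (\<gamma> j t) (\<gamma> x t) (\<gamma> y t) = 0"
      using \<gamma>(2) xy ij by auto
    then show "det3 (g t) (\<gamma> x t) (\<gamma> y t) = 0" by (simp add: g_def det3_def dot_linear)
  qed
qed

lemma crs_crs_parallel:
  assumes "dot h p = 0" "dot h q = 0" "crs p q \<noteq> 0" "h \<noteq> 0"
  shows "\<exists>c. c \<noteq> 0 \<and> crs p q = c *s h"
proof -
  have "dot p h = 0" "dot q h = 0" using assms by (simp_all add: dot_3 mult.commute)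
  then obtain c where "h = c *s crs p q" using crs_neq_0_lin[OF assms(3)] by blast
  moreover from this have "c \<noteq> 0" using assms(4) by auto
  ultimately show ?thesis by (intro exI[of _ "inverse c"]) simp
qed

text \<open>\<open>h\<close> joins the points \<open>i j\<close> and \<open>k l\<close>, and
  \<open>g\<close> computes this join by cross products. Where one of the two points becomes
  undefined, \<open>g\<close> vanishes and the required determinants are zero anyway.\<close>

lemma deformable_insert_two_points:
  assumes h: "h \<notin> S" and def: "deformable S a b" and pat: "same_pattern (insert h S) a b"
    and ij: "i \<in> S" "j \<in> S" "i \<noteq> j" "det3 (a h) (a i) (a j) = 0"
    and kl: "k \<in> S" "l \<in> S" "k \<noteq> l" "det3 (a h) (a k) (a l) = 0"
    and ik: "det3 (a h) (a i) (a k) \<noteq> 0"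
    and only: "\<And>x y. x \<in> S \<Longrightarrow> y \<in> S \<Longrightarrow> x \<noteq> y \<Longrightarrow> det3 (a h) (a x) (a y) = 0 \<Longrightarrow>
       det3 (a h) (a i) (a x) = 0 \<or> det3 (a h) (a k) (a x) = 0"
  shows "deformable (insert h S) a b"
proof -
  obtain \<gamma> where \<gamma>: "\<forall>i\<in>S. polycurve (\<gamma> i) \<and> (\<exists>c. c \<noteq> 0 \<and> \<gamma> i 0 = c *s a i) \<and> (\<exists>c. c \<noteq> 0 \<and> \<gamma> i 1 = c *s b i)"
      "\<forall>i\<in>S. \<forall>j\<in>S. \<forall>k\<in>S. det3 (a i) (a j) (a k) = 0 \<longrightarrow> (\<forall>t. det3 (\<gamma> i t) (\<gamma> j t) (\<gamma> k t) = 0)"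
    using def unfolding deformable_def by blast
  define g where "g t = crs (crs (\<gamma> i t) (\<gamma> j t)) (crs (\<gamma> k t) (\<gamma> l t))" for t
  have ends: "\<exists>c. c \<noteq> 0 \<and> g t = c *s u h"
    if u: "u h \<noteq> 0" "crs (u i) (u j) \<noteq> 0" "crs (u k) (u l) \<noteq> 0" "det3 (u h) (u i) (u j) = 0" "det3 (u h) (u k) (u l) = 0"
      "det3 (u h) (u i) (u k) \<noteq> 0" and \<gamma>u: "\<forall>m\<in>S. \<exists>c. c \<noteq> 0 \<and> \<gamma> m t = c *s u m" for u t
  proof -
    let ?p = "crs (u i) (u j)" and ?q = "crs (u k) (u l)"
    \<comment> \<open>If the two points agreed, \<open>k\<close> would pass through the point of
      \<open>h\<close> and \<open>i\<close>, which \<open>ik\<close> and its analogue for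
      \<open>b\<close> exclude.\<close>
    have pq: "crs ?p ?q \<noteq> 0"
    proof
      assume "crs ?p ?q = 0"
      then obtain c where "?q = c *s ?p" "c \<noteq> 0" using crs_eq_0_iff[OF u(2,3)] by blast
      then have "dot (u k) ?p = 0" using dot_crs_self(1)[of "u k" "u l"] by (simp add: dot_linear)
      then have "det3 (u h) (u i) (u k) = 0"
        using det3_zero_of_common[OF u(2)] u(4) by (simp add: det3_def)
      then show False using u(6) by simp
    qed
    have "dot (u h) ?p = 0" "dot (u h) ?q = 0" using u(4,5) by (simp_all add: det3_def)
    then obtain c where c: "c \<noteq> 0" "crs ?p ?q = c *s u h" using crs_crs_parallel pq u(1) by blast
    obtain ci cj ck cl where "ci \<noteq> 0" "\<gamma> i t = ci *s u i" "cj \<noteq> 0" "\<gamma> j t = cj *s u j"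
      "ck \<noteq> 0" "\<gamma> k t = ck *s u k" "cl \<noteq> 0" "\<gamma> l t = cl *s u l" using \<gamma>u ij kl by meson
    then have "g t = (ci * cj * (ck * cl) * c) *s u h" "ci * cj * (ck * cl) * c \<noteq> 0"
      using c by (simp_all add: g_def crs_scale)
    then show ?thesis by blast
  qed
  have ah: "a h \<noteq> 0" "crs (a i) (a j) \<noteq> 0" "crs (a k) (a l) \<noteq> 0" "crs (a h) (a i) \<noteq> 0" "crs (a h) (a k) \<noteq> 0"
    and bh: "b h \<noteq> 0" "crs (b i) (b j) \<noteq> 0" "crs (b k) (b l) \<noteq> 0" "det3 (b h) (b i) (b j) = 0"
      "det3 (b h) (b k) (b l) = 0" "det3 (b h) (b i) (b k) \<noteq> 0"
    using pat ij kl ik h unfolding same_pattern_def by auto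
  have concurrent: "det3 (g t) (\<gamma> x t) (\<gamma> y t) = 0"
    if xy: "x \<in> S" "y \<in> S" "x \<noteq> y" "det3 (a h) (a x) (a y) = 0"
      and r: "r \<in> S" "s \<in> S" "det3 (a h) (a r) (a s) = 0" "det3 (a h) (a r) (a x) = 0" "crs (a h) (a r) \<noteq> 0"
      and gp: "dot (g t) (crs (\<gamma> r t) (\<gamma> s t)) = 0" "crs (\<gamma> r t) (\<gamma> s t) = 0 \<Longrightarrow> g t = 0"
    for x y r s t
  proof -
    have "crs (a h) (a x) \<noteq> 0" using pat xy h unfolding same_pattern_def by auto
    then have hy: "det3 (a h) (a r) (a y) = 0" using det3_trans r(4) xy(4) by blast
    have hr: "det3 (a h) (a r) (a r) = 0" by simp
    have "det3 (a x) (a r) (a s) = 0" "det3 (a y) (a r) (a s) = 0"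
      by (rule det3_pencil[OF r(5) r(4) hr r(3)], rule det3_pencil[OF r(5) hy hr r(3)])
    then have "dot (\<gamma> x t) (crs (\<gamma> r t) (\<gamma> s t)) = 0" "dot (\<gamma> y t) (crs (\<gamma> r t) (\<gamma> s t)) = 0"
      using \<gamma>(2) xy r by (auto simp: det3_def)
    then show ?thesis using gp det3_zero_of_common[of "crs (\<gamma> r t) (\<gamma> s t)"]
      by (cases "crs (\<gamma> r t) (\<gamma> s t) = 0") (auto simp: det3_def dot_linear)
  qed
  show ?thesis
  proof (rule deformable_insertI[OF h \<gamma>])
    show "polycurve g" unfolding g_def using \<gamma>(1) ij kl by (intro polycurve_crs) auto
    show "\<exists>c. c \<noteq> 0 \<and> g 0 = c *s a h" using ah ij kl ik \<gamma>(1) by (intro ends) auto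
    show "\<exists>c. c \<noteq> 0 \<and> g 1 = c *s b h" using bh \<gamma>(1) by (intro ends) auto
    fix x y t assume xy: "x \<in> S" "y \<in> S" "x \<noteq> y" "det3 (a h) (a x) (a y) = 0"
    have sym: "dot u v = dot v u" for u v by (simp add: dot_3 mult.commute)
    have g0: "dot (g t) (crs (\<gamma> i t) (\<gamma> j t)) = 0" "dot (g t) (crs (\<gamma> k t) (\<gamma> l t)) = 0"
      unfolding g_def by (subst sym, simp)+
    have gz: "crs (\<gamma> i t) (\<gamma> j t) = 0 \<Longrightarrow> g t = 0" "crs (\<gamma> k t) (\<gamma> l t) = 0 \<Longrightarrow> g t = 0"
      unfolding g_def by (simp_all add: vec3_eq_iff)
    show "det3 (g t) (\<gamma> x t) (\<gamma> y t) = 0"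
      using only[OF xy] concurrent[OF xy ij(1,2,4) _ ah(4) g0(1) gz(1)] concurrent[OF xy kl(1,2,4) _ ah(5) g0(2) gz(2)]
      by blast
  qed
qed

section \<open>Combinatorics of concurrency patterns\<close>

text \<open>\<open>T i j k\<close> stands for concurrency of three lines and holds when two of the indices agree,
  so that for fixed \<open>h\<close> the relation \<open>T h\<close> is an equivalence whose classes on the other lines
  are the intersection points on \<open>h\<close>.\<close>

locale concurrency =
  fixes S :: "'a set" and T :: "'a \<Rightarrow> 'a \<Rightarrow> 'a \<Rightarrow> bool"
  assumes swap12: "T i j k \<Longrightarrow> T j i k"
    and swap23: "T i j k \<Longrightarrow> T i k j"
    and degenerate: "T i i k"
    and trans: "h \<in> S \<Longrightarrow> k \<in> S \<Longrightarrow> h \<noteq> k \<Longrightarrow> T h j k \<Longrightarrow> T h k l \<Longrightarrow> T h j l"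
begin


lemma sym_iff: "T x y z \<longleftrightarrow> T y x z" "T x y z \<longleftrightarrow> T x z y"
  using swap12 swap23 by blast+

lemma degenerate' [simp]: "T i j j" "T i j i" "T i i j"
  by (fact swap12[OF swap23[OF degenerate]] swap23[OF degenerate] degenerate)+

lemma same_point:
  assumes "h \<in> S" "u \<in> S" "v \<in> S" "h \<noteq> u" "h \<noteq> v" "T h u v"
  shows "T h v w \<longleftrightarrow> T h u w" "T h w v \<longleftrightarrow> T h w u"
proof -
  have "T h v u" using assms swap23 by blast
  then show *: "T h v w \<longleftrightarrow> T h u w" using assms trans by blast
  show "T h w v \<longleftrightarrow> T h w u" using * swap23 by blast
qed

definition three_points :: "'a \<Rightarrow> 'a \<Rightarrow> 'a \<Rightarrow> 'a \<Rightarrow> 'a \<Rightarrow> 'a \<Rightarrow> 'a \<Rightarrow> bool" where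
  "three_points h i j k l m q \<longleftrightarrow> {i,j,k,l,m,q} \<subseteq> S \<and> distinct [h,i,j,k,l,m,q] \<and>
     T h i j \<and> T h k l \<and> T h m q \<and> \<not> T h i k \<and> \<not> T h i m \<and> \<not> T h k m"

text \<open>The case left open by the three insertion lemmas: \<open>h\<close> carries at least
  three points of multiplicity at least 3.\<close>

definition heavy :: "'a \<Rightarrow> bool" where
  "heavy h \<longleftrightarrow> (\<exists>i j k l m q. three_points h i j k l m q)"

text \<open>Lines from different pairs are distinct automatically, because they meet
  \<open>h\<close> in different points.\<close>

lemma heavyI:
  assumes h: "h \<in> S" and S: "i \<in> S" "j \<in> S" "k \<in> S" "l \<in> S" "m \<in> S" "q \<in> S"
    and ne: "i \<noteq> h" "j \<noteq> h" "k \<noteq> h" "l \<noteq> h" "m \<noteq> h" "q \<noteq> h" "i \<noteq> j" "k \<noteq> l" "m \<noteq> q"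
    and T: "T h i j" "T h k l" "T h m q" "\<not> T h i k" "\<not> T h i m" "\<not> T h k m"
  shows "heavy h"
proof -
  have j: "T h j w \<longleftrightarrow> T h i w" "T h w j \<longleftrightarrow> T h w i" for w by (rule same_point; use assms in simp)+
  have l: "T h l w \<longleftrightarrow> T h k w" "T h w l \<longleftrightarrow> T h w k" for w by (rule same_point; use assms in simp)+
  have q: "T h q w \<longleftrightarrow> T h m w" "T h w q \<longleftrightarrow> T h w m" for w by (rule same_point; use assms in simp)+
  have n: "\<not> T h k i" "\<not> T h m i" "\<not> T h m k" using T by (simp_all add: sym_iff)
  have d: "i \<noteq> k" "i \<noteq> m" "k \<noteq> m" "j \<noteq> k" "j \<noteq> m" "l \<noteq> m" "i \<noteq> l" "i \<noteq> q" "k \<noteq> q" "j \<noteq> l" "j \<noteq> q" "l \<noteq> q"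
    using T(4-6) n j[of k] j[of m] j[of l] j[of q] l[of i] l[of m] l[of q] q[of i] q[of k] by auto
  have "three_points h i j k l m q" unfolding three_points_def using S T d ne by simp
  then show ?thesis unfolding heavy_def by blast
qed

text \<open>Each line is replaced by the representative \<open>i\<close>, \<open>k\<close> or
  \<open>m\<close> of its point on \<open>h\<close>; together these equivalences decide every
  concurrence on \<open>h\<close> among the seven named lines.\<close>

lemma three_points_rewrites:
  assumes h: "h \<in> S" and tp: "three_points h i j k l m q"
  shows "T h j w \<longleftrightarrow> T h i w" "T h w j \<longleftrightarrow> T h w i" "T h l w \<longleftrightarrow> T h k w" "T h w l \<longleftrightarrow> T h w k"
    "T h q w \<longleftrightarrow> T h m w" "T h w q \<longleftrightarrow> T h w m"
    "\<not> T h i k" "\<not> T h i m" "\<not> T h k m" "\<not> T h k i" "\<not> T h m i" "\<not> T h m k"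
proof -
  note tp' = tp[unfolded three_points_def]
  show "T h j w \<longleftrightarrow> T h i w" "T h w j \<longleftrightarrow> T h w i" by (rule same_point; use h tp' in auto)+
  show "T h l w \<longleftrightarrow> T h k w" "T h w l \<longleftrightarrow> T h w k" by (rule same_point; use h tp' in auto)+
  show "T h q w \<longleftrightarrow> T h m w" "T h w q \<longleftrightarrow> T h w m" by (rule same_point; use h tp' in auto)+
  show "\<not> T h i k" "\<not> T h i m" "\<not> T h k m" "\<not> T h k i" "\<not> T h m i" "\<not> T h m k"
    using tp' by (simp_all add: sym_iff)
qed

lemma heavy_card:
  assumes "finite S" "h \<in> S" "heavy h"
  shows "7 \<le> card S"
proof -
  obtain i j k l m q where tp: "three_points h i j k l m q" using assms heavy_def by blast
  then have "card {h,i,j,k,l,m,q} = 7" "{h,i,j,k,l,m,q} \<subseteq> S" using assms unfolding three_points_def by auto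
  then show ?thesis using card_mono[OF assms(1)] by metis
qed

section \<open>Seven heavy lines: the Fano plane\<close>

lemma fano_pairs:
  assumes S: "card S = 7" and h: "h \<in> S" "heavy h"
  shows "\<exists>i j k l m q. three_points h i j k l m q \<and> S = {h,i,j,k,l,m,q}"
proof -
  obtain i j k l m q where tp: "three_points h i j k l m q" using h heavy_def by blast
  then have "card {h,i,j,k,l,m,q} = 7" "{h,i,j,k,l,m,q} \<subseteq> S" using h unfolding three_points_def by auto
  then have "S = {h,i,j,k,l,m,q}" using S by (intro card_subset_eq[symmetric]) (auto intro: card_ge_0_finite)
  then show ?thesis using tp by blast
qed

text \<open>The three pairs on \<open>h\<close> use up all six other lines, so every point on
  \<open>h\<close> carries exactly two of them. When all lines are heavy this is a Steiner triple
  system.\<close>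

lemma fano_partner:
  assumes S: "card S = 7" and h: "h \<in> S" "heavy h" and x: "x \<in> S" "x \<noteq> h"
  shows "\<exists>y\<in>S. y \<noteq> h \<and> y \<noteq> x \<and> T h x y"
    "\<lbrakk>y \<in> S; z \<in> S; y \<noteq> h; y \<noteq> x; z \<noteq> h; z \<noteq> x; T h x y; T h x z\<rbrakk> \<Longrightarrow> y = z"
proof -
  obtain i j k l m q where tp: "three_points h i j k l m q" and Seq: "S = {h,i,j,k,l,m,q}"
    using fano_pairs[OF S h] by blast
  note r = three_points_rewrites[OF h(1) tp]
  have d: "distinct [h,i,j,k,l,m,q]" using tp by (simp add: three_points_def)
  have xs: "x \<in> {i,j,k,l,m,q}" using x Seq by auto
  show "\<exists>y\<in>S. y \<noteq> h \<and> y \<noteq> x \<and> T h x y"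
    using xs d unfolding Seq by (auto simp: r)
  show "y = z" if "y \<in> S" "z \<in> S" "y \<noteq> h" "y \<noteq> x" "z \<noteq> h" "z \<noteq> x" "T h x y" "T h x z"
    using that xs d unfolding Seq by (auto simp: r)
qed

text \<open>Uniqueness of the Steiner triple system on seven elements. The third line through the
  point of \<open>i\<close> and \<open>k\<close> is \<open>m\<close> or \<open>q\<close>,
  interchangeable by symmetry; the remaining triples are then forced.\<close>

lemma fano_structure:
  assumes S: "card S = 7" and hv: "\<And>h. h \<in> S \<Longrightarrow> heavy h"
  shows "\<exists>h i j k l m q. {h,i,j,k,l,m,q} \<subseteq> S \<and> distinct [h,i,j,k,l,m,q] \<and> \<not> T h i k \<and>
    T h i j \<and> T h k l \<and> T h m q \<and> T i k m \<and> T i l q \<and> T j k q \<and> T j l m"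
proof -
  have "S \<noteq> {}" using S by auto
  then obtain h where h: "h \<in> S" by blast
  obtain i j k l m q where tp: "three_points h i j k l m q" and Seq: "S = {h,i,j,k,l,m,q}"
    using fano_pairs[OF S h hv[OF h]] by blast
  have core: "\<exists>h i j k l m q. {h,i,j,k,l,m,q} \<subseteq> S \<and> distinct [h,i,j,k,l,m,q] \<and> \<not> T h i k \<and>
    T h i j \<and> T h k l \<and> T h m q \<and> T i k m \<and> T i l q \<and> T j k q \<and> T j l m"
    if Seq: "S = {h,i,j,k,l,m,q}" and d: "distinct [h,i,j,k,l,m,q]" and T: "T h i j" "T h k l" "T h m q" "\<not> T h i k"
      and ikm: "T i k m" for h i j k l m q
  proof -
    have U: "z = w" if "T x y z" "T x y w" "{x,y,z,w} \<subseteq> S" "distinct [x,y,z]" "distinct [x,y,w]" for x y z w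
      using fano_partner(2)[OF S _ hv, of x y z w] that by auto
    have P: "\<exists>z\<in>S. z \<noteq> x \<and> z \<noteq> y \<and> T x y z" if "x \<in> S" "y \<in> S" "x \<noteq> y" for x y
      using fano_partner(1)[OF S that(1) hv[OF that(1)] that(2)] that(3) by auto
    \<comment> \<open>The third line through a point is found by exclusion: any other candidate
      would make \<open>U\<close> identify two distinct lines.\<close>
    have 1: "T i l q"
    proof -
      obtain z where z: "z \<in> S" "z \<noteq> i" "z \<noteq> l" "T i l z" using P[of i l] d Seq by auto
      have "z \<noteq> h" using U[of h l i k] z(4) T d Seq by (auto simp: sym_iff)
      moreover have "z \<noteq> j" using U[of i j h l] z(4) T d Seq by (auto simp: sym_iff)
      moreover have "z \<noteq> k" using U[of k l h i] z(4) T d Seq by (auto simp: sym_iff)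
      moreover have "z \<noteq> m" using U[of i m k l] z(4) ikm d Seq by (auto simp: sym_iff)
      ultimately have "z = q" using z Seq by auto
      then show ?thesis using z by simp
    qed
    have 2: "T j k q"
    proof -
      obtain z where z: "z \<in> S" "z \<noteq> j" "z \<noteq> k" "T j k z" using P[of j k] d Seq by auto
      have "z \<noteq> h" using U[of h k j l] z(4) T d Seq by (auto simp: sym_iff)
      moreover have "z \<noteq> i" using U[of i j h k] z(4) T d Seq by (auto simp: sym_iff)
      moreover have "z \<noteq> l" using U[of k l h j] z(4) T d Seq by (auto simp: sym_iff)
      moreover have "z \<noteq> m" using U[of k m i j] z(4) ikm d Seq by (auto simp: sym_iff)
      ultimately have "z = q" using z Seq by auto
      then show ?thesis using z by simp
    qed
    have 3: "T j l m"
    proof -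
      obtain z where z: "z \<in> S" "z \<noteq> j" "z \<noteq> l" "T j l z" using P[of j l] d Seq by auto
      have "z \<noteq> h" using U[of h l j k] z(4) T d Seq by (auto simp: sym_iff)
      moreover have "z \<noteq> i" using U[of i j h l] z(4) T d Seq by (auto simp: sym_iff)
      moreover have "z \<noteq> k" using U[of k l h j] z(4) T d Seq by (auto simp: sym_iff)
      moreover have "z \<noteq> q" using U[of l q i j] z(4) 1 d Seq by (auto simp: sym_iff)
      ultimately have "z = m" using z Seq by auto
      then show ?thesis using z by simp
    qed
    have "{h,i,j,k,l,m,q} \<subseteq> S" unfolding Seq by (rule order_refl)
    then show ?thesis using d T ikm 1 2 3 by blast
  qed
  note tp' = tp[unfolded three_points_def]
  have d: "distinct [h,i,j,k,l,m,q]" using tp' by (elim conjE)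
  have i: "i \<in> S" "k \<in> S" "k \<noteq> i" using d unfolding Seq by auto
  obtain z where z: "z \<in> S" "z \<noteq> i" "z \<noteq> k" "T i k z" using fano_partner(1)[OF S i(1) hv[OF i(1)] i(2,3)] by blast
  have U: "z = w" if "T x y z" "T x y w" "{x,y,z,w} \<subseteq> S" "distinct [x,y,z]" "distinct [x,y,w]" for x y z w
    using fano_partner(2)[OF S _ hv, of x y z w] that by auto
  have "z \<noteq> h" using tp' z(4) by (auto simp: sym_iff)
  moreover have "z \<noteq> j" using U[of i j h k] z(4) tp' d Seq by (auto simp: sym_iff)
  moreover have "z \<noteq> l" using U[of k l h i] z(4) tp' d Seq by (auto simp: sym_iff)
  ultimately consider "z = m" | "z = q" using z Seq by auto
  then show ?thesis
  proof cases
    case 1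
    then show ?thesis using core[OF Seq d] tp' z(4) by blast
  next
    case 2
    have "S = {h,i,j,k,l,q,m}" "distinct [h,i,j,k,l,q,m]" "T h q m" using Seq d tp' by (auto simp: sym_iff)
    then show ?thesis using core[of h i j k l q m] tp' z(4) 2 by blast
  qed
qed

section \<open>Eight heavy lines: the configuration 8_3\<close>

lemma three_points_swap:
  assumes "h \<in> S" "three_points h i j k l m q"
  shows "three_points h k l i j m q" "three_points h m q k l i j"
  using assms unfolding three_points_def by (auto simp: sym_iff)

text \<open>One line \<open>p\<close> is left over by \<open>h\<close> and its pairs, and it passes
  through at most one of the three points. Relabelling makes this the point of \<open>i\<close> and
  \<open>j\<close>.\<close>

lemma eight_pairs:
  assumes S: "card S = 8" and h: "h \<in> S" "heavy h"
  shows "\<exists>i j k l m q p. three_points h i j k l m q \<and> S = {h,i,j,k,l,m,q,p} \<and> p \<notin> {h,i,j,k,l,m,q} \<and> \<not> T h k p \<and> \<not> T h m p"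
proof -
  obtain i j k l m q where tp: "three_points h i j k l m q" using h heavy_def by blast
  let ?H = "{h,i,j,k,l,m,q}"
  have H: "card ?H = 7" "?H \<subseteq> S" using tp h unfolding three_points_def by auto
  have fin: "finite S" using S by (auto intro: card_ge_0_finite)
  then have "card (S - ?H) = 1" using card_Diff_subset[of ?H S] H S by simp
  then obtain p where "S - ?H = {p}" by (auto simp: card_1_singleton_iff)
  then have p: "S = {h,i,j,k,l,m,q,p}" "p \<notin> ?H" using H(2) by auto
  note r = three_points_rewrites[OF h(1) tp]
  have pS: "p \<in> S" "p \<noteq> h" using p by auto
  have iS: "i \<in> S" "k \<in> S" "m \<in> S" "i \<noteq> h" "k \<noteq> h" "m \<noteq> h" using tp h unfolding three_points_def by auto
  consider "T h k p" | "T h m p" | "\<not> T h k p" "\<not> T h m p" by blast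
  then show ?thesis
  proof cases
    case 1
    then have "T h w p \<longleftrightarrow> T h w k" for w by (intro same_point) (use pS iS h in auto)
    then have "\<not> T h i p" "\<not> T h m p" using r by auto
    moreover have "S = {h,k,l,i,j,m,q,p}" "p \<notin> {h,k,l,i,j,m,q}" using p by auto
    ultimately show ?thesis using three_points_swap(1)[OF h(1) tp] by blast
  next
    case 2
    then have "T h w p \<longleftrightarrow> T h w m" for w by (intro same_point) (use pS iS h in auto)
    then have "\<not> T h i p" "\<not> T h k p" using r by auto
    moreover have "S = {h,m,q,k,l,i,j,p}" "p \<notin> {h,m,q,k,l,i,j}" using p by auto
    ultimately show ?thesis using three_points_swap(2)[OF h(1) tp] by blast
  next
    case 3
    then show ?thesis using tp p by blast
  qed
qed

text \<open>A point of \<open>h\<close> on three further lines must be the one that absorbs the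
  leftover line. The other four lines then form two pairs, which gives \<open>w\<close> a partner
  away from the quadruple point.\<close>

lemma quadruple_class:
  assumes S: "card S = 8" and h: "h \<in> S" "heavy h"
    and xyz: "x \<in> S" "y \<in> S" "z \<in> S" "distinct [h,x,y,z]" "T h x y" "T h x z"
    and w: "w \<in> S" "w \<notin> {h,x,y,z}"
  shows "\<not> T h x w \<and> \<not> T h y w \<and> \<not> T h z w \<and> (\<exists>v\<in>S - {h,x,y,z,w}. T h w v)"
proof -
  obtain i j k l m q p where tp: "three_points h i j k l m q" and Seq: "S = {h,i,j,k,l,m,q,p}"
    and p: "p \<notin> {h,i,j,k,l,m,q}" "\<not> T h k p" "\<not> T h m p" using eight_pairs[OF S h] by blast
  note r = three_points_rewrites[OF h(1) tp]
  have d: "distinct [h,i,j,k,l,m,q]" using tp by (simp add: three_points_def)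
  have p': "\<not> T h p k" "\<not> T h p m" using p by (simp_all add: sym_iff)
  have T1: "T h i j" "T h k l" "T h m q" "T h l k" "T h q m" by (simp_all add: r)
  have mem: "x \<in> {i,j,k,l,m,q,p}" "y \<in> {i,j,k,l,m,q,p}" "z \<in> {i,j,k,l,m,q,p}" using xyz Seq by auto
  show ?thesis
  proof (cases "T h i p")
    case False
    then have p'': "\<not> T h p i" by (simp add: sym_iff)
    have F: False if "u \<in> {i,j,k,l,m,q,p}" "y \<in> {i,j,k,l,m,q,p}" "z \<in> {i,j,k,l,m,q,p}" "T h u y" "T h u z" "u \<noteq> y" "u \<noteq> z" "y \<noteq> z" for u y z
      using that p False p' p'' by (elim insertE emptyE) (simp_all add: r)
    show ?thesis using F[OF mem] xyz by auto
  next
    case True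
    have pr: "T h p w \<longleftrightarrow> T h i w" "T h w p \<longleftrightarrow> T h w i" for w
      by (rule same_point; use True h p d Seq in auto)+
    have F: "u \<in> {i,j,p}" if "u \<in> {i,j,k,l,m,q,p}" "y \<in> {i,j,k,l,m,q,p}" "z \<in> {i,j,k,l,m,q,p}" "T h u y" "T h u z" "u \<noteq> y" "u \<noteq> z" "y \<noteq> z" for u y z
      using that by (elim insertE emptyE) (simp_all add: r pr)
    have yz: "T h y z" "T h y x" "T h z x" "T h z y"
      using trans[of h x y z] trans[of h x z y] swap23 h xyz by (auto simp: sym_iff)
    have "x \<in> {i,j,p}" "y \<in> {i,j,p}" "z \<in> {i,j,p}"
      using F[OF mem] F[OF mem(2,1,3)] F[OF mem(3,1,2)] xyz yz by auto
    then have X: "{x,y,z} = {i,j,p}" using xyz(4) by auto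
    then have wm: "w \<in> {k,l,m,q}" using w Seq by auto
    have "\<forall>u\<in>{i,j,p}. \<not> T h u w" using wm by (auto simp: r pr)
    then have 1: "\<not> T h x w" "\<not> T h y w" "\<not> T h z w" using X by auto
    have "{k,l,m,q} \<subseteq> S" "{k,l,m,q} \<inter> {h,x,y,z} = {}" using X Seq d p by auto
    moreover have "\<exists>v\<in>{k,l,m,q}. v \<noteq> w \<and> T h w v" using wm d by (auto simp: r)
    ultimately have "\<exists>v\<in>S - {h,x,y,z,w}. T h w v" by blast
    then show ?thesis using 1 by blast
  qed
qed

text \<open>If four lines pass through one point, each of them has to pair up the other four lines;
  two of them then choose the same partner of \<open>w\<close>.\<close>

lemma no_quadruple_point:
  assumes S: "card S = 8" and hv: "\<And>h. h \<in> S \<Longrightarrow> heavy h"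
    and xyz: "h \<in> S" "x \<in> S" "y \<in> S" "z \<in> S" "distinct [h,x,y,z]" "T h x y" "T h x z"
  shows False
proof -
  let ?A = "{h,x,y,z}"
  have fin: "finite S" using S by (auto intro: card_ge_0_finite)
  have cA: "card ?A = 4" using xyz by auto
  have "card (S - ?A) = 4" using card_Diff_subset[of ?A S] cA xyz S by auto
  then have "S - ?A \<noteq> {}" by (metis card.empty zero_neq_numeral)
  then obtain w where w: "w \<in> S - ?A" by blast
  have cN: "card (S - ?A - {w}) = 3" using \<open>card (S - ?A) = 4\<close> w fin by simp
  have Thyz: "T h y z" using trans[of h x y z] swap23 xyz by (auto simp: sym_iff)
  have "T x y h" "T x h z" using xyz by (simp_all add: sym_iff)
  then have Txyz: "T x y z" using trans[of x h y z] xyz by auto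
  have Q: "(\<forall>L'\<in>?A - {L}. \<not> T L L' w) \<and> (\<exists>v. v \<in> S - ?A - {w} \<and> T L w v)" if LA: "L \<in> ?A" for L
  proof -
    have *: "(\<forall>L'\<in>{b,c,e}. \<not> T L L' w) \<and> (\<exists>v. v \<in> S - ?A - {w} \<and> T L w v)"
      if "?A = {L,b,c,e}" "distinct [L,b,c,e]" "T L b c" "T L b e" for b c e
    proof -
      have mem: "L \<in> S" "b \<in> S" "c \<in> S" "e \<in> S" using that(1) xyz by auto
      have w': "w \<in> S" "w \<notin> {L,b,c,e}" using w that(1) by auto
      from quadruple_class[OF S mem(1) hv[OF mem(1)] mem(2-4) that(2-4) w'] that(1) show ?thesis by auto
    qed
    consider "L = h" | "L = x" | "L = y" | "L = z" using LA by auto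
    then show ?thesis
    proof cases
      case 1
      have "(\<forall>L'\<in>{x,y,z}. \<not> T L L' w) \<and> (\<exists>v. v \<in> S - ?A - {w} \<and> T L w v)"
        by (rule *) (use 1 xyz Thyz Txyz in \<open>auto simp: sym_iff\<close>)
      then show ?thesis using 1 xyz by auto
    next
      case 2
      have "(\<forall>L'\<in>{h,y,z}. \<not> T L L' w) \<and> (\<exists>v. v \<in> S - ?A - {w} \<and> T L w v)"
        by (rule *) (use 2 xyz Thyz Txyz in \<open>auto simp: sym_iff\<close>)
      then show ?thesis using 2 xyz by auto
    next
      case 3
      have "(\<forall>L'\<in>{h,x,z}. \<not> T L L' w) \<and> (\<exists>v. v \<in> S - ?A - {w} \<and> T L w v)"
        by (rule *) (use 3 xyz Thyz Txyz in \<open>auto simp: sym_iff\<close>)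
      then show ?thesis using 3 xyz by auto
    next
      case 4
      have "(\<forall>L'\<in>{h,x,y}. \<not> T L L' w) \<and> (\<exists>v. v \<in> S - ?A - {w} \<and> T L w v)"
        by (rule *) (use 4 xyz Thyz Txyz in \<open>auto simp: sym_iff\<close>)
      then show ?thesis using 4 xyz by auto
    qed
  qed
  then obtain f where f: "\<And>L. L \<in> ?A \<Longrightarrow> f L \<in> S - ?A - {w} \<and> T L w (f L)" by metis
  have "card (f ` ?A) \<le> 3" using cN fin f by (metis (no_types, lifting) card_mono finite_Diff image_subsetI)
  then have "\<not> inj_on f ?A" using cA by (intro pigeonhole) simp
  then obtain L L' where L: "L \<in> ?A" "L' \<in> ?A" "L \<noteq> L'" "f L = f L'" unfolding inj_on_def by blast
  \<comment> \<open>A shared partner means that \<open>L\<close>, \<open>L'\<close> and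
    \<open>w\<close> meet in one point. This is the quadruple point, which \<open>w\<close>
    misses.\<close>
  have "T w L (f L)" "T w (f L) L'" using f[OF L(1)] f[OF L(2)] L(4) by (auto simp: sym_iff)
  moreover have "f L \<in> S" "w \<noteq> f L" "w \<in> S" using f[OF L(1)] w by auto
  ultimately have "T w L L'" using trans by blast
  then have "T L L' w" by (simp add: sym_iff)
  then show False using Q[OF L(1)] L by blast
qed

text \<open>\<open>n\<close> is the only line meeting \<open>x\<close> in a double point.\<close>

definition avoids :: "'a \<Rightarrow> 'a \<Rightarrow> bool" where
  "avoids x n \<longleftrightarrow> n \<in> S \<and> n \<noteq> x \<and> (\<forall>y\<in>S - {x,n}. \<not> T x n y) \<and> (\<forall>y\<in>S - {x,n}. \<exists>z\<in>S - {x,n,y}. T x y z)"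

text \<open>Uniqueness of the Moebius-Kantor configuration. Without quadruple points each line meets
  six others in three triple points and the last one in a double point; these two facts determine
  the triples by exclusion.\<close>

lemma eight_structure:
  assumes S: "card S = 8" and hv: "\<And>h. h \<in> S \<Longrightarrow> heavy h"
  shows "\<exists>h i j k l m q p. S = {h,i,j,k,l,m,q,p} \<and> distinct [h,i,j,k,l,m,q,p] \<and> \<not> T h i k \<and>
    T h i j \<and> T h k l \<and> T h m q \<and> T i k m \<and> T j l q \<and> T p i l \<and> T p j m \<and> T p k q" (is ?goal)
proof -
  have U: "z = w" if "T x y z" "T x y w" "{x,y,z,w} \<subseteq> S" "distinct [x,y,z]" "distinct [x,y,w]" for x y z w
    using no_quadruple_point[OF S hv, of x y z w] that by auto
  have pairs: "\<exists>i j k l m q p. three_points h i j k l m q \<and> S = {h,i,j,k,l,m,q,p} \<and> distinct [h,i,j,k,l,m,q,p] \<and> avoids h p"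
    if h: "h \<in> S" for h
  proof -
    obtain i j k l m q p where tp: "three_points h i j k l m q" and Seq: "S = {h,i,j,k,l,m,q,p}"
      and p: "p \<notin> {h,i,j,k,l,m,q}" "\<not> T h k p" "\<not> T h m p" using eight_pairs[OF S h hv[OF h]] by blast
    note r = three_points_rewrites[OF h tp]
    have d: "distinct [h,i,j,k,l,m,q]" using tp by (simp add: three_points_def)
    have "\<not> T h i p" using U[of h i j p] tp p d Seq unfolding three_points_def by auto
    then have p': "\<not> T h p i" "\<not> T h p k" "\<not> T h p m" using p by (simp_all add: sym_iff)
    have "avoids h p" unfolding avoids_def
    proof (intro conjI ballI)
      show "p \<in> S" "p \<noteq> h" using p Seq by auto
      show "\<not> T h p y" if "y \<in> S - {h, p}" for y using that p' Seq by (auto simp: r)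
      show "\<exists>z\<in>S - {h,p,y}. T h y z" if "y \<in> S - {h, p}" for y
      proof -
        have "y \<in> {i,j,k,l,m,q}" using that Seq by auto
        then have "\<exists>z\<in>{i,j,k,l,m,q}. z \<noteq> y \<and> T h y z" using d by (auto simp: r)
        then show ?thesis using d p Seq by auto
      qed
    qed
    moreover have "distinct [h,i,j,k,l,m,q,p]" using d p by auto
    ultimately show ?thesis using tp Seq by blast
  qed
  have core: ?goal
    if Seq: "S = {h,i,j,k,l,m,q,p}" and d: "distinct [h,i,j,k,l,m,q,p]" and T: "T h i j" "T h k l" "T h m q" "\<not> T h i k"
      and ph: "avoids p h" and T2: "T p i l" "T i k m" for h i j k l m q p
  proof -
    have dS: "h \<in> S" "i \<in> S" "j \<in> S" "k \<in> S" "l \<in> S" "m \<in> S" "q \<in> S" "p \<in> S" unfolding Seq by simp_all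
    have mj: "T p j m"
    proof -
      have "m \<in> S - {p,h}" using d dS by auto
      then obtain z where z: "z \<in> S - {p,h,m}" "T p m z" using ph unfolding avoids_def by blast
      have "z \<noteq> i" using U[of p i l m] z T2 d dS by (auto simp: sym_iff)
      moreover have "z \<noteq> l" using U[of p l i m] z T2 d dS by (auto simp: sym_iff)
      moreover have "z \<noteq> q" using U[of m q h p] z T d dS by (auto simp: sym_iff)
      moreover have "z \<noteq> k" using U[of m k i p] z T2 d dS by (auto simp: sym_iff)
      ultimately have "z = j" using z Seq by auto
      then show ?thesis using z by (simp add: sym_iff)
    qed
    have kq: "T p k q"
    proof -
      have "k \<in> S - {p,h}" using d dS by auto
      then obtain z where z: "z \<in> S - {p,h,k}" "T p k z" using ph unfolding avoids_def by blast
      have "z \<noteq> i" using U[of p i l k] z T2 d dS by (auto simp: sym_iff)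
      moreover have "z \<noteq> l" using U[of p l i k] z T2 d dS by (auto simp: sym_iff)
      moreover have "z \<noteq> m" using U[of p m j k] z mj d dS by (auto simp: sym_iff)
      moreover have "z \<noteq> j" using U[of p j m k] z mj d dS by (auto simp: sym_iff)
      ultimately have "z = q" using z Seq by auto
      then show ?thesis using z by simp
    qed
    obtain n where n: "avoids q n" using pairs[OF dS(7)] by blast
    \<comment> \<open>The triple points on \<open>i\<close> are already used up by the pairs
      \<open>h j\<close>, \<open>k m\<close>, \<open>l p\<close>, so \<open>i\<close> and
      \<open>q\<close> meet in a double point and \<open>i\<close> is the line that \<open>q\<close>
      avoids.\<close>
    have qi: "\<not> T q i x" if x: "x \<in> S - {q,i}" for x
    proof
      assume a: "T q i x"
      have "x \<noteq> h" using U[of h i j q] a T d dS by (auto simp: sym_iff)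
      moreover have "x \<noteq> j" using U[of i j h q] a T d dS by (auto simp: sym_iff)
      moreover have "x \<noteq> k" using U[of i k m q] a T2 d dS by (auto simp: sym_iff)
      moreover have "x \<noteq> m" using U[of i m k q] a T2 d dS by (auto simp: sym_iff)
      moreover have "x \<noteq> l" using U[of i l p q] a T2 d dS by (auto simp: sym_iff)
      moreover have "x \<noteq> p" using U[of i p l q] a T2 d dS by (auto simp: sym_iff)
      ultimately show False using x Seq by auto
    qed
    have "n = i"
    proof (rule ccontr)
      assume "n \<noteq> i"
      then have "i \<in> S - {q,n}" using d dS by auto
      then show False using n qi unfolding avoids_def by blast
    qed
    then have "j \<in> S - {q,n}" using d dS by auto
    then obtain z where z: "z \<in> S - {q,i,j}" "T q j z" using n \<open>n = i\<close> unfolding avoids_def by blast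
    have "z \<noteq> h" using U[of h q m j] z T d dS by (auto simp: sym_iff)
    moreover have "z \<noteq> k" using U[of q k p j] z kq d dS by (auto simp: sym_iff)
    moreover have "z \<noteq> m" using U[of q m h j] z T d dS by (auto simp: sym_iff)
    moreover have "z \<noteq> p" using U[of q p k j] z kq d dS by (auto simp: sym_iff)
    ultimately have "z = l" using z Seq by auto
    then have "T j l q" using z by (simp add: sym_iff)
    then show ?goal using Seq d T T2 mj kq by blast
  qed
  have core2: ?goal
    if Seq: "S = {h,i,j,k,l,m,q,p}" and d: "distinct [h,i,j,k,l,m,q,p]" and T: "T h i j" "T h k l" "T h m q"
       "\<not> T h i k" "\<not> T h i m"
      and ph: "avoids p h" and T2: "T p i l" for h i j k l m q p
  proof -
    have dS: "h \<in> S" "i \<in> S" "j \<in> S" "k \<in> S" "l \<in> S" "m \<in> S" "q \<in> S" "p \<in> S" unfolding Seq by simp_all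
    \<comment> \<open>Otherwise \<open>k\<close> is the line avoided by \<open>i\<close>, and the
      only partner left for \<open>m\<close> on \<open>i\<close> is \<open>q\<close>; but
      \<open>m\<close> and \<open>q\<close> already meet on \<open>h\<close>.\<close>
    have "T i k m \<or> T i k q"
    proof (rule ccontr)
      assume no: "\<not> (T i k m \<or> T i k q)"
      obtain n where n: "avoids i n" using pairs[OF dS(2)] by blast
      have ik: "\<not> T i k x" if x: "x \<in> S - {i,k}" for x
      proof
        assume a: "T i k x"
        have "x \<noteq> h" using a T by (auto simp: sym_iff)
        moreover have "x \<noteq> j" using U[of i j h k] a T d dS by (auto simp: sym_iff)
        moreover have "x \<noteq> l" using U[of i l p k] a T2 d dS by (auto simp: sym_iff)
        moreover have "x \<noteq> p" using U[of i p l k] a T2 d dS by (auto simp: sym_iff)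
        moreover have "x \<noteq> m" "x \<noteq> q" using no a by auto
        ultimately show False using x Seq by auto
      qed
      have "n = k"
      proof (rule ccontr)
        assume "n \<noteq> k"
        then have "k \<in> S - {i,n}" using d dS by auto
        then show False using n ik unfolding avoids_def by blast
      qed
      then have "m \<in> S - {i,n}" using d dS by auto
      then obtain z where z: "z \<in> S - {i,k,m}" "T i m z" using n \<open>n = k\<close> unfolding avoids_def by blast
      have "z \<noteq> h" using z T by (auto simp: sym_iff)
      moreover have "z \<noteq> j" using U[of i j h m] z T d dS by (auto simp: sym_iff)
      moreover have "z \<noteq> l" using U[of i l p m] z T2 d dS by (auto simp: sym_iff)
      moreover have "z \<noteq> p" using U[of i p l m] z T2 d dS by (auto simp: sym_iff)
      moreover have "z \<noteq> q" using U[of m q h i] z T d dS by (auto simp: sym_iff)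
      ultimately show False using z Seq by auto
    qed
    then show ?goal
    proof
      assume "T i k m"
      then show ?goal using core[OF Seq d T(1-4) ph T2] by blast
    next
      assume 1: "T i k q"
      have "S = {h,i,j,k,l,q,m,p}" "distinct [h,i,j,k,l,q,m,p]" "T h q m" using Seq d T by (auto simp: sym_iff)
      then show ?goal using core[of h i j k l q m p] T ph T2 1 by blast
    qed
  qed
  have "S \<noteq> {}" using S by auto
  then obtain h where h: "h \<in> S" by blast
  obtain i j k l m q p where tp: "three_points h i j k l m q" and Seq: "S = {h,i,j,k,l,m,q,p}"
    and d: "distinct [h,i,j,k,l,m,q,p]" and hp: "avoids h p" using pairs[OF h] by blast
  have dS: "h \<in> S" "i \<in> S" "j \<in> S" "k \<in> S" "l \<in> S" "m \<in> S" "q \<in> S" "p \<in> S" unfolding Seq by simp_all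
  note r = three_points_rewrites[OF h tp]
  have T: "T h i j" "T h k l" "T h m q" "T h l k" "T h q m" "\<not> T h i k" "\<not> T h i m" "\<not> T h i l" "\<not> T h i q"
    by (simp_all add: r)
  obtain n where n: "avoids p n" using pairs[OF dS(8)] by blast
  \<comment> \<open>Meeting in a double point is symmetric, so \<open>p\<close> avoids
    \<open>h\<close> because \<open>h\<close> avoids \<open>p\<close>.\<close>
  have "n = h"
  proof (rule ccontr)
    assume "n \<noteq> h"
    then have "h \<in> S - {p,n}" using d dS by auto
    then obtain z where "z \<in> S - {p,n,h}" "T p h z" using n unfolding avoids_def by blast
    then have "z \<in> S - {h,p}" "T h p z" by (auto simp: sym_iff)
    then show False using hp unfolding avoids_def by blast
  qed
  then have ph: "avoids p h" using n by simp
  have "i \<in> S - {p,h}" using d dS by auto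
  then obtain z where z: "z \<in> S - {p,h,i}" "T p i z" using ph unfolding avoids_def by blast
  have "z \<noteq> j" using U[of i j h p] z T d dS by (auto simp: sym_iff)
  \<comment> \<open>Exchanging the two lines of a pair, or the pairs \<open>k l\<close> and
    \<open>m q\<close>, brings the partner of \<open>i\<close> on \<open>p\<close> into the place of
    \<open>l\<close> in all four cases.\<close>
  then consider "z = k" | "z = l" | "z = m" | "z = q" using z Seq by auto
  then show ?goal
  proof cases
    case 1
    have "S = {h,i,j,l,k,m,q,p}" "distinct [h,i,j,l,k,m,q,p]" using Seq d by auto
    then show ?goal by (rule core2) (use T ph z 1 in simp_all)
  next
    case 2
    show ?goal by (rule core2[OF Seq d]) (use T ph z 2 in simp_all)
  next
    case 3
    have "S = {h,i,j,q,m,k,l,p}" "distinct [h,i,j,q,m,k,l,p]" using Seq d by auto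
    then show ?goal by (rule core2) (use T ph z 3 in simp_all)
  next
    case 4
    have "S = {h,i,j,m,q,k,l,p}" "distinct [h,i,j,m,q,k,l,p]" using Seq d by auto
    then show ?goal by (rule core2) (use T ph z 4 in simp_all)
  qed
qed

end

section \<open>Removing a line with at most two multiple points\<close>

definition general_lines :: "nat set \<Rightarrow> (nat \<Rightarrow> complex^3) \<Rightarrow> bool" where
  "general_lines S a \<longleftrightarrow> (\<forall>i\<in>S. \<forall>j\<in>S. i \<noteq> j \<longrightarrow> crs (a i) (a j) \<noteq> 0)"

lemma concurrency_det3:
  assumes "general_lines S a"
  shows "concurrency S (\<lambda>i j k. det3 (a i) (a j) (a k) = 0)"
proof
  show "det3 (a j) (a i) (a k) = 0" if "det3 (a i) (a j) (a k) = 0" for i j k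
    using that det3_perm(1)[where a="a i" and b="a j" and c="a k"] by simp
  show "det3 (a i) (a k) (a j) = 0" if "det3 (a i) (a j) (a k) = 0" for i j k
    using that det3_perm(2)[where a="a i" and b="a j" and c="a k"] by simp
  show "det3 (a h) (a j) (a l) = 0"
    if "h \<in> S" "k \<in> S" "h \<noteq> k" "det3 (a h) (a j) (a k) = 0" "det3 (a h) (a k) (a l) = 0" for h k j l
    using det3_trans[OF _ that(4,5)] that assms unfolding general_lines_def by blast
qed simp

lemma same_pattern_general: "same_pattern S a b \<Longrightarrow> general_lines S a"
  "same_pattern S a b \<Longrightarrow> general_lines S b"
  unfolding same_pattern_def general_lines_def by blast+

lemma same_pattern_subset: "same_pattern S a b \<Longrightarrow> R \<subseteq> S \<Longrightarrow> same_pattern R a b"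
  unfolding same_pattern_def by (meson subsetD)

lemma deformable_remove:
  assumes h: "h \<in> S" and pat: "same_pattern S a b" and def: "deformable (S - {h}) a b"
    and light: "\<not> concurrency.heavy S (\<lambda>i j k. det3 (a i) (a j) (a k) = 0) h"
  shows "deformable S a b"
proof -
  interpret concurrency S "\<lambda>i j k. det3 (a i) (a j) (a k) = 0"
    by (rule concurrency_det3[OF same_pattern_general(1)[OF pat]])
  let ?R = "S - {h}"
  have ins: "insert h ?R = S" "h \<notin> ?R" using h by auto
  have pat': "same_pattern (insert h ?R) a b" using pat ins by simp
  have "deformable (insert h ?R) a b"
  proof (cases "\<exists>i\<in>?R. \<exists>j\<in>?R. i \<noteq> j \<and> det3 (a h) (a i) (a j) = 0")
    case False
    then show ?thesis by (intro deformable_insert_generic[OF ins(2) def]) blast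
  next
    case True
    then obtain i j where ij: "i \<in> ?R" "j \<in> ?R" "i \<noteq> j" "det3 (a h) (a i) (a j) = 0" by blast
    show ?thesis
    proof (cases "\<exists>k\<in>?R. \<exists>l\<in>?R. k \<noteq> l \<and> det3 (a h) (a k) (a l) = 0 \<and> det3 (a h) (a i) (a k) \<noteq> 0")
      case False
      then show ?thesis by (intro deformable_insert_pencil[OF ins(2) def pat' ij]) blast
    next
      case True
      then obtain k l where kl: "k \<in> ?R" "l \<in> ?R" "k \<noteq> l" "det3 (a h) (a k) (a l) = 0"
        and ik: "det3 (a h) (a i) (a k) \<noteq> 0" by blast
      show ?thesis
      proof (rule deformable_insert_two_points[OF ins(2) def pat' ij kl ik])
        fix m q assume mq: "m \<in> ?R" "q \<in> ?R" "m \<noteq> q" "det3 (a h) (a m) (a q) = 0"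
        show "det3 (a h) (a i) (a m) = 0 \<or> det3 (a h) (a k) (a m) = 0"
          using light heavyI[OF h, of i j k l m q] ij kl mq ik by auto
      qed
    qed
  qed
  then show ?thesis unfolding ins(1) .
qed

section \<open>The Fano plane is not realizable\<close>

lemma det3_coordinates:
  "det3 (x1 *s A + y1 *s B + z1 *s D) (x2 *s A + y2 *s B + z2 *s D) (x3 *s A + y3 *s B + z3 *s D) =
    (x1 * (y2 * z3 - z2 * y3) - y1 * (x2 * z3 - z2 * x3) + z1 * (x2 * y3 - y2 * x3)) * det3 A B D"
proof -
  have lin: "det3 (u + v) w r = det3 u w r + det3 v w r" "det3 w (u + v) r = det3 w u r + det3 w v r"
    "det3 w r (u + v) = det3 w r u + det3 w r v"
    "det3 (c *s u) w r = c * det3 u w r" "det3 w (c *s u) r = c * det3 w u r"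
    "det3 w r (c *s u) = c * det3 w r u" for u v w r c
    by (simp_all add: det3_alt algebra_simps)
  have p: "det3 B A D = - det3 A B D" "det3 A D B = - det3 A B D" "det3 D B A = - det3 A B D"
    "det3 B D A = det3 A B D" "det3 D A B = det3 A B D"
    by (rule det3_perm)+
  show ?thesis by (simp add: lin p algebra_simps)
qed

text \<open>A vanishing coefficient would make \<open>c\<close> parallel to \<open>a\<close> or to
  \<open>b\<close>.\<close>

lemma collinear_combination:
  assumes "crs a b \<noteq> 0" "crs a c \<noteq> 0" "crs b c \<noteq> 0" "det3 a b c = 0"
  shows "\<exists>x y. x \<noteq> 0 \<and> y \<noteq> 0 \<and> c = x *s a + y *s b"
proof -
  obtain x y where c: "c = x *s a + y *s b" using det3_eq_0_iff assms(1,4) by blast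
  have "crs a c = y *s crs a b" "crs b c = (- x) *s crs a b"
    by (simp_all add: c vec3_eq_iff algebra_simps)
  then have "x \<noteq> 0" "y \<noteq> 0" using assms by auto
  then show ?thesis using c by blast
qed

text \<open>In the basis \<open>h\<close>, \<open>i\<close>, \<open>k\<close> the last three
  concurrences force twice a product of nonzero coefficients to vanish: the Fano plane needs
  characteristic 2.\<close>

lemma fano_not_realizable:
  assumes D: "det3 h i k \<noteq> 0"
    and T: "det3 h i j = 0" "det3 h k l = 0" "det3 h m q = 0" "det3 i k m = 0" "det3 i l q = 0" "det3 j k q = 0" "det3 j l m = 0"
    and c: "crs h i \<noteq> 0" "crs h j \<noteq> 0" "crs i j \<noteq> 0" "crs h k \<noteq> 0" "crs h l \<noteq> 0" "crs k l \<noteq> 0"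
      "crs h m \<noteq> 0" "crs h q \<noteq> 0" "crs m q \<noteq> 0" "crs i k \<noteq> 0" "crs i m \<noteq> 0" "crs k m \<noteq> 0"
  shows False
proof -
  obtain x y where j: "x \<noteq> 0" "y \<noteq> 0" "j = x *s h + y *s i" using collinear_combination[OF c(1-3) T(1)] by blast
  obtain x' z where l: "x' \<noteq> 0" "z \<noteq> 0" "l = x' *s h + z *s k" using collinear_combination[OF c(4-6) T(2)] by blast
  obtain u v where m: "u \<noteq> 0" "v \<noteq> 0" "m = u *s i + v *s k" using collinear_combination[OF c(10-12) T(4)] by blast
  obtain \<alpha> \<beta> where q: "\<alpha> \<noteq> 0" "\<beta> \<noteq> 0" "q = \<alpha> *s h + \<beta> *s m" using collinear_combination[OF c(7-9) T(3)] by blast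
  have e: "i = 0 *s h + 1 *s i + 0 *s k" "k = 0 *s h + 0 *s i + 1 *s k" "j = x *s h + y *s i + 0 *s k"
    "l = x' *s h + 0 *s i + z *s k" "m = 0 *s h + u *s i + v *s k" "q = \<alpha> *s h + (\<beta> * u) *s i + (\<beta> * v) *s k"
    using j l m q by (simp_all add: vec_eq_iff algebra_simps)
  have "det3 i l q = (z * \<alpha> - x' * \<beta> * v) * det3 h i k"
    by (subst e(1), subst e(4), subst e(6), subst det3_coordinates) (simp add: algebra_simps)
  then have 1: "z * \<alpha> = x' * \<beta> * v" using T(5) D by simp
  have "det3 j k q = (y * \<alpha> - x * \<beta> * u) * det3 h i k"
    by (subst e(3), subst e(2), subst e(6), subst det3_coordinates) (simp add: algebra_simps)
  then have 2: "y * \<alpha> = x * \<beta> * u" using T(6) D by simp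
  have "det3 j l m = (x * z * u + y * x' * v) * (- det3 h i k)"
    by (subst e(3), subst e(4), subst e(5), subst det3_coordinates) (simp add: algebra_simps)
  then have 3: "x * z * u + y * x' * v = 0" using T(7) D by simp
  have "2 * (x * x' * u * v * \<beta>) = x * u * (x' * \<beta> * v) + x' * v * (x * \<beta> * u)" by (simp add: algebra_simps)
  also have "\<dots> = \<alpha> * (x * z * u + y * x' * v)" unfolding 1[symmetric] 2[symmetric] by (simp add: algebra_simps)
  finally show False using 3 j l m q by simp
qed

text \<open>Lines that are not heavy are removed by induction. A nonempty remainder of heavy lines
  has exactly seven of them by \<open>heavy_card\<close> and would be a complex Fano plane.\<close>

lemma deformable_le_7:
  "\<lbrakk>finite S; card S \<le> 7; same_pattern S a b\<rbrakk> \<Longrightarrow> deformable S a b"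
proof (induction "card S" arbitrary: S rule: less_induct)
  case less
  let ?T = "\<lambda>i j k. det3 (a i) (a j) (a k) = 0"
  note gen = same_pattern_general(1)[OF less.prems(3)]
  interpret concurrency S ?T by (rule concurrency_det3[OF gen])
  show ?case
  proof (cases "\<exists>h\<in>S. \<not> heavy h")
    case True
    then obtain h where h: "h \<in> S" "\<not> heavy h" by blast
    have "card (S - {h}) < card S" using h less.prems by (intro psubset_card_mono) auto
    then have "deformable (S - {h}) a b"
      using less.prems by (intro less.hyps) (auto intro: same_pattern_subset)
    then show ?thesis using deformable_remove[OF h(1) less.prems(3)] h(2) by blast
  next
    case False
    show ?thesis
    proof (cases "S = {}")
      case True then show ?thesis by (simp add: deformable_empty)
    next
      case ne: False
      then have "card S = 7" using heavy_card[OF less.prems(1)] False less.prems(2) by fastforce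
      then obtain h i j k l m q where S: "{h,i,j,k,l,m,q} \<subseteq> S" and d: "distinct [h,i,j,k,l,m,q]"
        and T: "\<not> ?T h i k" "?T h i j" "?T h k l" "?T h m q" "?T i k m" "?T i l q" "?T j k q" "?T j l m"
        using fano_structure False by blast
      have c: "crs (a u) (a v) \<noteq> 0" if "u \<in> S" "v \<in> S" "u \<noteq> v" for u v
        using gen that unfolding general_lines_def by blast
      have False
        by (rule fano_not_realizable[OF T(1-8)]; rule c) (use S d in auto)
      then show ?thesis ..
    qed
  qed
qed

section \<open>The MacLane arrangements\<close>

definition proportional :: "complex^3 \<Rightarrow> complex^3 \<Rightarrow> bool" where
  "proportional u w \<longleftrightarrow> (\<exists>c. c \<noteq> 0 \<and> u = c *s w)"

text \<open>Five concurrences express the other lines through \<open>a\<close>, \<open>b\<close>,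
  \<open>d\<close>; rescaling the latter two turns \<open>c\<close> and \<open>e\<close> into
  \<open>A + B\<close> and \<open>A + D\<close>. Three unknowns \<open>r\<close>, \<open>s\<close>,
  \<open>t\<close> remain for \<open>g\<close>, \<open>f\<close>, \<open>p\<close>, and the last
  three concurrences give \<open>r = 1 + s\<close>, \<open>t * s = 1 + s\<close>,
  \<open>t * r = 1\<close>.\<close>

lemma maclane_normal_form:
  assumes ndet: "det3 a b d \<noteq> 0"
    and T: "det3 a b c = 0" "det3 a d e = 0" "det3 a f g = 0" "det3 b d f = 0" "det3 c e g = 0"
      "det3 p b e = 0" "det3 p c f = 0" "det3 p d g = 0"
    and nc: "crs a b \<noteq> 0" "crs a c \<noteq> 0" "crs b c \<noteq> 0" "crs a d \<noteq> 0" "crs a e \<noteq> 0" "crs d e \<noteq> 0"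
      "crs a f \<noteq> 0" "crs a g \<noteq> 0" "crs f g \<noteq> 0" "crs b d \<noteq> 0" "crs b f \<noteq> 0" "crs d f \<noteq> 0"
      "crs b e \<noteq> 0" "crs b p \<noteq> 0" "crs e p \<noteq> 0"
  shows "\<exists>A B D s. det3 A B D \<noteq> 0 \<and> s * s + s + 1 = 0 \<and> proportional a A \<and> proportional b B \<and>
    proportional c (A + B) \<and> proportional d D \<and> proportional e (A + D) \<and> proportional f (B + s *s D) \<and>
    proportional g ((1 + s) *s A + B + s *s D) \<and> proportional p (A + (- s) *s B + D)"
proof -
  obtain x y where c: "x \<noteq> 0" "y \<noteq> 0" "c = x *s a + y *s b" using collinear_combination[OF nc(1-3) T(1)] by blast
  obtain x' z where e: "x' \<noteq> 0" "z \<noteq> 0" "e = x' *s a + z *s d" using collinear_combination[OF nc(4-6) T(2)] by blast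
  obtain u w where f: "u \<noteq> 0" "w \<noteq> 0" "f = u *s b + w *s d" using collinear_combination[OF nc(10-12) T(4)] by blast
  obtain \<alpha> \<beta> where g: "\<alpha> \<noteq> 0" "\<beta> \<noteq> 0" "g = \<alpha> *s a + \<beta> *s f" using collinear_combination[OF nc(7-9) T(3)] by blast
  have "det3 b e p = 0" using T(6) det3_perm(5)[where a=b and b=e and c=p] by simp
  then obtain \<rho> \<sigma> where p: "\<rho> \<noteq> 0" "\<sigma> \<noteq> 0" "p = \<rho> *s b + \<sigma> *s e" using collinear_combination[OF nc(13-15)] by blast
  define B where "B = (y / x) *s b"
  define D where "D = (z / x') *s d"
  define s where "s = (w * x' / z) / (u * x / y)"
  define r where "r = \<alpha> / (\<beta> * (u * x / y))"
  define t where "t = (\<rho> * x / y) / (\<sigma> * x')"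
  have nz: "u * x / y \<noteq> 0" "\<beta> * (u * x / y) \<noteq> 0" "\<sigma> * x' \<noteq> 0" using c e f g p by auto
  have b': "b = (x / y) *s B" and d': "d = (x' / z) *s D" using c e by (simp_all add: B_def D_def)
  have c': "c = x *s (a + B)" using c by (simp add: B_def vec_eq_iff algebra_simps)
  have e': "e = x' *s (a + D)" using e by (simp add: D_def vec_eq_iff algebra_simps)
  have f': "f = (u * x / y) *s (B + s *s D)"
    using nz(1) by (simp add: f(3) b' d' s_def vec_eq_iff algebra_simps)
  have g': "g = (\<beta> * (u * x / y)) *s (r *s a + B + s *s D)"
    using nz(2) unfolding g(3) f' by (simp add: r_def vec_eq_iff algebra_simps)
  have p': "p = (\<sigma> * x') *s (a + t *s B + D)"
    using nz(3) unfolding p(3) e' b' by (simp add: t_def vec_eq_iff algebra_simps)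
  have det: "det3 a B D \<noteq> 0"
    using ndet c e det3_scale[of 1 a "y/x" b "z/x'" d] by (simp add: B_def D_def)
  have cf: "a + B = 1 *s a + 1 *s B + 0 *s D" "a + D = 1 *s a + 0 *s B + 1 *s D" "B + s *s D = 0 *s a + 1 *s B + s *s D"
    "r *s a + B + s *s D = r *s a + 1 *s B + s *s D" "a + t *s B + D = 1 *s a + t *s B + 1 *s D"
    "D = 0 *s a + 0 *s B + 1 *s D"
    by simp_all
  have "det3 (a + B) (a + D) (r *s a + B + s *s D) = 0"
    using T(5) c(1) e(1) nz(2) unfolding c' e' g' det3_scale by simp
  then have "(r - 1 - s) * det3 a B D = 0" unfolding cf(1,2,4) det3_coordinates by (simp add: algebra_simps)
  then have "r - 1 - s = 0" using det by simp
  then have r: "r = 1 + s" by (simp add: algebra_simps)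
  have "det3 (a + t *s B + D) (a + B) (B + s *s D) = 0"
    using T(7) nz(1,3) c(1) unfolding c' f' p' det3_scale by simp
  then have "(1 + s - t * s) * det3 a B D = 0" unfolding cf(1,3,5) det3_coordinates by (simp add: algebra_simps)
  then have ts: "t * s = 1 + s" using det by simp
  have "det3 (a + t *s B + D) D (r *s a + B + s *s D) = 0"
    using T(8) nz(2,3) e(1,2) unfolding d' g' p' det3_scale by simp
  then have "(t * r - 1) * det3 a B D = 0" by (subst (asm) cf(6), unfold cf(4,5) det3_coordinates) (simp add: algebra_simps)
  then have tr: "t * r = 1" using det by simp
  \<comment> \<open>Eliminating \<open>r\<close> and \<open>t\<close> leaves the equation of the
    primitive cube roots of unity, the only freedom in the configuration.\<close>
  have "(1 + s) * (1 + s) = s * (t * r)" using ts r by (simp add: algebra_simps)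
  then have "(1 + s) * (1 + s) = s" by (simp only: tr mult_1_right)
  then have ss: "s * s + s + 1 = 0" by (simp add: algebra_simps)
  have "s \<noteq> 0" using ts by auto
  moreover have "s * (t + s) = 0" using ts ss by (simp add: algebra_simps)
  ultimately have t: "t = - s" by (simp add: add_eq_0_iff)
  have P: "proportional v w" if "v = k *s w" "k \<noteq> 0" for v w k
    using that unfolding proportional_def by blast
  have "proportional a a" "proportional b B" "proportional d D"
    using P[of a 1 a] P[OF b'] P[OF d'] c e by auto
  moreover have "proportional c (a + B)" "proportional e (a + D)" "proportional f (B + s *s D)"
    using P[OF c' c(1)] P[OF e' e(1)] P[OF f' nz(1)] by auto
  moreover have "proportional g ((1 + s) *s a + B + s *s D)" "proportional p (a + (- s) *s B + D)"
    using P[OF g' nz(2)] P[OF p' nz(3)] unfolding r t by auto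
  ultimately show ?thesis using det ss by blast
qed

text \<open>Cramer's rule in closed form: the vector on which \<open>A\<close>, \<open>B\<close>,
  \<open>D\<close> take the values \<open>x\<close>, \<open>y\<close>, \<open>z\<close>, visibly
  continuous in these values.\<close>

definition solve3 :: "complex^3 \<Rightarrow> complex^3 \<Rightarrow> complex^3 \<Rightarrow> complex \<Rightarrow> complex \<Rightarrow> complex \<Rightarrow> complex^3" where
  "solve3 A B D x y z = inverse (det3 A B D) *s (x *s crs B D + y *s crs D A + z *s crs A B)"

lemma solve3:
  assumes "det3 A B D \<noteq> 0"
  shows "dot A (solve3 A B D x y z) = x" "dot B (solve3 A B D x y z) = y" "dot D (solve3 A B D x y z) = z"
    "solve3 A B D (dot A v) (dot B v) (dot D v) = v"
proof -
  have p: "dot A (crs B D) = det3 A B D" "dot B (crs D A) = det3 A B D" "dot D (crs A B) = det3 A B D"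
    using det3_perm[where a=A and b=B and c=D] by (simp_all add: det3_def)
  show "dot A (solve3 A B D x y z) = x" "dot B (solve3 A B D x y z) = y" "dot D (solve3 A B D x y z) = z"
    using assms by (simp_all add: solve3_def dot_linear p)
  have "dot A v *s crs B D + dot B v *s crs D A + dot D v *s crs A B = det3 A B D *s v"
    by (simp add: vec3_eq_iff det3_alt dot_3 algebra_simps)
  then show "solve3 A B D (dot A v) (dot B v) (dot D v) = v" using assms by (simp add: solve3_def)
qed

text \<open>The map is fixed by requiring that \<open>A'\<close>, \<open>B'\<close>,
  \<open>D'\<close> take on the image of \<open>v\<close> the \<sigma>-images of the values of
  \<open>A\<close>, \<open>B\<close>, \<open>D\<close> at \<open>v\<close>. Since \<sigma> respects
  sums and products, it carries every line to the one with \<sigma>-conjugate coordinates.\<close>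

lemma lines_homeo_coordinates:
  fixes \<sigma> :: "complex \<Rightarrow> complex"
  assumes det: "det3 A B D \<noteq> 0" "det3 A' B' D' \<noteq> 0"
    and \<sigma>: "continuous_on UNIV \<sigma>" "\<And>x y. \<sigma> (x + y) = \<sigma> x + \<sigma> y" "\<And>x y. \<sigma> (x * y) = \<sigma> x * \<sigma> y" "\<And>x. \<sigma> (\<sigma> x) = x" "\<sigma> 0 = 0"
    and coords: "\<And>i. i < n \<Longrightarrow> \<exists>x y z. proportional (a i) (x *s A + y *s B + z *s D) \<and>
       proportional (b i) (\<sigma> x *s A' + \<sigma> y *s B' + \<sigma> z *s D')"
  shows "lines_homeo n a b"
proof (rule lines_homeoI[of "\<lambda>v. solve3 A' B' D' (\<sigma> (dot A v)) (\<sigma> (dot B v)) (\<sigma> (dot D v))"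
      "\<lambda>v. solve3 A B D (\<sigma> (dot A' v)) (\<sigma> (dot B' v)) (\<sigma> (dot D' v))"])
  have cont: "continuous_on UNIV (\<lambda>v. solve3 P Q R (\<sigma> (dot P' v)) (\<sigma> (dot Q' v)) (\<sigma> (dot R' v)))" for P Q R P' Q' R'
  proof -
    have *: "continuous_on UNIV (\<lambda>v. \<sigma> (dot P v))" for P
      by (rule continuous_on_compose2[OF \<sigma>(1) continuous_dot]) simp
    have "continuous_on UNIV (\<lambda>v. \<chi> k. solve3 P Q R (\<sigma> (dot P' v)) (\<sigma> (dot Q' v)) (\<sigma> (dot R' v)) $ k)"
      unfolding solve3_def by (intro continuous_on_vec_lambda) (simp, intro continuous_intros *)
    then show ?thesis by simp
  qed
  show "continuous_on UNIV (\<lambda>v. solve3 A' B' D' (\<sigma> (dot A v)) (\<sigma> (dot B v)) (\<sigma> (dot D v)))"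
    "continuous_on UNIV (\<lambda>v. solve3 A B D (\<sigma> (dot A' v)) (\<sigma> (dot B' v)) (\<sigma> (dot D' v)))"
    by (rule cont)+
  show "solve3 A' B' D' (\<sigma> (dot A 0)) (\<sigma> (dot B 0)) (\<sigma> (dot D 0)) = 0"
    by (simp add: dot_linear \<sigma>(5) solve3_def)
  let ?f = "\<lambda>v. solve3 A' B' D' (\<sigma> (dot A v)) (\<sigma> (dot B v)) (\<sigma> (dot D v))"
  have scale: "?f (c *s v) = \<sigma> c *s ?f v" for c v
    by (simp add: dot_linear \<sigma>(3) solve3_def vec_eq_iff algebra_simps)
  show "?f ` proj_pt v = proj_pt (?f v)" for v
  proof -
    have s0: "\<sigma> c \<noteq> 0 \<longleftrightarrow> c \<noteq> 0" for c using \<sigma>(4,5) by metis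
    have "?f ` proj_pt v = {\<sigma> c *s ?f v |c. c \<noteq> 0}"
      by (simp only: proj_pt_def setcompr_eq_image image_image scale)
    also have "\<dots> = proj_pt (?f v)" unfolding proj_pt_def using s0 \<sigma>(4) by (metis (no_types, opaque_lifting))
    finally show ?thesis .
  qed
  show "dot (b i) (?f v) = 0 \<longleftrightarrow> dot (a i) v = 0" if i: "i < n" for i v
  proof -
    obtain x y z c c' where *: "a i = c *s (x *s A + y *s B + z *s D)" "c \<noteq> 0"
      "b i = c' *s (\<sigma> x *s A' + \<sigma> y *s B' + \<sigma> z *s D')" "c' \<noteq> 0"
      using coords[OF i] unfolding proportional_def by blast
    have "dot (b i) (?f v) = c' * \<sigma> (dot (x *s A + y *s B + z *s D) v)"
      unfolding *(3) by (simp add: dot_linear solve3[OF det(2)] \<sigma>(2,3) distrib_left mult.assoc)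
    moreover have "\<sigma> w = 0 \<longleftrightarrow> w = 0" for w using \<sigma>(4,5) by metis
    moreover have "dot (a i) v = c * dot (x *s A + y *s B + z *s D) v"
      unfolding *(1) by (simp only: dot_linear(5))
    ultimately show ?thesis using *(2,4) by (simp only: mult_eq_0_iff)
  qed
qed (simp_all add: solve3[OF det(1)] solve3[OF det(2)] \<sigma>(4))

text \<open>The second root is \<open>- 1 - s\<close>, and conjugation also yields a root. It is a
  different one because the equation has no real solution, as completing the square shows.\<close>

lemma primitive_cube_roots:
  fixes s t :: complex
  assumes "s * s + s + 1 = 0" "t * t + t + 1 = 0"
  shows "t = s \<or> t = cnj s"
proof -
  have roots: "u = s \<or> u = - 1 - s" if "u * u + u + 1 = 0" for u
  proof -
    have "u * u + u + 1 = s * s + s + 1" using that assms(1) by simp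
    then have "u * u + u = s * s + s" by (rule add_right_imp_eq)
    then have "(u - s) * (u + s + 1) = 0" by (simp add: algebra_simps)
    then have "u = s \<or> u + s + 1 = 0" by simp
    moreover have "u = (u + s + 1) - 1 - s" by simp
    ultimately show ?thesis by (metis diff_0)
  qed
  have "cnj (s * s + s + 1) = 0" using assms(1) by simp
  then have c: "cnj s = s \<or> cnj s = - 1 - s" by (intro roots) simp
  have "cnj s \<noteq> s"
  proof
    assume "cnj s = s"
    then have "Im s = 0" by (simp add: complex_eq_iff)
    then have "Re s * Re s + Re s + 1 = 0" using assms(1) by (simp add: complex_eq_iff)
    moreover have "Re s * Re s + Re s + 1 = (Re s + 1/2) * (Re s + 1/2) + 3/4" by (simp add: algebra_simps)
    moreover have "(Re s + 1/2) * (Re s + 1/2) \<ge> 0" by (rule zero_le_square)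
    ultimately show False by linarith
  qed
  then show ?thesis using c roots[OF assms(2)] by auto
qed


text \<open>The same labelling brings \<open>a\<close> and \<open>b\<close> to the same normal form
  except for the choice of \<open>s\<close> or \<open>t\<close>. The identity or conjugation matches
  the two.\<close>

lemma maclane_lines_homeo:
  assumes "card S = 8" and S: "S = {..<n}" and pat: "same_pattern S a b"
    and heavy: "\<And>h. h \<in> S \<Longrightarrow> concurrency.heavy S (\<lambda>i j k. det3 (a i) (a j) (a k) = 0) h"
  shows "lines_homeo n a b"
proof -
  interpret concurrency S "\<lambda>i j k. det3 (a i) (a j) (a k) = 0"
    by (rule concurrency_det3[OF same_pattern_general(1)[OF pat]])
  obtain h i j k l m q p where Seq: "S = {h,i,j,k,l,m,q,p}" and d: "distinct [h,i,j,k,l,m,q,p]"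
    and T: "det3 (a h) (a i) (a k) \<noteq> 0" "det3 (a h) (a i) (a j) = 0" "det3 (a h) (a k) (a l) = 0"
      "det3 (a h) (a m) (a q) = 0" "det3 (a i) (a k) (a m) = 0" "det3 (a j) (a l) (a q) = 0"
      "det3 (a p) (a i) (a l) = 0" "det3 (a p) (a j) (a m) = 0" "det3 (a p) (a k) (a q) = 0"
    using eight_structure[OF assms(1) heavy] by blast
  have nf: "\<exists>A B D s. det3 A B D \<noteq> 0 \<and> s * s + s + 1 = 0 \<and> proportional (c h) A \<and> proportional (c i) B \<and>
    proportional (c j) (A + B) \<and> proportional (c k) D \<and> proportional (c l) (A + D) \<and> proportional (c m) (B + s *s D) \<and>
    proportional (c q) ((1 + s) *s A + B + s *s D) \<and> proportional (c p) (A + (- s) *s B + D)"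
    if gen: "general_lines S c" and same: "\<And>u v w. u \<in> S \<Longrightarrow> v \<in> S \<Longrightarrow> w \<in> S \<Longrightarrow>
      det3 (c u) (c v) (c w) = 0 \<longleftrightarrow> det3 (a u) (a v) (a w) = 0" for c
  proof (rule maclane_normal_form)
    have nc: "crs (c u) (c v) \<noteq> 0" if "u \<in> S" "v \<in> S" "u \<noteq> v" for u v
      using gen that unfolding general_lines_def by blast
    have mem: "h \<in> S" "i \<in> S" "j \<in> S" "k \<in> S" "l \<in> S" "m \<in> S" "q \<in> S" "p \<in> S" unfolding Seq by simp_all
    show "det3 (c h) (c i) (c k) \<noteq> 0" "det3 (c h) (c i) (c j) = 0" "det3 (c h) (c k) (c l) = 0"
      "det3 (c h) (c m) (c q) = 0" "det3 (c i) (c k) (c m) = 0" "det3 (c j) (c l) (c q) = 0"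
      "det3 (c p) (c i) (c l) = 0" "det3 (c p) (c j) (c m) = 0" "det3 (c p) (c k) (c q) = 0"
      using T by (simp_all add: same mem)
    show "crs (c h) (c i) \<noteq> 0" "crs (c h) (c j) \<noteq> 0" "crs (c i) (c j) \<noteq> 0" "crs (c h) (c k) \<noteq> 0"
      "crs (c h) (c l) \<noteq> 0" "crs (c k) (c l) \<noteq> 0" "crs (c h) (c m) \<noteq> 0" "crs (c h) (c q) \<noteq> 0"
      "crs (c m) (c q) \<noteq> 0" "crs (c i) (c k) \<noteq> 0" "crs (c i) (c m) \<noteq> 0" "crs (c k) (c m) \<noteq> 0"
      "crs (c i) (c l) \<noteq> 0" "crs (c i) (c p) \<noteq> 0" "crs (c l) (c p) \<noteq> 0"
      by (rule nc; use mem d in auto)+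
  qed
  obtain A B D s where a: "det3 A B D \<noteq> 0" "s * s + s + 1 = 0" "proportional (a h) A" "proportional (a i) B"
    "proportional (a j) (A + B)" "proportional (a k) D" "proportional (a l) (A + D)" "proportional (a m) (B + s *s D)"
    "proportional (a q) ((1 + s) *s A + B + s *s D)" "proportional (a p) (A + (- s) *s B + D)"
    using nf[OF same_pattern_general(1)[OF pat] refl] by blast
  have "det3 (b u) (b v) (b w) = 0 \<longleftrightarrow> det3 (a u) (a v) (a w) = 0" if "u \<in> S" "v \<in> S" "w \<in> S" for u v w
    using pat that unfolding same_pattern_def by blast
  from nf[OF same_pattern_general(2)[OF pat] this]
  obtain A' B' D' t where b: "det3 A' B' D' \<noteq> 0" "t * t + t + 1 = 0" "proportional (b h) A'" "proportional (b i) B'"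
    "proportional (b j) (A' + B')" "proportional (b k) D'" "proportional (b l) (A' + D')" "proportional (b m) (B' + t *s D')"
    "proportional (b q) ((1 + t) *s A' + B' + t *s D')" "proportional (b p) (A' + (- t) *s B' + D')"
    by blast
  have main: "lines_homeo n a b"
    if \<sigma>: "continuous_on UNIV \<sigma>" "\<And>x y. \<sigma> (x + y) = \<sigma> x + \<sigma> y" "\<And>x y. \<sigma> (x * y) = \<sigma> x * \<sigma> y" "\<And>x. \<sigma> (\<sigma> x) = x"
      "\<sigma> 0 = 0" "\<sigma> 1 = 1" "\<And>x. \<sigma> (- x) = - \<sigma> x" "\<sigma> s = t" for \<sigma> :: "complex \<Rightarrow> complex"
  proof (rule lines_homeo_coordinates[OF a(1) b(1) \<sigma>(1-5)])
    fix u assume "u < n"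
    then have "u \<in> {h,i,j,k,l,m,q,p}" using S Seq by auto
    \<comment> \<open>The coordinates from the normal form. All are polynomials in \<open>s\<close>
      with integer coefficients, so \<sigma> turns them into those for \<open>t\<close>.\<close>
    then have "\<exists>(x, y, z) \<in> {(1,0,0), (0,1,0), (1,1,0), (0,0,1), (1,0,1), (0,1,s), (1 + s,1,s), (1,-s,1)}.
      proportional (a u) (x *s A + y *s B + z *s D) \<and> proportional (b u) (\<sigma> x *s A' + \<sigma> y *s B' + \<sigma> z *s D')"
      using a b by (elim insertE emptyE) (simp_all add: \<sigma>)
    then show "\<exists>x y z. proportional (a u) (x *s A + y *s B + z *s D) \<and> proportional (b u) (\<sigma> x *s A' + \<sigma> y *s B' + \<sigma> z *s D')"
      by blast
  qed
  from primitive_cube_roots[OF a(2) b(2)] show ?thesis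
  proof
    assume "t = s"
    then show ?thesis by (intro main[of "\<lambda>x. x"]) auto
  next
    assume "t = cnj s"
    then show ?thesis by (intro main[of cnj]) (auto intro: continuous_intros)
  qed
qed

section \<open>Arrangements with at most eight lines\<close>

lemma lines_homeo_deformable:
  assumes "2 \<le> n" "same_pattern {..<n} a b" "deformable {..<n} a b"
  shows "lines_homeo n a b"
proof -
  obtain \<gamma> where \<gamma>: "\<forall>i\<in>{..<n}. polycurve (\<gamma> i) \<and> (\<exists>c. c \<noteq> 0 \<and> \<gamma> i 0 = c *s a i) \<and> (\<exists>c. c \<noteq> 0 \<and> \<gamma> i 1 = c *s b i)"
      "\<forall>i\<in>{..<n}. \<forall>j\<in>{..<n}. \<forall>k\<in>{..<n}. det3 (a i) (a j) (a k) = 0 \<longrightarrow> (\<forall>t. det3 (\<gamma> i t) (\<gamma> j t) (\<gamma> k t) = 0)"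
    using assms(3) unfolding deformable_def by blast
  show ?thesis
    by (rule lines_homeo_along_curve[OF assms(1), where \<gamma> = \<gamma>])
      (use assms(2) \<gamma> in \<open>auto simp: same_pattern_def line_arrangement_iff\<close>)
qed

lemma lines_homeo_le_8_of_ge_2:
  assumes "2 \<le> n" "n \<le> 8" and pat: "same_pattern {..<n} a b"
  shows "lines_homeo n a b"
proof -
  let ?heavy = "concurrency.heavy {..<n} (\<lambda>i j k. det3 (a i) (a j) (a k) = 0)"
  consider "n \<le> 7" | h where "n = 8" "h < n" "\<not> ?heavy h" | "n = 8" "\<And>h. h < n \<Longrightarrow> ?heavy h"
    using assms(2) by fastforce
  then show ?thesis
  proof cases
    case 1
    then have "deformable {..<n} a b" by (intro deformable_le_7 pat) simp_all
    then show ?thesis by (rule lines_homeo_deformable[OF assms(1) pat])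
  next
    case 2
    have "deformable ({..<n} - {h}) a b"
      using 2 by (intro deformable_le_7 same_pattern_subset[OF pat]) simp_all
    then have "deformable {..<n} a b" using deformable_remove[OF _ pat] 2(2,3) by simp
    then show ?thesis by (rule lines_homeo_deformable[OF assms(1) pat])
  next
    case 3
    then show ?thesis by (intro maclane_lines_homeo[OF _ refl pat]) simp_all
  qed
qed

lemma crs_anticomm: "crs v u = - crs u v"
  by (simp add: vec3_eq_iff)

lemma ex_crs_nonzero: "\<exists>v. v \<noteq> 0 \<and> (u \<noteq> 0 \<longrightarrow> crs u v \<noteq> 0)"
proof (cases "u$1 = 0 \<and> u$2 = 0")
  case True
  then show ?thesis by (intro exI[of _ "vector [1,0,0]"]) (auto simp: vec3_eq_iff)
next
  case False
  then show ?thesis by (intro exI[of _ "vector [0,0,1]"]) (auto simp: vec3_eq_iff)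
qed

text \<open>The averaging over intersection points needs at least one of them on every line.\<close>

lemma extend_to_two_lines:
  assumes "line_arrangement n a" "n < 2"
  shows "\<exists>a'. line_arrangement 2 a' \<and> (\<forall>i<n. a' i = a i)"
proof -
  obtain u where u: "u \<noteq> 0" "n = 1 \<Longrightarrow> u = a 0"
  proof (cases "n = 1")
    case True
    then show ?thesis using that[of "a 0"] assms(1) by (auto simp: line_arrangement_iff)
  next
    case False
    then show ?thesis using that[of 1] by auto
  qed
  obtain v where v: "v \<noteq> 0" "crs u v \<noteq> 0" using ex_crs_nonzero u(1) by blast
  then have "crs v u \<noteq> 0" by (metis add.inverse_neutral crs_anticomm)
  then have "line_arrangement 2 (\<lambda>i. if i = 0 then u else v)"
    using u(1) v by (auto simp: line_arrangement_iff less_2_cases_iff)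
  moreover have "\<forall>i<n. (if i = 0 then u else v) = a i" using u(2) assms(2) by (auto simp: less_2_cases_iff)
  ultimately show ?thesis by (intro exI[of _ "\<lambda>i. if i = 0 then u else v"]) auto
qed

lemma lines_homeo_le_8:
  assumes a: "line_arrangement n a" and b: "line_arrangement n b" and "n \<le> 8"
    and inc: "incidence n a = incidence n b"
  shows "lines_homeo n a b"
proof (cases "2 \<le> n")
  case True
  have "det3 (a i) (a j) (a k) = 0 \<longleftrightarrow> det3 (b i) (b j) (b k) = 0" if "i < n" "j < n" "k < n" for i j k
  proof (cases "i \<noteq> j \<and> j \<noteq> k \<and> i \<noteq> k")
    case True
    then show ?thesis using incidence_iff_det3[OF a that] incidence_iff_det3[OF b that] inc by simp
  next
    case False
    then show ?thesis by auto
  qed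
  then have "same_pattern {..<n} a b"
    using a b unfolding same_pattern_def line_arrangement_iff by simp
  then show ?thesis using True assms(3) by (intro lines_homeo_le_8_of_ge_2)
next
  case False
  obtain a' b' where a': "line_arrangement 2 a'" "\<forall>i<n. a' i = a i" and b': "line_arrangement 2 b'" "\<forall>i<n. b' i = b i"
    using extend_to_two_lines[OF a] extend_to_two_lines[OF b] False by auto
  \<comment> \<open>Among two indices every triple has a repetition, so all determinants vanish on
    both sides.\<close>
  have "same_pattern {..<2} a' b'"
    using a'(1) b'(1) unfolding same_pattern_def line_arrangement_iff by (auto simp: less_2_cases_iff)
  then have "lines_homeo 2 a' b'" by (intro lines_homeo_le_8_of_ge_2) auto
  then obtain F where F: "homeomorphic_map P2_top P2_top F" "\<forall>i<2. F ` proj_line (a' i) = proj_line (b' i)"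
    unfolding lines_homeo_def by blast
  have "F ` proj_line (a i) = proj_line (b i)" if "i < n" for i
    using F(2) a'(2) b'(2) that False by (metis leI less_le_trans less_imp_le)
  then show ?thesis unfolding lines_homeo_def using F(1) by blast
qed

text \<open>On the curve \<open>(1, t, t^2)\<close> a line becomes a nonzero polynomial of degree at
  most two, so finitely many lines leave infinitely many of its points uncovered.\<close>

lemma ex_point_off_lines:
  assumes "\<And>i. i < n \<Longrightarrow> a i \<noteq> 0"
  shows "P2 - arr_union n a \<noteq> {}"
proof -
  define v where "v t = (vector [1, t, t * t] :: complex^3)" for t
  have "finite {t. dot (a i) (v t) = 0}" if "i < n" for i
  proof -
    have eq: "dot (a i) (v t) = poly [:a i $ 1, a i $ 2, a i $ 3:] t" for t
      by (simp add: v_def dot_3 algebra_simps)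
    have "[:a i $ 1, a i $ 2, a i $ 3:] \<noteq> 0" using assms[OF that] by (auto simp: vec3_eq_iff)
    then show ?thesis unfolding eq by (rule poly_roots_finite)
  qed
  then have "finite (\<Union>i<n. {t. dot (a i) (v t) = 0})" by auto
  then obtain t where t: "t \<notin> (\<Union>i<n. {t. dot (a i) (v t) = 0})"
    using infinite_UNIV_char_0 ex_new_if_finite by blast
  have "v t \<noteq> 0" by (auto simp: v_def vec3_eq_iff)
  then have "proj_pt (v t) \<in> P2 - arr_union n a"
    using t by (auto simp: arr_union_def proj_pt_in_line_iff)
  then show ?thesis by blast
qed

theorem mainTheorem9:
  fixes n :: nat and a1 a2 :: "nat \<Rightarrow> complex^3"
  assumes "line_arrangement n a1" and "line_arrangement n a2"
    and "n \<le> 8"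
    and "incidence n a1 = incidence n a2"
  shows "(\<exists>f. homeomorphic_map P2_top P2_top f \<and> f ` arr_union n a1 = arr_union n a2) \<and>
         (\<exists>x1 \<in> topspace (complement_top n a1). \<exists>x2 \<in> topspace (complement_top n a2).
            fundamental_group (complement_top n a1) x1 \<cong> fundamental_group (complement_top n a2) x2)"
proof -
  obtain f where f: "homeomorphic_map P2_top P2_top f" "\<forall>i<n. f ` proj_line (a1 i) = proj_line (a2 i)"
    using lines_homeo_le_8[OF assms] unfolding lines_homeo_def by blast
  have union: "f ` arr_union n a1 = arr_union n a2"
    using f(2) unfolding arr_union_def image_UN by (intro SUP_cong) auto
  obtain g where g: "homeomorphic_maps P2_top P2_top f g" using f(1) homeomorphic_map_maps by blast
  have inj: "inj_on f P2" and surj: "f ` P2 = P2"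
    using homeomorphic_imp_injective_map[OF f(1)] homeomorphic_imp_surjective_map[OF f(1)] by simp_all
  have sub: "arr_union n a \<subseteq> P2" for a using proj_line_subset unfolding arr_union_def by blast
  have "f ` (P2 - arr_union n a1) = P2 - arr_union n a2"
    using inj_on_image_set_diff[OF inj, of P2 "arr_union n a1"] sub surj union by simp
  then have comp: "homeomorphic_maps (complement_top n a1) (complement_top n a2) f g"
    unfolding complement_top_def by (intro homeomorphic_maps_subtopologies[OF g]) (simp add: Int_absorb1)
  have ts: "topspace (complement_top n a) = P2 - arr_union n a" for a
    by (auto simp: complement_top_def)
  \<comment> \<open>The claim on fundamental groups needs a base point in the complement; its
    partner is the image under \<open>f\<close>.\<close>
  obtain x where x: "x \<in> topspace (complement_top n a1)"
    using ex_point_off_lines[of n a1] assms(1) unfolding ts line_arrangement_def by blast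
  moreover have "f x \<in> topspace (complement_top n a2)"
    using comp x unfolding homeomorphic_maps_def by (meson continuous_map_image_subset_topspace image_subset_iff)
  ultimately show ?thesis using f(1) union fundamental_group_homeo[OF comp x] by blast
qed

end
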